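(* Let $n\ge 3$ be an integer and let $\mathcal{M}\subset\mathbb{R}^n$ be a compact $C^\infty$ non-degenerate curve. Define $$\Theta(n)=\begin{cases}\dfrac{n^2+4}{n(n+4)} & \text{if } n \text{ is even},\\[2mm] \dfrac{n^2+3}{n(n+4)-1} & \text{if } n \text{ is odd}.\end{cases}$$ Then the following hold. (Upper bound) For every $\nu>0$ and every $\Delta>0$ there is a constant $C_{\nu,\Delta}>0$, depending only on $\mathcal{M},n,\nu,\Delta$, such that for all $\delta\in[0,\Delta)$ and all real $q\ge 1$, $$A_{\mathcal{M}}(q,\delta)\le C_{\nu,\Delta}\left(\delta^{n-1}q+q^{\Theta(n)+\nu}\right).$$ (Lower bound) There are constants $C_0>0$ and $c>0$, depending only on $\mathcal{M}$ and $n$, such that for every $\nu>0$ there is a constant $Q_0>0$, depending only on $\mathcal{M},n,\nu$, such that for all real $q\geq 1$ with $q>Q_0$ and all $\delta>C_0\,q^{(\Theta(n)-1)/(n-1)+\nu}$, $$A_{\mathcal{M}}(q,\delta)\ge c\,\delta^{n-1}q.$$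
   Context: A compact $C^\infty$ curve in $\mathbb{R}^n$ means a (nonempty) compact one-dimensional $C^\infty$ submanifold of $\mathbb{R}^n$, possibly with boundary (e.g. an arc such as $\{(t,t^2,\dots,t^n):t\in[0,1]\}$). It is called non-degenerate if for every local parametrization $\{\gamma(t):t\in U\}$ of $\mathcal{M}$ one has $\det[\gamma^{(1)}(t),\gamma^{(2)}(t),\dots,\gamma^{(n)}(t)]\ne 0$ for all $t\in U$, where $\gamma^{(r)}$ denotes the $r$-th derivative. For real $q\ge 1$ and $\delta\ge 0$, the counting function $A_{\mathcal{M}}(q,\delta)$ is the cardinality of $$\{b\in\mathbb{Z}^n:\operatorname{dist}(b,q\mathcal{M})\le\delta\}=\{b\in\mathbb{Z}^n:\operatorname{dist}(b/q,\mathcal{M})\le\delta/q\},$$ where $\operatorname{dist}$ is the Euclidean distance on $\mathbb{R}^n$ and $q\mathcal{M}=\{qx:x\in\mathcal{M}\}$. *)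

theory Defs
  imports "HOL-Analysis.Analysis"
begin

definition vderiv :: "nat \<Rightarrow> (real \<Rightarrow> 'a::real_normed_vector) \<Rightarrow> real \<Rightarrow> 'a" where
  "vderiv k f = ((\<lambda>g t. vector_derivative g (at t)) ^^ k) f"

(* Smoothness on a set that need not be open is smoothness on an open neighbourhood.
   The total function f plays the role of the extension, so at an end point of S
   the derivatives of f are the one-sided derivatives of its restriction to S. *)
definition smooth_on :: "real set \<Rightarrow> (real \<Rightarrow> 'a::real_normed_vector) \<Rightarrow> bool" where
  "smooth_on S f \<longleftrightarrow>
     (\<exists>V. open V \<and> S \<subseteq> V \<and> (\<forall>k. \<forall>t\<in>V. vderiv k f differentiable (at t)))"

(* The parameter domain is open in the line (interior charts) or in the closed half-line
   (charts at boundary points). *)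
definition local_parametrization ::
    "'a::euclidean_space set \<Rightarrow> real set \<Rightarrow> (real \<Rightarrow> 'a) \<Rightarrow> bool" where
  "local_parametrization M U \<gamma> \<longleftrightarrow>
     (open U \<or> openin (top_of_set {0..}) U) \<and>
     smooth_on U \<gamma> \<and>
     (\<forall>t\<in>U. vderiv 1 \<gamma> t \<noteq> 0) \<and>
     (\<exists>\<phi>. homeomorphism U (\<gamma> ` U) \<gamma> \<phi>) \<and>
     openin (top_of_set M) (\<gamma> ` U)"

definition compact_smooth_curve :: "'a::euclidean_space set \<Rightarrow> bool" where
  "compact_smooth_curve M \<longleftrightarrow>
     M \<noteq> {} \<and> compact M \<and>
     (\<forall>x\<in>M. \<exists>U \<gamma>. local_parametrization M U \<gamma> \<and> x \<in> \<gamma> ` U)"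

(* The index type carries no order, so the columns are listed through a bijection \<sigma> with
   1, ..., n; a different \<sigma> changes the determinant at most by a sign. *)
definition nondegenerate :: "(real ^ 'n) set \<Rightarrow> bool" where
  "nondegenerate M \<longleftrightarrow>
     (\<forall>U \<gamma>. local_parametrization M U \<gamma> \<longrightarrow>
       (\<forall>t\<in>U. \<forall>\<sigma> :: 'n \<Rightarrow> nat. bij_betw \<sigma> UNIV {1..CARD('n)} \<longrightarrow>
          det (\<chi> i j. vderiv (\<sigma> j) \<gamma> t $ i) \<noteq> 0))"

definition lattice_count :: "(real ^ 'n) set \<Rightarrow> real \<Rightarrow> real \<Rightarrow> nat" where
  "lattice_count M q \<delta> =
     card {b :: real ^ 'n. (\<forall>i. b $ i \<in> \<int>) \<and> infdist b ((\<lambda>x. q *\<^sub>R x) ` M) \<le> \<delta>}"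

definition Theta :: "nat \<Rightarrow> real" where
  "Theta n = (if even n then (real n ^ 2 + 4) / (real n * (real n + 4))
              else (real n ^ 2 + 3) / (real n * (real n + 4) - 1))"

end

theory Submission
  imports Defs
begin

text \<open>
  Cover the curve by finitely many short arcs. On an arc parametrized by \<open>\<gamma>\<close>, counting lattice
  points within \<open>1/N\<close> of \<open>q\<gamma>\<close> reduces to integrating trigonometric polynomials of degree \<open>N\<close>
  along \<open>q\<gamma>\<close>, so everything follows once the sum over \<open>0 < \<bar>k\<bar> \<le> N\<close> of
  \<open>\<bar>\<integral> exp (2 \<pi> i q k\<cdot>\<gamma>(t)) dt\<bar>\<close> is small. If such an integral exceeds a multiple of \<open>r\<close>, a van der
  Corput argument produces a parameter \<open>t\<close> with \<open>\<bar>k\<cdot>\<gamma>\<^sup>(\<^sup>j\<^sup>)(t)\<bar> \<lesssim> r\<^sup>-\<^sup>j / q\<close> for all \<open>j \<le> n\<close>. By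
  non-degeneracy, these \<open>k\<close> lie in \<open>O(N)\<close> parallelepipeds with sides \<open>min N (1 + r\<^sup>-\<^sup>j / q)\<close>.
  Summing over dyadic \<open>r\<close>, the total is at most \<open>O(log q)\<close> times the maximum over
  \<open>2 \<le> s \<le> n\<close> of \<open>N\<^sup>n\<^sup>-\<^sup>s\<^sup>+\<^sup>2 (Nq)\<^sup>-\<^sup>1\<^sup>/\<^sup>s\<close>, which is small as soon as
  \<open>N < q\<^sup>1\<^sup>/\<^sup>D\<^sup>-\<^sup>\<nu>\<close> with \<open>D = max\<^sub>s (s (n + 2 - s) - 1) = (n - 1) / (1 - \<Theta>(n))\<close>.
\<close>

section \<open>Oscillatory integrals\<close>

text \<open>Only mean squares along an arc are ever evaluated. Such a mean square is the parameter
  length times the energy (the sum of squared coefficients), plus cross terms bounded by the energy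
  times the sum of the integrals; once that sum is small, the arc behaves like the torus up to a
  constant. For the upper bound, a squared product of Dirichlet kernels is a majorant. For the lower
  bound, a function positive only near lattice points must again be a combination of squares:
  \<open>\<tau> * |T|^2\<close> minus the sum over \<open>i\<close> of
  \<open>|1 - e(x_i)|^2 * |T|^2\<close>, where multiplication by \<open>1 - e(x_i)\<close> merely
  differences the coefficients of \<open>T\<close>. The obstacle on the oscillatory side: a lower
  bound for one fixed derivative of the phase only limits the size of \<open>k\<close>. To put
  \<open>k\<close> into a parallelepiped, all derivatives must be small at one common parameter, so
  the order of the large derivative has to be allowed to vary with the parameter. The index
  \<open>s\<close> of the maximum is the least exponent with \<open>r^(-s) >= N q\<close>, where the
  sides get cut off at \<open>N\<close>.\<close>

lemma monotone_level_split:
  fixes g :: "real \<Rightarrow> real"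
  assumes "a \<le> b" and cont: "continuous_on {a..b} g"
    and mono: "\<And>s t. a \<le> s \<Longrightarrow> s \<le> t \<Longrightarrow> t \<le> b \<Longrightarrow> g s \<le> g t"
  obtains x where "a \<le> x" "x \<le> b"
    "x = a \<or> (\<forall>t\<in>{a..x}. g t \<le> y)" "x = b \<or> (\<forall>t\<in>{x..b}. y \<le> g t)"
proof -
  consider "y \<le> g a" | "g b \<le> y" | "g a \<le> y" "y \<le> g b" by linarith
  then show thesis
  proof cases
    case 1
    have "\<forall>t\<in>{a..b}. y \<le> g t" using 1 mono by (metis atLeastAtMost_iff order_refl order_trans)
    then show thesis using that[of a] assms(1) by auto
  next
    case 2
    have "\<forall>t\<in>{a..b}. g t \<le> y" using 2 mono by (metis atLeastAtMost_iff order_refl order_trans)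
    then show thesis using that[of b] assms(1) by auto
  next
    case 3
    then obtain x where x: "a \<le> x" "x \<le> b" "g x = y" using IVT'[of g a y b] assms by auto
    show thesis
      by (rule that[of x]) (use x mono in auto)
  qed
qed

text \<open>The middle range is cut once more at the level 0, so that \<open>g\<close> keeps one
  sign on each piece; the induction in \<open>osc_some_derivative_large\<close> needs that sign. A
  piece reduced to a point carries no information, hence alternatives such as
  \<open>x = a\<close>.\<close>

lemma monotone_threshold_split:
  fixes g :: "real \<Rightarrow> real"
  assumes "a \<le> b" and cont: "continuous_on {a..b} g"
    and mono: "\<And>s t. a \<le> s \<Longrightarrow> s \<le> t \<Longrightarrow> t \<le> b \<Longrightarrow> g s \<le> g t" and "0 < \<tau>"
  obtains x z y where "a \<le> x" "x \<le> z" "z \<le> y" "y \<le> b"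
    "x = a \<or> (\<forall>t\<in>{a..x}. \<tau> \<le> \<bar>g t\<bar>)"
    "z = x \<or> (\<forall>t\<in>{x..z}. g t \<le> 0 \<and> \<bar>g t\<bar> \<le> \<tau>)"
    "y = z \<or> (\<forall>t\<in>{z..y}. 0 \<le> g t \<and> \<bar>g t\<bar> \<le> \<tau>)"
    "y = b \<or> (\<forall>t\<in>{y..b}. \<tau> \<le> \<bar>g t\<bar>)"
proof -
  obtain x where x: "a \<le> x" "x \<le> b"
    "x = a \<or> (\<forall>t\<in>{a..x}. g t \<le> -\<tau>)" "x = b \<or> (\<forall>t\<in>{x..b}. -\<tau> \<le> g t)"
    by (rule monotone_level_split[OF assms(1) cont mono])
  have cx: "continuous_on {x..b} g" by (rule continuous_on_subset[OF cont]) (use x in auto)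
  obtain z where z: "x \<le> z" "z \<le> b"
    "z = x \<or> (\<forall>t\<in>{x..z}. g t \<le> 0)" "z = b \<or> (\<forall>t\<in>{z..b}. 0 \<le> g t)"
    by (rule monotone_level_split[OF x(2) cx mono]) (use x in auto)
  have cz: "continuous_on {z..b} g" by (rule continuous_on_subset[OF cont]) (use x z in auto)
  obtain y where y: "z \<le> y" "y \<le> b"
    "y = z \<or> (\<forall>t\<in>{z..y}. g t \<le> \<tau>)" "y = b \<or> (\<forall>t\<in>{y..b}. \<tau> \<le> g t)"
    by (rule monotone_level_split[OF z(2) cz mono]) (use x z in auto)
  show thesis
  proof (rule that)
    show "a \<le> x" "x \<le> z" "z \<le> y" "y \<le> b" using x y z by auto
    show "x = a \<or> (\<forall>t\<in>{a..x}. \<tau> \<le> \<bar>g t\<bar>)" using x(3) \<open>0 < \<tau>\<close> by force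
    show "z = x \<or> (\<forall>t\<in>{x..z}. g t \<le> 0 \<and> \<bar>g t\<bar> \<le> \<tau>)"
    proof (cases "z = x")
      case False
      then have "x \<noteq> b" using z by auto
      then have "\<forall>t\<in>{x..z}. -\<tau> \<le> g t" using x(4) z by auto
      then show ?thesis using z(3) False \<open>0 < \<tau>\<close> by (auto simp: abs_le_iff)
    qed auto
    show "y = z \<or> (\<forall>t\<in>{z..y}. 0 \<le> g t \<and> \<bar>g t\<bar> \<le> \<tau>)"
    proof (cases "y = z")
      case False
      then have "z \<noteq> b" using y by auto
      then have "\<forall>t\<in>{z..y}. 0 \<le> g t" using z(4) y by auto
      then show ?thesis using y(3) False by auto
    qed auto
    show "y = b \<or> (\<forall>t\<in>{y..b}. \<tau> \<le> \<bar>g t\<bar>)" using y(4) by force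
  qed
qed

text \<open>\<open>D 0\<close> is the phase and \<open>D j\<close> its \<open>j\<close>-th
  derivative. Carrying the whole family lets an induction on the order treat the derivatives as
  given functions, one-sided at the ends of an interval.\<close>

definition deriv_chain :: "(nat \<Rightarrow> real \<Rightarrow> real) \<Rightarrow> real set \<Rightarrow> bool" where
  "deriv_chain D S \<longleftrightarrow>
     (\<forall>j. \<forall>t\<in>S. (D j has_real_derivative D (Suc j) t) (at t within S))"

lemma deriv_chain_subset: "deriv_chain D S \<Longrightarrow> T \<subseteq> S \<Longrightarrow> deriv_chain D T"
  unfolding deriv_chain_def by (meson DERIV_subset subsetD)

lemma deriv_chain_uminus: "deriv_chain D S \<Longrightarrow> deriv_chain (\<lambda>j t. - D j t) S"
  unfolding deriv_chain_def by (auto intro: DERIV_minus)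

lemma deriv_chain_continuous: "deriv_chain D S \<Longrightarrow> continuous_on S (D j)"
  unfolding deriv_chain_def
  by (meson DERIV_atLeastAtMost_imp_continuous_on DERIV_continuous continuous_on_eq_continuous_within)

lemma deriv_chain_mono:
  assumes "deriv_chain D {a..b}" "\<forall>t\<in>{a..b}. 0 \<le> D (Suc j) t" "a \<le> s" "s \<le> t" "t \<le> b"
  shows "D j s \<le> D j t"
proof (rule DERIV_nonneg_imp_increasing_open[OF assms(4)])
  fix x assume "s < x" "x < t"
  then have "x \<in> {a<..<b}" using assms by auto
  moreover have "(D j has_real_derivative D (Suc j) x) (at x within {a..b})"
    using assms \<open>x \<in> {a<..<b}\<close> by (auto simp: deriv_chain_def)
  ultimately have "(D j has_real_derivative D (Suc j) x) (at x)"
    by (metis at_within_Icc_at greaterThanLessThan_iff)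
  then show "\<exists>y. (D j has_real_derivative y) (at x) \<and> 0 \<le> y"
    using assms \<open>x \<in> {a<..<b}\<close> by (intro exI[of _ "D (Suc j) x"]) auto
next
  show "continuous_on {s..t} (D j)"
    by (rule continuous_on_subset[OF deriv_chain_continuous[OF assms(1)]]) (use assms in auto)
qed

definition osc :: "real \<Rightarrow> real \<Rightarrow> (real \<Rightarrow> real) \<Rightarrow> complex" where
  "osc a b f = integral {a..b} (\<lambda>t. cis (f t))"

lemma osc_integrable:
  "continuous_on {a..b} f \<Longrightarrow> (\<lambda>t. cis (f t)) integrable_on {a..b::real}"
  by (intro integrable_continuous_real continuous_on_cis)

lemma osc_split:
  assumes "a \<le> x" "x \<le> b" "continuous_on {a..b} f"
  shows "osc a b f = osc a x f + osc x b f"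
  unfolding osc_def
  using Henstock_Kurzweil_Integration.integral_combine[OF assms(1,2) osc_integrable[OF assms(3)]] by simp

lemma osc_uminus: "norm (osc a b (\<lambda>t. - f t)) = norm (osc a b f)"
proof -
  have "osc a b (\<lambda>t. - f t) = integral {a..b} (\<lambda>t. cnj (cis (f t)))"
    by (simp add: osc_def cis_cnj)
  also have "\<dots> = cnj (osc a b f)" by (simp add: osc_def integral_cnj)
  finally show ?thesis by simp
qed

lemma osc_refl [simp]: "osc a a f = 0"
  by (simp add: osc_def)

lemma osc_trivial:
  assumes "a \<le> b" "continuous_on {a..b} f"
  shows "norm (osc a b f) \<le> b - a"
proof -
  have "norm (osc a b f) \<le> 1 * (b - a)"
    unfolding osc_def by (rule integral_bound) (use assms in \<open>auto intro!: continuous_on_cis\<close>)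
  then show ?thesis by simp
qed

text \<open>Integration by parts with the primitive \<open>cis (D 0 t) / (i * D 1 t)\<close>, which
  contributes at most \<open>1 / \<mu>\<close> at each end. The remaining integral is left explicit
  because it is estimated in two ways: by monotonicity of \<open>D 1\<close>, or by a pointwise
  bound on \<open>D 2\<close>.\<close>

lemma osc_by_parts:
  assumes ab: "a \<le> b" and D: "deriv_chain D {a..b}" and "0 < \<mu>"
    and big: "\<forall>t\<in>{a..b}. \<mu> \<le> \<bar>D 1 t\<bar>"
  shows "norm (osc a b (D 0)) \<le> 2 / \<mu> + integral {a..b} (\<lambda>t. \<bar>D 2 t\<bar> / (D 1 t)\<^sup>2)"
proof -
  have nz: "D 1 t \<noteq> 0" if "t \<in> {a..b}" for t using big that \<open>0 < \<mu>\<close> by force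
  define H where "H t = cis (D 0 t) * complex_of_real (inverse (D 1 t)) / \<i>" for t
  define h where "h t = cis (D 0 t) - cis (D 0 t) * of_real (D 2 t / (D 1 t)\<^sup>2) / \<i>" for t
  have dH: "(H has_vector_derivative h t) (at t within {a..b})" if t: "t \<in> {a..b}" for t
  proof -
    have d0: "(D 0 has_real_derivative D 1 t) (at t within {a..b})"
      and d1: "(D 1 has_real_derivative D 2 t) (at t within {a..b})"
      using D t by (auto simp: deriv_chain_def numeral_2_eq_2)
    have c: "((\<lambda>t. cis (D 0 t)) has_vector_derivative (D 1 t *\<^sub>R (\<i> * cis (D 0 t)))) (at t within {a..b})"
      using has_derivative_cis[OF d0[unfolded has_field_derivative_def]]
      by (simp add: has_vector_derivative_def mult.commute)
    have i: "((\<lambda>t. complex_of_real (inverse (D 1 t))) has_vector_derivative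
        complex_of_real (- (D 2 t) / (D 1 t)\<^sup>2)) (at t within {a..b})"
      using DERIV_inverse'[OF d1 nz[OF t]]
      by (intro has_vector_derivative_of_real)
        (simp add: has_real_derivative_iff_has_vector_derivative field_simps power2_eq_square)
    show ?thesis
      unfolding H_def
      using has_vector_derivative_mult[OF c i, THEN has_vector_derivative_divide, of "\<i>"] nz[OF t]
      by (simp add: h_def field_simps scaleR_conv_of_real power2_eq_square)
  qed
  have int1: "(h has_integral H b - H a) {a..b}"
    by (rule fundamental_theorem_of_calculus[OF ab dH]) auto
  define p where "p t = cis (D 0 t) * of_real (D 2 t / (D 1 t)\<^sup>2) / \<i>" for t
  have cD: "continuous_on {a..b} (D j)" for j by (rule deriv_chain_continuous[OF D])
  have cp: "continuous_on {a..b} p" unfolding p_def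
    by (intro continuous_intros continuous_on_cis cD) (use nz in auto)
  have "((\<lambda>t. h t + p t) has_integral (H b - H a) + integral {a..b} p) {a..b}"
    by (intro has_integral_add int1 integrable_integral integrable_continuous_real cp)
  then have eq: "osc a b (D 0) = (H b - H a) + integral {a..b} p"
    unfolding osc_def by (auto simp: h_def p_def)
  have nH: "norm (H t) \<le> 1 / \<mu>" if "t \<in> {a..b}" for t
  proof -
    have "norm (H t) = 1 / \<bar>D 1 t\<bar>" by (simp add: H_def norm_mult norm_divide norm_inverse field_simps)
    also have "\<dots> \<le> 1 / \<mu>" using big that \<open>0 < \<mu>\<close> by (intro divide_left_mono) (use nz[OF that] in auto)
    finally show ?thesis .
  qed
  have "norm (integral {a..b} p) \<le> integral {a..b} (\<lambda>t. \<bar>D 2 t\<bar> / (D 1 t)\<^sup>2)"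
  proof (rule integral_norm_bound_integral)
    show "p integrable_on {a..b}" by (intro integrable_continuous_real cp)
    show "(\<lambda>t. \<bar>D 2 t\<bar> / (D 1 t)\<^sup>2) integrable_on {a..b}"
      by (intro integrable_continuous_real continuous_intros cD) (use nz in auto)
    show "norm (p t) \<le> \<bar>D 2 t\<bar> / (D 1 t)\<^sup>2" for t
      by (simp add: p_def norm_mult norm_divide norm_power)
  qed
  moreover have "norm (H b - H a) \<le> 1 / \<mu> + 1 / \<mu>"
    using norm_triangle_ineq4[of "H b" "H a"] nH[of a] nH[of b] ab by auto
  moreover have "norm (osc a b (D 0)) \<le> norm (H b - H a) + norm (integral {a..b} p)"
    unfolding eq by (rule norm_triangle_ineq)
  ultimately show ?thesis by auto
qed

lemma continuous_nonzero_sign: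
  fixes g :: "real \<Rightarrow> real"
  assumes "continuous_on {a..b} g" "\<forall>t\<in>{a..b}. g t \<noteq> 0"
  shows "(\<forall>t\<in>{a..b}. 0 < g t) \<or> (\<forall>t\<in>{a..b}. g t < 0)"
proof (rule ccontr)
  assume "\<not> ?thesis"
  then obtain s t where st: "s \<in> {a..b}" "t \<in> {a..b}" "g s \<le> 0" "0 \<le> g t"
    by (auto simp: not_less)
  have "connected (g ` {a..b})"
    by (rule connected_continuous_image[OF assms(1)]) simp
  then have "0 \<in> g ` {a..b}"
    using st connectedD_interval[of "g ` {a..b}" "g s" "g t" 0] by auto
  then show False using assms(2) by force
qed

text \<open>Since \<open>D 2\<close> has one sign, the remainder of \<open>osc_by_parts\<close>
  integrates the exact derivative of \<open>- 1 / D 1\<close> and costs at most another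
  \<open>2 / \<mu>\<close>, whatever the length of the interval.\<close>

lemma osc_first_derivative:
  assumes ab: "a \<le> b" and D: "deriv_chain D {a..b}" and "0 < \<mu>"
    and big: "\<forall>t\<in>{a..b}. \<mu> \<le> \<bar>D 1 t\<bar>" and sgn: "\<forall>t\<in>{a..b}. 0 \<le> D 2 t"
  shows "norm (osc a b (D 0)) \<le> 4 / \<mu>"
proof -
  have nz: "D 1 t \<noteq> 0" if "t \<in> {a..b}" for t using big that \<open>0 < \<mu>\<close> by force
  have "((\<lambda>t. D 2 t / (D 1 t)\<^sup>2) has_integral (- inverse (D 1 b)) - (- inverse (D 1 a))) {a..b}"
  proof (rule fundamental_theorem_of_calculus[OF ab])
    fix t assume t: "t \<in> {a..b}"
    have d1: "(D 1 has_real_derivative D 2 t) (at t within {a..b})"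
      using D t by (auto simp: deriv_chain_def numeral_2_eq_2)
    show "((\<lambda>t. - inverse (D 1 t)) has_vector_derivative D 2 t / (D 1 t)\<^sup>2) (at t within {a..b})"
      using DERIV_minus[OF DERIV_inverse'[OF d1 nz[OF t]]]
      by (simp add: has_real_derivative_iff_has_vector_derivative field_simps power2_eq_square)
  qed
  moreover have "integral {a..b} (\<lambda>t. \<bar>D 2 t\<bar> / (D 1 t)\<^sup>2) = integral {a..b} (\<lambda>t. D 2 t / (D 1 t)\<^sup>2)"
    by (rule integral_cong) (use sgn in auto)
  ultimately have "integral {a..b} (\<lambda>t. \<bar>D 2 t\<bar> / (D 1 t)\<^sup>2) = inverse (D 1 a) - inverse (D 1 b)"
    by (simp add: integral_unique)
  also have "\<dots> \<le> \<bar>inverse (D 1 a)\<bar> + \<bar>inverse (D 1 b)\<bar>" by linarith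
  also have "\<dots> \<le> 1/\<mu> + 1/\<mu>"
    using big ab \<open>0 < \<mu>\<close> nz[of a] nz[of b]
    by (intro add_mono) (auto simp: abs_inverse inverse_eq_divide intro!: divide_left_mono mult_pos_pos)
  finally show ?thesis using osc_by_parts[OF assms(1-4)] by (auto simp: field_simps)
qed

lemma osc_four_pieces:
  assumes "a \<le> x" "x \<le> z" "z \<le> y" "y \<le> b" "continuous_on {a..b} f"
  shows "norm (osc a b f) \<le> norm (osc a x f) + norm (osc x z f) + norm (osc z y f) + norm (osc y b f)"
proof -
  have c: "continuous_on {x..b} f" "continuous_on {z..b} f"
    by (rule continuous_on_subset[OF assms(5)]; use assms in auto)+
  have "osc a b f = osc a x f + (osc x z f + (osc z y f + osc y b f))"
    using osc_split[of a x b f] osc_split[of x z b f] osc_split[of z y b f] assms c by simp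
  then show ?thesis
    by (smt (verit) norm_triangle_ineq)
qed

text \<open>Writing the lower bound as \<open>(1/\<rho>)^m\<close> lets the threshold for
  \<open>D m\<close> in the inductive step use the same \<open>\<rho>\<close>: where
  \<open>|D m|\<close> is below it, the size of \<open>D (Suc m)\<close> forces length at most
  \<open>\<rho>\<close>; elsewhere the induction hypothesis applies. In order one a size bound alone
  does not control the integral, hence the sign condition on \<open>D 2\<close>.\<close>

lemma van_der_corput:
  assumes "a \<le> b" "deriv_chain D {a..b}" "0 < \<rho>" "1 \<le> m"
    and "\<forall>t\<in>{a..b}. (1/\<rho>)^m \<le> \<bar>D m t\<bar>"
    and "m = 1 \<Longrightarrow> (\<forall>t\<in>{a..b}. 0 \<le> D 2 t) \<or> (\<forall>t\<in>{a..b}. D 2 t \<le> 0)"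
  shows "norm (osc a b (D 0)) \<le> 4^m * \<rho>"
  using assms(4,1,2,5,6)
proof (induction m arbitrary: a b D rule: dec_induct)
  case base
  show ?case
  proof (cases "\<forall>t\<in>{a..b}. 0 \<le> D 2 t")
    case True
    then show ?thesis using osc_first_derivative[of a b D "1/\<rho>"] base assms(3) by auto
  next
    case False
    then have "\<forall>t\<in>{a..b}. 0 \<le> - D 2 t" using base by auto
    then show ?thesis
      using osc_first_derivative[of a b "\<lambda>j t. - D j t" "1/\<rho>"] base assms(3)
        deriv_chain_uminus[OF base(2)] osc_uminus[of a b "D 0"] by auto
  qed
next
  case (step m)
  have main: "norm (osc a b (D 0)) \<le> 4 ^ Suc m * \<rho>"
    if ab: "a \<le> b" and D: "deriv_chain D {a..b}" and big: "\<forall>t\<in>{a..b}. (1/\<rho>)^Suc m \<le> D (Suc m) t"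
    for a b D
  proof -
    have pos: "(1/\<rho>)^Suc m > 0" using assms(3) by simp
    have nn: "\<forall>t\<in>{a..b}. 0 \<le> D (Suc m) t" using big pos by (meson less_le_trans less_imp_le)
    have cD: "continuous_on {a..b} (D j)" for j by (rule deriv_chain_continuous[OF D])
    have tpos: "(1/\<rho>)^m > 0" using assms(3) by simp
    obtain x z y where p: "a \<le> x" "x \<le> z" "z \<le> y" "y \<le> b"
      "x = a \<or> (\<forall>t\<in>{a..x}. (1/\<rho>)^m \<le> \<bar>D m t\<bar>)"
      "z = x \<or> (\<forall>t\<in>{x..z}. D m t \<le> 0 \<and> \<bar>D m t\<bar> \<le> (1/\<rho>)^m)"
      "y = z \<or> (\<forall>t\<in>{z..y}. 0 \<le> D m t \<and> \<bar>D m t\<bar> \<le> (1/\<rho>)^m)"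
      "y = b \<or> (\<forall>t\<in>{y..b}. (1/\<rho>)^m \<le> \<bar>D m t\<bar>)"
      by (rule monotone_threshold_split[OF ab cD deriv_chain_mono[OF D nn] tpos])
    have outer: "norm (osc u v (D 0)) \<le> 4^m * \<rho>"
      if uv: "a \<le> u" "u \<le> v" "v \<le> b" "u = v \<or> (\<forall>t\<in>{u..v}. (1/\<rho>)^m \<le> \<bar>D m t\<bar>)" for u v
    proof (cases "u = v")
      case False
      have "deriv_chain D {u..v}" by (rule deriv_chain_subset[OF D]) (use uv in auto)
      moreover have "\<forall>t\<in>{u..v}. 0 \<le> D (Suc m) t" using nn uv by auto
      ultimately show ?thesis
        using step.IH[OF uv(2)] uv False by (auto simp: numeral_2_eq_2)
    qed (use assms(3) in auto)
    have len: "v - u \<le> \<rho>"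
      if uv: "a \<le> u" "u \<le> v" "v \<le> b" and d: "D m v - D m u \<le> (1/\<rho>)^m" for u v
    proof -
      have dc: "deriv_chain (\<lambda>j t. if j = m then D m t - (1/\<rho>)^Suc m * t
          else if j = Suc m then D (Suc m) t - (1/\<rho>)^Suc m else undefined) {}" by (simp add: deriv_chain_def)
      have "(1/\<rho>)^Suc m * (v - u) \<le> D m v - D m u"
      proof (cases "u = v")
        case False
        then have "u < v" using uv by auto
        have "\<exists>l z. z > u \<and> z < v \<and> (D m has_real_derivative l) (at z) \<and> D m v - D m u = (v - u) * l"
        proof (rule MVT[OF \<open>u < v\<close>])
          show "continuous_on {u..v} (D m)" by (rule continuous_on_subset[OF cD]) (use uv in auto)
          fix x assume "u < x" "x < v"
          then have "(D m has_real_derivative D (Suc m) x) (at x within {a..b})" "x \<in> {a<..<b}"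
            using D uv by (auto simp: deriv_chain_def)
          then show "D m differentiable (at x)"
            by (metis at_within_Icc_at greaterThanLessThan_iff real_differentiable_def)
        qed
        then obtain l z where lz: "z > u" "z < v" "(D m has_real_derivative l) (at z)"
          "D m v - D m u = (v - u) * l" by blast
        have "(D m has_real_derivative D (Suc m) z) (at z within {a..b})" "z \<in> {a<..<b}"
          using D uv lz by (auto simp: deriv_chain_def)
        then have "(D m has_real_derivative D (Suc m) z) (at z)"
          by (metis at_within_Icc_at greaterThanLessThan_iff)
        then have "l = D (Suc m) z" using lz(3) DERIV_unique by blast
        then have "(1/\<rho>)^Suc m \<le> l" using big lz uv by auto
        then show ?thesis using lz(4) uv mult_right_mono[of _ l "v - u"] by (metis diff_ge_0_iff_ge mult.commute)
      qed auto
      with d have "(1/\<rho>)^m * ((v - u)/\<rho>) \<le> (1/\<rho>)^m * 1" by (simp add: field_simps)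
      then have "(v - u)/\<rho> \<le> 1" using tpos by (simp only: mult_le_cancel_left_pos)
      then show ?thesis using assms(3) by (simp add: field_simps)
    qed
    have triv: "norm (osc u v (D 0)) \<le> \<rho>"
      if uv: "a \<le> u" "u \<le> v" "v \<le> b" and d: "u = v \<or> D m v - D m u \<le> (1/\<rho>)^m" for u v
    proof (cases "u = v")
      case False
      have "continuous_on {u..v} (D 0)" by (rule continuous_on_subset[OF cD]) (use uv in auto)
      then show ?thesis using osc_trivial[OF uv(2), of "D 0"] len[OF uv] d False by auto
    qed (use assms(3) in auto)
    have "x = z \<or> D m z - D m x \<le> (1/\<rho>)^m"
    proof (cases "x = z")
      case False
      then have "D m z \<le> 0" "\<bar>D m x\<bar> \<le> (1/\<rho>)^m" using p(2,6) by (metis atLeastAtMost_iff order_refl)+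
      then show ?thesis by linarith
    qed auto
    then have "norm (osc x z (D 0)) \<le> \<rho>"
      by (rule triv[rotated 3]) (use p in linarith)+
    moreover have "z = y \<or> D m y - D m z \<le> (1/\<rho>)^m"
    proof (cases "z = y")
      case False
      then have "0 \<le> D m z" "\<bar>D m y\<bar> \<le> (1/\<rho>)^m" using p(3,7) by (metis atLeastAtMost_iff order_refl)+
      then show ?thesis by linarith
    qed auto
    then have "norm (osc z y (D 0)) \<le> \<rho>"
      by (rule triv[rotated 3]) (use p in linarith)+
    moreover have "norm (osc a x (D 0)) \<le> 4^m * \<rho>" by (rule outer) (use p in auto)
    moreover have "norm (osc y b (D 0)) \<le> 4^m * \<rho>" by (rule outer) (use p in auto)
    ultimately have "norm (osc a b (D 0)) \<le> 2 * (4^m * \<rho>) + 2 * \<rho>"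
      using osc_four_pieces[OF p(1-4) cD, of 0] by linarith
    also have "\<dots> \<le> 4^Suc m * \<rho>"
      using assms(3) one_le_power[of "4::real" m] by (simp add: field_simps)
    finally show ?thesis .
  qed
  have pos: "(1/\<rho>)^Suc m > 0" using assms(3) by simp
  have c: "continuous_on {a..b} (D (Suc m))" by (rule deriv_chain_continuous) fact
  have "(\<forall>t\<in>{a..b}. 0 < D (Suc m) t) \<or> (\<forall>t\<in>{a..b}. D (Suc m) t < 0)"
    by (rule continuous_nonzero_sign[OF c]) (use step.prems(3) pos in force)
  then show ?case
  proof
    assume "\<forall>t\<in>{a..b}. 0 < D (Suc m) t"
    then have "\<forall>t\<in>{a..b}. (1/\<rho>)^Suc m \<le> D (Suc m) t" using step.prems(3) by (metis abs_of_pos)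
    then show ?case using main[OF step.prems(1,2)] by blast
  next
    assume "\<forall>t\<in>{a..b}. D (Suc m) t < 0"
    then have "\<forall>t\<in>{a..b}. (1/\<rho>)^Suc m \<le> - D (Suc m) t" using step.prems(3) by (metis abs_of_neg)
    then show ?case using main[OF step.prems(1) deriv_chain_uminus[OF step.prems(2)]]
      osc_uminus[of a b "D 0"] by metis
  qed
qed

text \<open>The order \<open>j\<close> of the large derivative may change with \<open>t\<close>. The
  sign of \<open>D m\<close> makes \<open>D (m - 1)\<close> monotone, so the interval splits into
  two pieces where \<open>D (m - 1)\<close> is large, handled by \<open>van_der_corput\<close>, and
  two where it is small and of one sign, so that the large derivative has lower order still. For
  \<open>m = 1\<close> the range of \<open>j\<close> is empty and the hypothesis is
  contradictory.\<close>

lemma osc_some_derivative_large: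
  assumes "0 < r" "1 \<le> m" "a \<le> b" "deriv_chain D {a..b}"
    and "(\<forall>t\<in>{a..b}. 0 \<le> D m t) \<or> (\<forall>t\<in>{a..b}. D m t \<le> 0)"
    and "\<forall>t\<in>{a..b}. \<exists>j\<in>{1..<m}. (1/r)^j < \<bar>D j t\<bar>"
  shows "norm (osc a b (D 0)) \<le> 4^m * r"
  using assms(2-6)
proof (induction m arbitrary: a b D rule: dec_induct)
  case base
  then show ?case by fastforce
next
  case (step m)
  have main: "norm (osc a b (D 0)) \<le> 4 ^ Suc m * r"
    if ab: "a \<le> b" and D: "deriv_chain D {a..b}" and nn: "\<forall>t\<in>{a..b}. 0 \<le> D (Suc m) t"
      and ex: "\<forall>t\<in>{a..b}. \<exists>j\<in>{1..<Suc m}. (1/r)^j < \<bar>D j t\<bar>"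
    for a b D
  proof -
    have cD: "continuous_on {a..b} (D j)" for j by (rule deriv_chain_continuous[OF D])
    have tpos: "(1/r)^m > 0" using assms(1) by simp
    obtain x z y where p: "a \<le> x" "x \<le> z" "z \<le> y" "y \<le> b"
      "x = a \<or> (\<forall>t\<in>{a..x}. (1/r)^m \<le> \<bar>D m t\<bar>)"
      "z = x \<or> (\<forall>t\<in>{x..z}. D m t \<le> 0 \<and> \<bar>D m t\<bar> \<le> (1/r)^m)"
      "y = z \<or> (\<forall>t\<in>{z..y}. 0 \<le> D m t \<and> \<bar>D m t\<bar> \<le> (1/r)^m)"
      "y = b \<or> (\<forall>t\<in>{y..b}. (1/r)^m \<le> \<bar>D m t\<bar>)"
      by (rule monotone_threshold_split[OF ab cD deriv_chain_mono[OF D nn] tpos])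
    have outer: "norm (osc u v (D 0)) \<le> 4^m * r"
      if uv: "a \<le> u" "u \<le> v" "v \<le> b" "u = v \<or> (\<forall>t\<in>{u..v}. (1/r)^m \<le> \<bar>D m t\<bar>)" for u v
    proof (cases "u = v")
      case False
      have "deriv_chain D {u..v}" by (rule deriv_chain_subset[OF D]) (use uv in auto)
      moreover have "\<forall>t\<in>{u..v}. 0 \<le> D (Suc m) t" using nn uv by auto
      ultimately show ?thesis
        using van_der_corput[OF uv(2) _ assms(1) step.hyps(1), of D] uv False
        by (auto simp: numeral_2_eq_2)
    qed (use assms(1) in auto)
    have inner: "norm (osc u v (D 0)) \<le> 4^m * r"
      if uv: "a \<le> u" "u \<le> v" "v \<le> b"
        "u = v \<or> ((\<forall>t\<in>{u..v}. 0 \<le> D m t) \<or> (\<forall>t\<in>{u..v}. D m t \<le> 0)) \<and> (\<forall>t\<in>{u..v}. \<bar>D m t\<bar> \<le> (1/r)^m)"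
      for u v
    proof (cases "u = v")
      case False
      have "deriv_chain D {u..v}" by (rule deriv_chain_subset[OF D]) (use uv in auto)
      moreover have "\<exists>j\<in>{1..<m}. (1/r)^j < \<bar>D j t\<bar>" if t: "t \<in> {u..v}" for t
      proof -
        obtain j where "j \<in> {1..<Suc m}" "(1/r)^j < \<bar>D j t\<bar>" using ex t uv by fastforce
        moreover have "\<bar>D m t\<bar> \<le> (1/r)^m" using uv False t by auto
        ultimately show ?thesis by (metis atLeastLessThan_iff less_SucE not_less)
      qed
      ultimately show ?thesis using step.IH[OF uv(2)] uv False by auto
    qed (use assms(1) in auto)
    have "norm (osc x z (D 0)) \<le> 4^m * r" by (rule inner) (use p in auto)
    moreover have "norm (osc z y (D 0)) \<le> 4^m * r" by (rule inner) (use p in auto)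
    moreover have "norm (osc a x (D 0)) \<le> 4^m * r" by (rule outer) (use p in auto)
    moreover have "norm (osc y b (D 0)) \<le> 4^m * r" by (rule outer) (use p in auto)
    ultimately show ?thesis
      using osc_four_pieces[OF p(1-4) cD, of 0] by simp
  qed
  show ?case
  proof (cases "\<forall>t\<in>{a..b}. 0 \<le> D (Suc m) t")
    case True
    then show ?thesis using main[OF step.prems(1,2)] step.prems(4) by auto
  next
    case False
    then have "\<forall>t\<in>{a..b}. D (Suc m) t \<le> 0" using step.prems(3) by auto
    then show ?thesis using main[OF step.prems(1) deriv_chain_uminus[OF step.prems(2)]] step.prems(4)
      osc_uminus[of a b "D 0"] by auto
  qed
qed

section \<open>Frequencies with a large oscillatory integral\<close>

lemma card_PiE_le_prod:
  fixes f :: "'a \<Rightarrow> nat \<Rightarrow> int" and \<beta> :: "nat \<Rightarrow> real"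
  assumes inj: "inj_on f A" and im: "\<And>x. x \<in> A \<Longrightarrow> f x \<in> PiE J T" and J: "finite J"
    and T: "\<And>j. j \<in> J \<Longrightarrow> finite (T j)" "\<And>j. j \<in> J \<Longrightarrow> real (card (T j)) \<le> \<beta> j"
  shows "finite A" "real (card A) \<le> (\<Prod>j\<in>J. \<beta> j)"
proof -
  have fin: "finite (PiE J T)" using J T by (intro finite_PiE) auto
  have sub: "f ` A \<subseteq> PiE J T" using im by auto
  show "finite A" using finite_imageD[OF finite_subset[OF sub fin] inj] .
  have "card A = card (f ` A)" using card_image[OF inj] by simp
  also have "\<dots> \<le> card (PiE J T)" by (rule card_mono[OF fin sub])
  also have "\<dots> = (\<Prod>j\<in>J. card (T j))" by (rule card_PiE[OF J])
  finally have "real (card A) \<le> (\<Prod>j\<in>J. real (card (T j)))" using of_nat_mono by fastforce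
  also have "\<dots> \<le> (\<Prod>j\<in>J. \<beta> j)" by (rule prod_mono) (use T in auto)
  finally show "real (card A) \<le> (\<Prod>j\<in>J. \<beta> j)" .
qed

lemma Ints_abs_less_one: "x \<in> \<int> \<Longrightarrow> \<bar>x\<bar> < 1 \<Longrightarrow> x = (0::real)"
  by (metis Ints_nonzero_abs_less1)

definition lattice :: "(real ^ 'n) set" where
  "lattice = {k. \<forall>i. k $ i \<in> \<int>}"

definition lattice_box :: "real \<Rightarrow> (real ^ 'n) set" where
  "lattice_box N = {k \<in> lattice. \<forall>i. \<bar>k $ i\<bar> \<le> N}"

lemma lattice_diff: "x \<in> lattice \<Longrightarrow> y \<in> lattice \<Longrightarrow> x - y \<in> lattice"
  by (auto simp: lattice_def)

lemma lattice_norm_less_one: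
  assumes "x \<in> lattice" "norm x < 1" shows "x = 0"
proof (rule vec_eq_iff[THEN iffD2], rule allI)
  fix i
  have "\<bar>x $ i\<bar> < 1" using assms(2) component_le_norm_cart[of x i] by linarith
  then show "x $ i = 0 $ i" using assms(1) Ints_abs_less_one by (auto simp: lattice_def)
qed

lemma norm_lattice_box:
  fixes k :: "real ^ 'n" and N :: real
  assumes "k \<in> lattice_box N" shows "norm k \<le> CARD('n) * N"
proof -
  have "norm k \<le> (\<Sum>i\<in>UNIV. \<bar>k $ i\<bar>)" by (rule norm_le_l1_cart)
  also have "\<dots> \<le> (\<Sum>i\<in>(UNIV::'n set). N)" by (rule sum_mono) (use assms in \<open>auto simp: lattice_box_def\<close>)
  finally show ?thesis by simp
qed

lemma lattice_near_point:
  fixes y :: "real ^ 'n"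
  assumes "0 \<le> \<rho>"
  shows "finite {k \<in> lattice. norm (k - y) \<le> \<rho>}"
    "real (card {k \<in> lattice. norm (k - y) \<le> \<rho>}) \<le> (2 * \<rho> + 2) ^ CARD('n)"
proof -
  let ?A = "{k \<in> lattice. norm (k - y) \<le> \<rho>}"
  obtain \<sigma> :: "nat \<Rightarrow> 'n" where \<sigma>: "bij_betw \<sigma> {0..<CARD('n)} UNIV"
    using ex_bij_betw_nat_finite[of "UNIV::'n set"] by auto
  define f where "f k = (\<lambda>j\<in>{0..<CARD('n)}. \<lfloor>k $ \<sigma> j\<rfloor>)" for k :: "real^'n"
  have inj: "inj_on f ?A"
  proof
    fix x z assume xz: "x \<in> ?A" "z \<in> ?A" "f x = f z"
    show "x = z"
    proof (rule vec_eq_iff[THEN iffD2], rule allI)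
      fix i
      obtain j where j: "j < CARD('n)" "i = \<sigma> j" using \<sigma> by (metis UNIV_I atLeastLessThan_iff bij_betw_imp_surj_on imageE)
      have "f x j = f z j" using xz by simp
      then have "\<lfloor>x $ i\<rfloor> = \<lfloor>z $ i\<rfloor>" using j by (simp add: f_def)
      moreover have "x $ i \<in> \<int>" "z $ i \<in> \<int>" using xz by (auto simp: lattice_def)
      ultimately show "x $ i = z $ i" by (metis Ints_cases floor_of_int)
    qed
  qed
  have im: "f x \<in> PiE {0..<CARD('n)} (\<lambda>j. {\<lfloor>y $ \<sigma> j - \<rho>\<rfloor>..\<lfloor>y $ \<sigma> j + \<rho>\<rfloor>})" if x: "x \<in> ?A" for x
  proof -
    have "\<lfloor>y $ i - \<rho>\<rfloor> \<le> \<lfloor>x $ i\<rfloor>" "\<lfloor>x $ i\<rfloor> \<le> \<lfloor>y $ i + \<rho>\<rfloor>" for i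
      using x component_le_norm_cart[of "x - y" i] by (auto intro!: floor_mono simp: abs_le_iff)
    then show ?thesis by (auto simp: f_def)
  qed
  have cd: "real (card {\<lfloor>y $ \<sigma> j - \<rho>\<rfloor>..\<lfloor>y $ \<sigma> j + \<rho>\<rfloor>}) \<le> 2 * \<rho> + 2" for j
  proof -
    have "\<lfloor>y $ \<sigma> j - \<rho>\<rfloor> \<le> \<lfloor>y $ \<sigma> j + \<rho>\<rfloor>" using assms by (intro floor_mono) auto
    then show ?thesis by simp linarith
  qed
  have "finite ?A \<and> real (card ?A) \<le> (\<Prod>j\<in>{0..<CARD('n)}. 2 * \<rho> + 2)"
    using card_PiE_le_prod[OF inj im _ _ cd] by simp
  then show "finite ?A" "real (card ?A) \<le> (2 * \<rho> + 2) ^ CARD('n)" by auto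
qed

lemma finite_lattice_box: "finite (lattice_box N :: (real ^ 'n) set)"
proof (cases "N \<ge> 0")
  case True
  have "(lattice_box N :: (real^'n) set) \<subseteq> {k \<in> lattice. norm (k - 0) \<le> real CARD('n) * N}"
  proof
    fix k :: "real ^ 'n" assume "k \<in> lattice_box N"
    then show "k \<in> {k \<in> lattice. norm (k - 0) \<le> real CARD('n) * N}"
      using norm_lattice_box[of k N] by (auto simp: lattice_box_def)
  qed
  then show ?thesis
    by (rule finite_subset) (use True in \<open>auto intro!: lattice_near_point(1)[where y = 0, simplified]\<close>)
next
  case False
  then have "lattice_box N = ({} :: (real ^ 'n) set)" by (force simp: lattice_box_def)
  then show ?thesis by simp
qed

lemma card_lattice_box:
  fixes N :: real
  assumes "1 \<le> N"
  shows "real (card (lattice_box N :: (real ^ 'n) set)) \<le> (4 * CARD('n) * N) ^ CARD('n)"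
proof -
  have n: "real CARD('n) \<ge> 1" by (simp add: Suc_leI)
  have nN: "real CARD('n) * N \<ge> 1" using mult_mono[of 1 "real CARD('n)" 1 N] n assms by auto
  have "card (lattice_box N :: (real ^ 'n) set) \<le> card {k \<in> lattice. norm (k - (0::real^'n)) \<le> CARD('n) * N}"
    by (rule card_mono[OF lattice_near_point(1)]) (use norm_lattice_box nN in \<open>auto simp: lattice_box_def\<close>)
  also have "real \<dots> \<le> (2 * (CARD('n) * N) + 2) ^ CARD('n)"
    by (rule lattice_near_point(2)) (use nN in auto)
  also have "\<dots> \<le> (4 * CARD('n) * N) ^ CARD('n)"
    by (rule power_mono) (use nN in \<open>auto simp: mult_ac\<close>)
  finally show ?thesis by simp
qed

text \<open>\<open>G j\<close> is the \<open>j\<close>-th derivative of the parametrization. In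
  \<open>nondeg\<close> the order \<open>m\<close> depends on \<open>k\<close> but not on
  \<open>t\<close>; this holds on short arcs and lets one estimate cover the whole interval.
  \<open>bounded\<close> goes one order past the dimension to make the derivatives up to the
  dimension Lipschitz. \<open>chord\<close> keeps together the parameters whose points are near one
  lattice point.\<close>

locale nondegenerate_arc =
  fixes G :: "nat \<Rightarrow> real \<Rightarrow> real ^ 'n" and a b c B :: real
  assumes ab: "a < b" and c_pos: "0 < c"
    and deriv: "t \<in> {a..b} \<Longrightarrow> (G j has_vector_derivative G (Suc j) t) (at t within {a..b})"
    and bounded: "j \<le> Suc CARD('n) \<Longrightarrow> t \<in> {a..b} \<Longrightarrow> norm (G j t) \<le> B"
    and nondeg: "\<exists>m\<in>{1..CARD('n)}. \<forall>t\<in>{a..b}. c * norm k \<le> \<bar>k \<bullet> G m t\<bar>"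
    and chord: "s \<in> {a..b} \<Longrightarrow> t \<in> {a..b} \<Longrightarrow> c * \<bar>s - t\<bar> \<le> norm (G 0 s - G 0 t)"
begin

lemma B_nonneg: "0 \<le> B"
  using bounded[of 0 a] ab norm_ge_zero[of "G 0 a"] by (simp del: norm_ge_zero)

definition wave :: "real \<Rightarrow> real ^ 'n \<Rightarrow> complex" where
  "wave q k = osc a b (\<lambda>t. 2 * pi * q * (k \<bullet> G 0 t))"

lemma wave_deriv_chain: "deriv_chain (\<lambda>j t. 2 * pi * q * (k \<bullet> G j t)) {a..b}"
  unfolding deriv_chain_def has_real_derivative_iff_has_vector_derivative
proof (intro allI ballI)
  fix j t assume "t \<in> {a..b}"
  then have "((\<lambda>t. k \<bullet> G j t) has_vector_derivative k \<bullet> G (Suc j) t) (at t within {a..b})"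
    using bounded_linear.has_vector_derivative[OF bounded_linear_inner_right[of k] deriv[of t j]] by simp
  then show "((\<lambda>t. 2 * pi * q * (k \<bullet> G j t)) has_vector_derivative 2 * pi * q * (k \<bullet> G (Suc j) t))
      (at t within {a..b})"
    using has_vector_derivative_mult_right by blast
qed

lemma continuous_G: "continuous_on {a..b} (G j)"
  by (meson continuous_on_eq_continuous_within deriv has_vector_derivative_continuous)

lemma wave_trivial: "norm (wave q k) \<le> b - a"
  unfolding wave_def using deriv_chain_continuous[OF wave_deriv_chain, of q k 0] ab
  by (intro osc_trivial) auto

lemma G_lipschitz:
  assumes "j \<le> CARD('n)" "s \<in> {a..b}" "t \<in> {a..b}"
  shows "norm (G j s - G j t) \<le> B * \<bar>s - t\<bar>"
proof -
  have "norm (G j s - G j t) \<le> B * norm (s - t)"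
  proof (rule differentiable_bound[of "{a..b}" "G j" "\<lambda>x h. h *\<^sub>R G (Suc j) x"])
    fix x assume x: "x \<in> {a..b}"
    show "(G j has_derivative (\<lambda>h. h *\<^sub>R G (Suc j) x)) (at x within {a..b})"
      using deriv[OF x] by (simp add: has_vector_derivative_def)
    show "onorm (\<lambda>h. h *\<^sub>R G (Suc j) x) \<le> B"
      by (rule onorm_le) (use bounded[of "Suc j" x] assms x in
        \<open>auto simp: mult.commute[of B] intro: mult_left_mono\<close>)
  qed (use assms in auto)
  then show ?thesis by simp
qed

lemma abs_inner_le:
  assumes "j \<le> Suc CARD('n)" "t \<in> {a..b}"
  shows "\<bar>k \<bullet> G j t\<bar> \<le> B * norm k"
  using Cauchy_Schwarz_ineq2[of k "G j t"] bounded[OF assms] mult_left_mono[of "norm (G j t)" B "norm k"]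
  by (simp add: mult.commute)

text \<open>For \<open>m = 1\<close> no sign of the second derivative is available, so
  \<open>osc_first_derivative\<close> does not apply. Instead
  \<open>|D 2| <= (B / c) * \<mu>\<close> bounds the remainder pointwise, at the cost of a factor
  \<open>b - a\<close>.\<close>

lemma wave_first_derivative:
  assumes q: "q > 0" and k: "k \<noteq> 0" and big: "\<forall>t\<in>{a..b}. c * norm k \<le> \<bar>k \<bullet> G 1 t\<bar>"
  shows "norm (wave q k) \<le> (2 + (b - a) * B / c) / (2 * pi * q * (c * norm k))"
proof -
  define \<mu> where "\<mu> = 2 * pi * q * (c * norm k)"
  define D where "D j t = 2 * pi * q * (k \<bullet> G j t)" for j t
  have D: "deriv_chain D {a..b}" unfolding D_def by (rule wave_deriv_chain)
  have cD: "continuous_on {a..b} (D j)" for j by (rule deriv_chain_continuous[OF D])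
  have \<mu>: "\<mu> > 0" using q k c_pos by (simp add: \<mu>_def)
  have D1: "\<mu> \<le> \<bar>D 1 t\<bar>" if "t \<in> {a..b}" for t
    using big that q by (auto simp: D_def \<mu>_def abs_mult intro!: mult_left_mono)
  have "norm (osc a b (D 0)) \<le> 2 / \<mu> + integral {a..b} (\<lambda>t. \<bar>D 2 t\<bar> / (D 1 t)\<^sup>2)"
    using osc_by_parts[OF _ D \<mu>] D1 ab by auto
  moreover have "integral {a..b} (\<lambda>t. \<bar>D 2 t\<bar> / (D 1 t)\<^sup>2) \<le> integral {a..b} (\<lambda>t. (B / c) / \<mu>)"
  proof (rule integral_le)
    have "D 1 t \<noteq> 0" if "t \<in> {a..b}" for t using D1[OF that] \<mu> by auto
    then show "(\<lambda>t. \<bar>D 2 t\<bar> / (D 1 t)\<^sup>2) integrable_on {a..b}"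
      by (intro integrable_continuous_real continuous_intros cD) auto
    fix t assume t: "t \<in> {a..b}"
    have "\<bar>D 2 t\<bar> \<le> 2 * pi * q * (B * norm k)"
      using abs_inner_le[of 2 t k] t q by (auto simp: D_def abs_mult Suc_leI intro!: mult_left_mono)
    also have "\<dots> = (B / c) * \<mu>" using c_pos by (simp add: \<mu>_def)
    finally have "\<bar>D 2 t\<bar> / (D 1 t)\<^sup>2 \<le> ((B / c) * \<mu>) / \<mu>\<^sup>2"
      using D1[OF t] \<mu> B_nonneg c_pos
      by (intro frac_le) (auto simp: power2_le_iff_abs_le intro: power_mono[of \<mu> "\<bar>D 1 t\<bar>" 2, simplified])
    then show "\<bar>D 2 t\<bar> / (D 1 t)\<^sup>2 \<le> (B / c) / \<mu>" using \<mu> by (simp add: power2_eq_square)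
  qed auto
  ultimately have "norm (osc a b (D 0)) \<le> 2 / \<mu> + (b - a) * ((B / c) / \<mu>)"
    using ab by simp
  moreover have "wave q k = osc a b (D 0)" by (simp add: wave_def D_def[abs_def])
  ultimately show ?thesis by (simp add: \<mu>_def add_divide_distrib)
qed

text \<open>A sum dominating each constant that arises in \<open>large_wave_imp_flat_point\<close>.
  The summand \<open>b - a\<close> makes \<open>norm (wave q k) / wave_const\<close> at most 1, so
  that only levels \<open>r <= 1\<close> can be nonempty.\<close>

definition wave_const :: real where
  "wave_const = 4 ^ CARD('n) + B / c * (2 + (b - a) * B / c) + B / c + 1 + (b - a)"

lemma wave_const_ge:
  "1 \<le> wave_const" "4 ^ CARD('n) \<le> wave_const" "B / c \<le> wave_const" "b - a \<le> wave_const"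
  "B / c * (2 + (b - a) * B / c) \<le> wave_const"
proof -
  have "0 \<le> B / c" "0 \<le> (b - a) * B / c" using B_nonneg c_pos ab by auto
  moreover from this have "0 \<le> B / c * (2 + (b - a) * B / c)" by (intro mult_nonneg_nonneg) auto
  moreover have "(0::real) \<le> 4 ^ CARD('n)" by simp
  ultimately show "1 \<le> wave_const" "4 ^ CARD('n) \<le> wave_const" "B / c \<le> wave_const" "b - a \<le> wave_const"
    "B / c * (2 + (b - a) * B / c) \<le> wave_const"
    using ab unfolding wave_const_def by linarith+
qed

text \<open>The uniformly large derivative of order \<open>m\<close> first bounds
  \<open>norm k\<close> by a multiple of \<open>(1/r)^m / q\<close>, which settles all orders
  \<open>j >= m\<close> at every parameter because \<open>r <= 1\<close>. If each \<open>t\<close>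
  had a large derivative of order below \<open>m\<close>, then
  \<open>osc_some_derivative_large\<close> would contradict \<open>large\<close>; so some
  \<open>t\<close> has all of them small at once.\<close>

lemma large_wave_imp_flat_point:
  assumes q: "q > 0" and r: "0 < r" "r \<le> 1" and large: "wave_const * r < norm (wave q k)"
  shows "\<exists>t\<in>{a..b}. \<forall>j\<in>{1..CARD('n)}. \<bar>k \<bullet> G j t\<bar> \<le> wave_const * ((1/r)^j / q)"
proof (cases "k = 0")
  case True
  then show ?thesis using ab q r wave_const_ge(1) by (intro bexI[of _ a]) auto
next
  case False
  define n where "n = CARD('n)"
  obtain m where m: "m \<in> {1..n}" "\<forall>t\<in>{a..b}. c * norm k \<le> \<bar>k \<bullet> G m t\<bar>"
    using nondeg unfolding n_def by blast
  have pw: "(1/r)^i \<le> (1/r)^j" if "i \<le> j" for i j using that r by (intro power_increasing) auto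
  have upper: "\<bar>k \<bullet> G j t\<bar> \<le> wave_const * ((1/r)^j / q)"
    if K: "norm k \<le> K / c * ((1/r)^i / q)" "B / c * K \<le> wave_const" "i \<le> j" "j \<le> n" "t \<in> {a..b}" for K i j t
  proof -
    have "\<bar>k \<bullet> G j t\<bar> \<le> B * norm k" using abs_inner_le[of j t k] that by (auto simp: n_def)
    also have "\<dots> \<le> B * (K / c * ((1/r)^i / q))" using K(1) B_nonneg by (intro mult_left_mono)
    also have "\<dots> = (B / c * K) * ((1/r)^i / q)" by simp
    also have "\<dots> \<le> wave_const * ((1/r)^i / q)" using K(2) q r by (intro mult_right_mono) auto
    also have "\<dots> \<le> wave_const * ((1/r)^j / q)"
      using pw[OF K(3)] q wave_const_ge(1) by (intro mult_left_mono divide_right_mono) auto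
    finally show ?thesis .
  qed
  have twopi: "2 * pi \<ge> 1" using pi_gt3 by simp
  show ?thesis
  proof (cases "m = 1")
    case True
    define K where "K = 2 + (b - a) * B / c"
    have K: "K > 0" using ab B_nonneg c_pos by (auto simp: K_def intro: add_pos_nonneg)
    have kp: "norm k > 0" using False by simp
    have "wave_const * r < K / (2 * pi * q * (c * norm k))"
      using wave_first_derivative[OF q False] m True large by (auto simp: K_def)
    moreover have "r \<le> wave_const * r" using r wave_const_ge(1) by simp
    moreover have "K / (2 * pi * q * (c * norm k)) \<le> K / (1 * (q * (c * norm k)))"
      using twopi K q c_pos kp
      by (intro divide_left_mono) (auto simp: mult.assoc intro!: mult_right_mono mult_pos_pos)
    ultimately have "r \<le> K / (q * (c * norm k))" by simp
    then have "norm k \<le> K / c * ((1/r)^1 / q)" using q c_pos kp r by (simp add: field_simps)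
    then have "\<bar>k \<bullet> G j a\<bar> \<le> wave_const * ((1/r)^j / q)" if "j \<in> {1..n}" for j
      by (rule upper) (use that ab wave_const_ge(5) in \<open>auto simp: K_def\<close>)
    then show ?thesis using ab unfolding n_def by (intro bexI[of _ a]) auto
  next
    case False
    then have m2: "m \<ge> 2" using m by auto
    define D where "D j t = 2 * pi * q * (k \<bullet> G j t)" for j t
    have D: "deriv_chain D {a..b}" unfolding D_def by (rule wave_deriv_chain)
    define l where "l = 2 * pi * q * (c * norm k)"
    have l: "l > 0" using q \<open>k \<noteq> 0\<close> c_pos by (simp add: l_def)
    have Dm: "l \<le> \<bar>D m t\<bar>" if "t \<in> {a..b}" for t
      using m that q by (auto simp: D_def l_def abs_mult intro!: mult_left_mono)
    have m4: "(4::real)^m \<le> wave_const"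
    proof -
      have "(4::real)^m \<le> 4^CARD('n)" by (rule power_increasing) (use m in \<open>auto simp: n_def\<close>)
      then show ?thesis using wave_const_ge(2) by linarith
    qed
    have large': "4^m * r < norm (osc a b (D 0))"
    proof -
      have "4^m * r \<le> wave_const * r" using m4 r by (intro mult_right_mono) auto
      also have "\<dots> < norm (osc a b (D 0))" using large by (simp add: wave_def D_def[abs_def])
      finally show ?thesis .
    qed
    \<comment> \<open>Chosen so that \<open>(1/\<rho>)^m\<close> is exactly the lower bound
      \<open>l\<close> for \<open>|D m|\<close>; comparing \<open>van_der_corput\<close> with
      \<open>large'\<close> then gives \<open>r < \<rho>\<close>, hence
      \<open>l <= (1/r)^m\<close>.\<close>
    define \<rho> where "\<rho> = root m (1/l)"
    have \<rho>: "\<rho> > 0" "(1/\<rho>)^m = l" using l m2 by (auto simp: \<rho>_def power_divide)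
    have "norm (osc a b (D 0)) \<le> 4^m * \<rho>"
    proof (rule van_der_corput)
      show "\<forall>t\<in>{a..b}. (1/\<rho>)^m \<le> \<bar>D m t\<bar>" unfolding \<rho>(2) using Dm by blast
    qed (use ab D \<rho> m2 in auto)
    with large' have "4^m * r < 4^m * \<rho>" by linarith
    then have "r < \<rho>" by simp
    then have "(1/\<rho>)^m \<le> (1/r)^m" using r \<rho> by (intro power_mono divide_left_mono) auto
    moreover have "1 * (q * (c * norm k)) \<le> 2 * pi * (q * (c * norm k))"
      using twopi q c_pos by (intro mult_right_mono) auto
    ultimately have "q * (c * norm k) \<le> (1/r)^m"
      using \<rho>(2) by (simp add: l_def mult.assoc)
    then have nk: "norm k \<le> 1 / c * ((1/r)^m / q)" using q c_pos r by (simp add: field_simps)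
    have "\<not> (\<forall>t\<in>{a..b}. \<exists>j\<in>{1..<m}. (1/r)^j < \<bar>D j t\<bar>)"
    proof
      assume "\<forall>t\<in>{a..b}. \<exists>j\<in>{1..<m}. (1/r)^j < \<bar>D j t\<bar>"
      moreover have "(\<forall>t\<in>{a..b}. 0 < D m t) \<or> (\<forall>t\<in>{a..b}. D m t < 0)"
        by (rule continuous_nonzero_sign[OF deriv_chain_continuous[OF D]]) (use Dm l in force)
      ultimately have "norm (osc a b (D 0)) \<le> 4^m * r"
        using osc_some_derivative_large[OF r(1) _ _ D, of m] m2 ab by force
      then show False using large' by simp
    qed
    then obtain t where t: "t \<in> {a..b}" "\<And>j. j \<in> {1..<m} \<Longrightarrow> \<bar>D j t\<bar> \<le> (1/r)^j"
      by (auto simp: not_less)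
    have "\<bar>k \<bullet> G j t\<bar> \<le> wave_const * ((1/r)^j / q)" if j: "j \<in> {1..n}" for j
    proof (cases "j < m")
      case True
      have "1 * (q * \<bar>k \<bullet> G j t\<bar>) \<le> \<bar>D j t\<bar>"
        using mult_right_mono[OF twopi, of "q * \<bar>k \<bullet> G j t\<bar>"] q by (simp add: D_def abs_mult mult.assoc)
      also have "\<dots> \<le> (1/r)^j" using t(2) True j by auto
      finally have "\<bar>k \<bullet> G j t\<bar> \<le> 1 * ((1/r)^j / q)" using q r by (simp add: field_simps)
      also have "\<dots> \<le> wave_const * ((1/r)^j / q)" using wave_const_ge(1) q r by (intro mult_right_mono) auto
      finally show ?thesis .
    next
      case False
      show ?thesis by (rule upper[OF nk]) (use False j t wave_const_ge(3) in auto)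
    qed
    then show ?thesis using t(1) unfolding n_def by (intro bexI[of _ t]) auto
  qed
qed

text \<open>Rounding each \<open>k . G j t\<close> down to a multiple of \<open>c / 2\<close> is
  injective on lattice points: two points in one cell differ by a lattice vector that
  \<open>nondeg\<close> forces to have norm below 1/2.\<close>

lemma card_lattice_parallelepiped:
  assumes t: "t \<in> {a..b}" and \<rho>: "\<And>j. 0 \<le> \<rho> j"
  defines "A \<equiv> {k \<in> lattice. \<forall>j\<in>{1..CARD('n)}. \<bar>k \<bullet> G j t\<bar> \<le> \<rho> j}"
  shows "finite A" "real (card A) \<le> (\<Prod>j=1..CARD('n). (4 / c + 2) * (1 + \<rho> j))"
proof -
  define \<eta> where "\<eta> = c / 2"
  have \<eta>: "\<eta> > 0" using c_pos by (simp add: \<eta>_def)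
  define f where "f k = (\<lambda>j\<in>{1..CARD('n)}. \<lfloor>(k \<bullet> G j t) / \<eta>\<rfloor>)" for k
  have inj: "inj_on f A"
  proof
    fix x z assume xz: "x \<in> A" "z \<in> A" "f x = f z"
    obtain m where m: "m \<in> {1..CARD('n)}" "c * norm (x - z) \<le> \<bar>(x - z) \<bullet> G m t\<bar>"
      using nondeg[of "x - z"] t by blast
    have "f x m = f z m" using xz by simp
    then have fl: "\<lfloor>(x \<bullet> G m t) / \<eta>\<rfloor> = \<lfloor>(z \<bullet> G m t) / \<eta>\<rfloor>" using m by (simp add: f_def)
    have "\<bar>(x \<bullet> G m t) / \<eta> - (z \<bullet> G m t) / \<eta>\<bar> < 1" using fl by linarith
    then have "\<bar>(x - z) \<bullet> G m t\<bar> < \<eta>"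
      using \<eta> by (simp add: inner_diff_left diff_divide_distrib[symmetric] abs_divide field_simps)
    then have "c * norm (x - z) < c * (1/2)" using m(2) by (simp add: \<eta>_def)
    then have "norm (x - z) < 1/2" using c_pos by (simp only: mult_less_cancel_left_pos)
    then show "x = z" using lattice_norm_less_one[of "x - z"] xz lattice_diff[of x z] by (auto simp: A_def)
  qed
  have im: "f x \<in> PiE {1..CARD('n)} (\<lambda>j. {\<lfloor>- \<rho> j / \<eta>\<rfloor>..\<lfloor>\<rho> j / \<eta>\<rfloor>})" if x: "x \<in> A" for x
  proof -
    have "\<lfloor>- \<rho> j / \<eta>\<rfloor> \<le> \<lfloor>(x \<bullet> G j t) / \<eta>\<rfloor>" "\<lfloor>(x \<bullet> G j t) / \<eta>\<rfloor> \<le> \<lfloor>\<rho> j / \<eta>\<rfloor>" if "j \<in> {1..CARD('n)}" for j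
    proof -
      have "- \<rho> j \<le> x \<bullet> G j t" "x \<bullet> G j t \<le> \<rho> j"
        using x that unfolding A_def by (force simp: abs_le_iff)+
      then show "\<lfloor>- \<rho> j / \<eta>\<rfloor> \<le> \<lfloor>(x \<bullet> G j t) / \<eta>\<rfloor>" "\<lfloor>(x \<bullet> G j t) / \<eta>\<rfloor> \<le> \<lfloor>\<rho> j / \<eta>\<rfloor>"
        using \<eta> by (auto intro!: floor_mono divide_right_mono simp del: divide_minus_left)
    qed
    then show ?thesis by (auto simp: f_def)
  qed
  have cd: "real (card {\<lfloor>- \<rho> j / \<eta>\<rfloor>..\<lfloor>\<rho> j / \<eta>\<rfloor>}) \<le> (4 / c + 2) * (1 + \<rho> j)" for j
  proof -
    have "0 \<le> \<rho> j / \<eta>" using \<rho>[of j] \<eta> by simp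
    then have "real (card {\<lfloor>- \<rho> j / \<eta>\<rfloor>..\<lfloor>\<rho> j / \<eta>\<rfloor>}) \<le> 2 * (\<rho> j / \<eta>) + 2"
      by simp linarith
    also have "\<dots> = 4 / c * \<rho> j + 2 * 1" using c_pos by (simp add: \<eta>_def)
    also have "\<dots> \<le> (4 / c + 2) * (1 + \<rho> j)" using c_pos \<rho>[of j] by (simp add: field_simps)
    finally show ?thesis .
  qed
  have "finite A \<and> real (card A) \<le> (\<Prod>j=1..CARD('n). (4 / c + 2) * (1 + \<rho> j))"
    using card_PiE_le_prod[OF inj im _ _ cd] by simp
  then show "finite A" "real (card A) \<le> (\<Prod>j=1..CARD('n). (4 / c + 2) * (1 + \<rho> j))" by auto
qed

definition flat_const :: real where
  "flat_const = (b - a + 1) * ((4 / c + 2) * (1 + CARD('n) * B)) ^ CARD('n)"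

text \<open>Moving \<open>t\<close> by \<open>1 / N\<close> changes \<open>k . G j t\<close> by
  \<open>O(1)\<close>, because \<open>norm k <= n * N\<close> and \<open>G j\<close> is Lipschitz.
  So the parameters \<open>a + i / N\<close> suffice, which gives \<open>O(N)\<close>
  parallelepipeds with half-widths enlarged by \<open>n * B\<close>. The trivial bound
  \<open>n * B * N\<close> caps each side at a multiple of \<open>N\<close>.\<close>

lemma card_flat_points:
  assumes N: "1 \<le> N" and \<rho>: "\<And>j. 0 \<le> \<rho> j"
  shows "real (card {k \<in> lattice_box N. \<exists>t\<in>{a..b}. \<forall>j\<in>{1..CARD('n)}. \<bar>k \<bullet> G j t\<bar> \<le> \<rho> j})
    \<le> flat_const * N * (\<Prod>j=1..CARD('n). min N (1 + \<rho> j))"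
proof -
  define n where "n = CARD('n)"
  define \<rho>' where "\<rho>' j = min (n * B * N) (\<rho> j + n * B)" for j
  define P where "P i = {k \<in> lattice. \<forall>j\<in>{1..n}. \<bar>k \<bullet> G j (a + real i / N)\<bar> \<le> \<rho>' j}" for i :: nat
  define m where "m = nat \<lfloor>(b - a) * N\<rfloor>"
  have nB: "real n * B \<ge> 0" using B_nonneg by simp
  have \<rho>'0: "0 \<le> \<rho>' j" for j using nB \<rho>[of j] N by (auto simp: \<rho>'_def)
  have "0 \<le> (b - a) * N" using ab N by simp
  then have mle: "real m \<le> (b - a) * N" unfolding m_def by simp
  have grid: "a + real i / N \<in> {a..b}" if "i \<le> m" for i
  proof -
    have "real i \<le> (b - a) * N" using that mle by linarith
    then have "real i / N \<le> b - a" using N by (simp add: field_simps)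
    then show ?thesis using N by auto
  qed
  let ?S = "{k \<in> lattice_box N. \<exists>t\<in>{a..b}. \<forall>j\<in>{1..CARD('n)}. \<bar>k \<bullet> G j t\<bar> \<le> \<rho> j}"
  have sub: "?S \<subseteq> (\<Union>i\<in>{..m}. P i)"
  proof
    fix k assume "k \<in> ?S"
    then obtain t where k: "k \<in> lattice_box N" and t: "t \<in> {a..b}" "\<And>j. j \<in> {1..n} \<Longrightarrow> \<bar>k \<bullet> G j t\<bar> \<le> \<rho> j"
      by (auto simp: n_def)
    define i where "i = nat \<lfloor>(t - a) * N\<rfloor>"
    have ta: "0 \<le> (t - a) * N" "(t - a) * N \<le> (b - a) * N" using t N by (auto intro!: mult_right_mono)
    have im: "i \<le> m" using ta by (auto simp: i_def m_def intro!: nat_mono floor_mono)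
    have "real i \<le> (t - a) * N" "(t - a) * N < real i + 1" using ta unfolding i_def by (auto simp: of_nat_nat)
    then have "real i / N \<le> t - a" "t - a < (real i + 1) / N" using N by (auto simp: field_simps)
    then have dt: "\<bar>a + real i / N - t\<bar> \<le> 1 / N" by (simp add: add_divide_distrib)
    have nk: "norm k \<le> n * N" using norm_lattice_box[OF k] by (simp add: n_def)
    have "\<bar>k \<bullet> G j (a + real i / N)\<bar> \<le> \<rho>' j" if j: "j \<in> {1..n}" for j
    proof -
      have "\<bar>k \<bullet> G j (a + real i / N)\<bar> \<le> B * norm k"
        by (rule abs_inner_le) (use j grid[OF im] in \<open>auto simp: n_def\<close>)
      also have "\<dots> \<le> B * (n * N)" by (rule mult_left_mono[OF nk B_nonneg])
      finally have 1: "\<bar>k \<bullet> G j (a + real i / N)\<bar> \<le> n * B * N" by (simp add: mult_ac)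
      have "norm (G j (a + real i / N) - G j t) \<le> B * \<bar>a + real i / N - t\<bar>"
        by (rule G_lipschitz) (use j grid[OF im] t in \<open>auto simp: n_def\<close>)
      also have "\<dots> \<le> B * (1 / N)" by (rule mult_left_mono[OF dt B_nonneg])
      finally have "norm k * norm (G j (a + real i / N) - G j t) \<le> (n * N) * (B * (1 / N))"
        using nk N by (intro mult_mono) auto
      also have "\<dots> = n * B" using N by simp
      finally have "\<bar>k \<bullet> (G j (a + real i / N) - G j t)\<bar> \<le> n * B"
        using Cauchy_Schwarz_ineq2 order_trans by blast
      then have "\<bar>k \<bullet> G j (a + real i / N)\<bar> \<le> \<rho> j + n * B"
        using t(2)[OF j] by (simp add: inner_diff_right)
      with 1 show ?thesis by (simp add: \<rho>'_def)
    qed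
    then have "k \<in> P i" using k by (auto simp: P_def lattice_box_def)
    then show "k \<in> (\<Union>i\<in>{..m}. P i)" using im by auto
  qed
  have P: "finite (P i)" "real (card (P i)) \<le> (\<Prod>j=1..n. (4 / c + 2) * (1 + \<rho>' j))" if "i \<le> m" for i
    using card_lattice_parallelepiped[OF grid[OF that], of \<rho>'] \<rho>'0 by (auto simp: P_def n_def)
  have "card ?S \<le> card (\<Union>i\<in>{..m}. P i)" by (rule card_mono[OF _ sub]) (use P in auto)
  also have "\<dots> \<le> (\<Sum>i\<in>{..m}. card (P i))" by (rule card_UN_le) simp
  finally have "real (card ?S) \<le> (\<Sum>i\<in>{..m}. real (card (P i)))" using of_nat_mono by fastforce
  also have "\<dots> \<le> (\<Sum>i\<in>{..m}. (\<Prod>j=1..n. (4 / c + 2) * (1 + \<rho>' j)))"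
    by (rule sum_mono) (use P in auto)
  also have "\<dots> = (real m + 1) * (\<Prod>j=1..n. (4 / c + 2) * (1 + \<rho>' j))" by simp
  also have "\<dots> \<le> ((b - a + 1) * N) * (\<Prod>j=1..n. ((4 / c + 2) * (1 + n * B)) * min N (1 + \<rho> j))"
  proof (rule mult_mono)
    show "real m + 1 \<le> (b - a + 1) * N" using mle N by (simp add: algebra_simps)
    have "(4 / c + 2) * (1 + \<rho>' j) \<le> (4 / c + 2) * (1 + n * B) * min N (1 + \<rho> j)" for j
    proof -
      have "1 + n * B * N \<le> (1 + n * B) * N" using N nB by (simp add: algebra_simps)
      moreover have "1 + (\<rho> j + n * B) \<le> (1 + n * B) * (1 + \<rho> j)"
        using mult_nonneg_nonneg[OF nB \<rho>[of j]] by (simp add: algebra_simps)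
      ultimately have "1 + \<rho>' j \<le> (1 + n * B) * min N (1 + \<rho> j)"
        by (auto simp: \<rho>'_def min_def)
      then have "(4 / c + 2) * (1 + \<rho>' j) \<le> (4 / c + 2) * ((1 + n * B) * min N (1 + \<rho> j))"
        using c_pos by (intro mult_left_mono) auto
      then show ?thesis by (simp add: mult_ac)
    qed
    then show "(\<Prod>j=1..n. (4 / c + 2) * (1 + \<rho>' j))
        \<le> (\<Prod>j=1..n. ((4 / c + 2) * (1 + n * B)) * min N (1 + \<rho> j))"
      using \<rho>'0 c_pos by (intro prod_mono conjI) (auto intro!: mult_nonneg_nonneg add_nonneg_nonneg)
  qed (use \<rho>'0 c_pos ab N in \<open>auto intro!: prod_nonneg mult_nonneg_nonneg add_nonneg_nonneg\<close>)
  also have "\<dots> = flat_const * N * (\<Prod>j=1..n. min N (1 + \<rho> j))"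
    by (simp add: flat_const_def prod.distrib n_def mult_ac)
  finally show ?thesis by (simp add: n_def)
qed

end

section \<open>Summing the oscillatory integrals\<close>

text \<open>The exponent \<open>p\<close> varies from case to case below; weakening it to its
  largest value \<open>n\<close> gives one saving \<open>q powr (-\<kappa> / n)\<close> valid in all
  of them.\<close>

lemma le_powr_of_power_le:
  fixes y q \<kappa> :: real
  assumes "0 \<le> y" "1 \<le> p" "p \<le> n" "1 \<le> q" "0 \<le> \<kappa>" "y ^ p \<le> q powr (-\<kappa>)"
  shows "y \<le> q powr (-\<kappa> / n)"
proof -
  have "y ^ p \<le> (q powr (-\<kappa> / p)) ^ p"
    using assms by (simp add: powr_realpow[symmetric] powr_powr)
  then have "y \<le> q powr (-\<kappa> / p)" using assms by (intro power_le_imp_le_base[of y "p - 1"]) auto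
  also have "\<dots> \<le> q powr (-\<kappa> / n)"
    using assms by (intro powr_mono) (auto simp: field_simps intro: mult_left_mono)
  finally show ?thesis .
qed

text \<open>The number \<open>s * (n + 2 - s) - 1\<close> is the power of \<open>N\<close> that has
  to be beaten by \<open>q\<close> when \<open>s\<close> is the critical order in
  \<open>scale_bound\<close>; \<open>\<kappa>\<close> measures the room left below the threshold
  \<open>N powr D = q\<close>.\<close>

locale scale_exponents =
  fixes n :: nat and N q D \<kappa> :: real
  assumes n: "2 \<le> n" and N: "1 \<le> N" and q: "1 < q" and \<kappa>: "0 < \<kappa>"
    and ND: "N powr D \<le> q powr (1 - \<kappa>)"
    and D: "\<And>s. s \<in> {2..n} \<Longrightarrow> real s * (real n + 2 - real s) - 1 \<le> D"
begin

lemma power_le: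
  assumes "real e \<le> D"
  shows "N ^ e / q \<le> q powr (-\<kappa>)"
proof -
  have "N ^ e = N powr e" using N by (simp add: powr_realpow)
  also have "\<dots> \<le> N powr D" using assms N by (intro powr_mono) auto
  also have "\<dots> \<le> q powr (1 - \<kappa>)" by (rule ND)
  also have "\<dots> = q * q powr (-\<kappa>)" using q by (simp add: powr_diff powr_minus field_simps)
  finally show ?thesis using q by (simp add: field_simps)
qed

lemma power_le_scale:
  assumes "s \<in> {2..n}"
  shows "N ^ (s * (n + 2 - s)) / (N * q) \<le> q powr (-\<kappa>)"
proof -
  have p: "s * (n + 2 - s) \<ge> 1" using assms by (auto simp: Suc_le_eq)
  then have "N ^ (s * (n + 2 - s)) = N * N ^ (s * (n + 2 - s) - 1)"
    by (metis power_minus_mult mult.commute less_le_trans zero_less_one)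
  then have "N ^ (s * (n + 2 - s)) / (N * q) = N ^ (s * (n + 2 - s) - 1) / q" using N by simp
  also have "\<dots> \<le> q powr (-\<kappa>)"
  proof (rule power_le)
    have "real (s * (n + 2 - s) - 1) = real s * (real n + 2 - real s) - 1"
      using p assms by (simp add: of_nat_diff)
    then show "real (s * (n + 2 - s) - 1) \<le> D" using D[OF assms] by simp
  qed
  finally show ?thesis .
qed

lemma n_le_D: "real n \<le> D"
  using D[of 2] n by simp

lemma N_le: "N \<le> q powr (1 / n) * q powr (-\<kappa> / n)"
proof -
  have "N / q powr (1 / n) \<le> q powr (-\<kappa> / n)"
  proof (rule le_powr_of_power_le[of _ n])
    have "(q powr (1 / n)) ^ n = q" using q n by (simp add: powr_realpow[symmetric] powr_powr)
    then have "(N / q powr (1 / n)) ^ n = N ^ n / q" by (simp add: power_divide)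
    then show "(N / q powr (1 / n)) ^ n \<le> q powr (-\<kappa>)" using power_le[OF n_le_D] by simp
  qed (use N n q \<kappa> in auto)
  then show ?thesis using q by (simp add: field_simps)
qed

text \<open>Here \<open>x\<close> stands for \<open>1 / r\<close>. Let \<open>p <= n\<close> be the
  last order with \<open>x ^ p < N * q\<close>. As \<open>N <= x\<close>, the factors below
  \<open>p\<close> are at most 2; those above are at most \<open>N\<close>. Factor \<open>p\<close>
  leaves the two terms \<open>N ^ (n + 1 - p) / x\<close> and
  \<open>N ^ (n + 1 - p) * x ^ (p - 1) / q\<close>. The first decreases in \<open>x\<close> and is
  controlled by \<open>N * q <= x ^ Suc p\<close>, the second does not decrease and is controlled by
  \<open>x ^ p < N * q\<close>; both thus reduce to a case \<open>x ^ s = N * q\<close> of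
  \<open>power_le_scale\<close>, except at the ends of the range of \<open>p\<close>.\<close>

lemma scale_bound:
  assumes x: "N \<le> x" "x\<^sup>2 \<le> N * q" "c0 * q powr (1 / n) \<le> x" and c0: "0 < c0" "c0 \<le> 1"
  shows "N / x * (\<Prod>j=1..n. min N (1 + x ^ j / q)) \<le> 2 ^ Suc n / c0 * q powr (-\<kappa> / n)"
proof -
  have x1: "x \<ge> 1" using x N by simp
  have Nq: "N * q > 1" using N q by (metis less_1_mult mult_1 order_le_less)
  have xlt: "x < N * q"
  proof (rule power_less_imp_less_base[of x 2])
    have "1 * (N * q) < (N * q) * (N * q)" using Nq by (intro mult_strict_right_mono) auto
    then have "N * q < (N * q)\<^sup>2" by (simp add: power2_eq_square)
    then show "x\<^sup>2 < (N * q)\<^sup>2" using x(2) by simp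
  qed (use Nq in auto)
  \<comment> \<open>The first exponent with \<open>N * q <= x ^ s\<close>, or \<open>n + 1\<close>
    if none up to \<open>n\<close> qualifies; \<open>s >= 2\<close> because \<open>1 < N * q\<close>
    and \<open>x < N * q\<close>.\<close>
  obtain s where s: "2 \<le> s" "s \<le> Suc n" "x ^ (s - 1) < N * q" "s \<le> n \<Longrightarrow> N * q \<le> x ^ s"
  proof (cases "\<exists>j\<le>n. N * q \<le> x ^ j")
    case True
    define s where "s = (LEAST j. N * q \<le> x ^ j)"
    have 1: "N * q \<le> x ^ s" using True LeastI_ex[of "\<lambda>j. N * q \<le> x ^ j"] by (auto simp: s_def)
    have "s \<le> n" using True Least_le[of "\<lambda>j. N * q \<le> x ^ j"] by (force simp: s_def)
    have "s \<noteq> 0"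
    proof
      assume "s = 0"
      then show False using 1 Nq by simp
    qed
    moreover have "s \<noteq> 1"
    proof
      assume "s = 1"
      then show False using 1 xlt by simp
    qed
    ultimately have "s \<ge> 2" by auto
    moreover from this have "\<not> N * q \<le> x ^ (s - 1)" unfolding s_def by (intro not_less_Least) simp
    ultimately show thesis using that[of s] 1 \<open>s \<le> n\<close> by auto
  next
    case False
    then show thesis using that[of "Suc n"] n by (auto simp: not_le)
  qed
  define p where "p = s - 1"
  have p: "1 \<le> p" "p \<le> n" "s = Suc p" using s by (auto simp: p_def)
  have xp: "x ^ p < N * q" using s(3) by (simp add: p_def)
  define f where "f j = min N (1 + x ^ j / q)" for j
  have f0: "0 \<le> f j" for j using N x1 q by (auto simp: f_def)
  have small: "f j \<le> 2" if "j < p" for j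
  proof -
    have "x ^ j * N \<le> x ^ j * x" using x(1) x1 by (intro mult_left_mono) auto
    also have "\<dots> = x ^ Suc j" by simp
    also have "\<dots> \<le> x ^ p" using that x1 by (intro power_increasing) auto
    also have "\<dots> < N * q" by (rule xp)
    finally have "x ^ j < q" using N by (simp add: mult.commute)
    then have "x ^ j / q \<le> 1" using q by simp
    then show ?thesis by (simp add: f_def min.coboundedI2)
  qed
  have split: "{1..n} = {1..<p} \<union> ({p} \<union> {Suc p..n})" using p by auto
  have "(\<Prod>j=1..n. f j) = (\<Prod>j\<in>{1..<p}. f j) * (f p * (\<Prod>j\<in>{Suc p..n}. f j))"
    unfolding split by (subst prod.union_disjoint; auto)
  also have "\<dots> \<le> (\<Prod>j\<in>{1..<p}. 2) * ((1 + x ^ p / q) * (\<Prod>j\<in>{Suc p..n}. N))"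
    by (intro mult_mono prod_mono mult_nonneg_nonneg prod_nonneg)
      (use small f0 N q x1 in \<open>auto simp: f_def intro!: add_nonneg_nonneg\<close>)
  also have "\<dots> = 2 ^ (p - 1) * ((1 + x ^ p / q) * N ^ (n - p))" by simp
  also have "\<dots> \<le> 2 ^ n * ((1 + x ^ p / q) * N ^ (n - p))"
    by (rule mult_right_mono[OF power_increasing]) (use p N q x1 in auto)
  finally have "N / x * (\<Prod>j=1..n. f j) \<le> N / x * (2 ^ n * ((1 + x ^ p / q) * N ^ (n - p)))"
    using N x1 by (intro mult_left_mono) auto
  also have "\<dots> = 2 ^ n * (N ^ (n + 1 - p) / x + N ^ (n + 1 - p) * x ^ (p - 1) / q)"
  proof -
    have "N ^ (n + 1 - p) = N * N ^ (n - p)" using p by (simp add: Suc_diff_le)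
    moreover have "x ^ p = x * x ^ (p - 1)" using p by (simp add: power_eq_if)
    ultimately show ?thesis using x1 q by (simp add: field_simps)
  qed
  also have "\<dots> \<le> 2 ^ n * (q powr (-\<kappa> / n) / c0 + q powr (-\<kappa> / n) / c0)"
  proof (intro mult_left_mono add_mono)
    have weaken: "q powr (-\<kappa> / n) \<le> q powr (-\<kappa> / n) / c0"
      using c0 mult_right_mono[of c0 1 "q powr (-\<kappa> / n)"] by (simp add: field_simps)
    show "N ^ (n + 1 - p) / x \<le> q powr (-\<kappa> / n) / c0"
    proof (cases "s \<le> n")
      case True
      have "N ^ (n + 1 - p) / x \<le> q powr (-\<kappa> / n)"
      proof (rule le_powr_of_power_le[of _ s])
        have "n + 1 - p = n + 2 - s" using p by simp
        then have "(N ^ (n + 1 - p) / x) ^ s = N ^ (s * (n + 2 - s)) / x ^ s"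
          by (simp only: power_divide power_mult[symmetric] mult.commute)
        also have "\<dots> \<le> N ^ (s * (n + 2 - s)) / (N * q)"
          using s(4)[OF True] N q Nq x1 by (intro divide_left_mono) auto
        also have "\<dots> \<le> q powr (-\<kappa>)" using s True by (intro power_le_scale) auto
        finally show "(N ^ (n + 1 - p) / x) ^ s \<le> q powr (-\<kappa>)" .
      qed (use N x1 s True q \<kappa> in auto)
      then show ?thesis using weaken by simp
    next
      \<comment> \<open>No power up to \<open>n\<close> reaches \<open>N * q\<close>, so the missing
        lower bound for \<open>x\<close> is supplied by \<open>c0 * q powr (1 / n) <= x\<close>,
        compared with \<open>N_le\<close>.\<close>
      case False
      then have "p = n" using s p by simp
      have "N * c0 \<le> (q powr (1 / n) * q powr (-\<kappa> / n)) * c0"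
        using N_le c0 by (intro mult_right_mono) auto
      also have "\<dots> = (c0 * q powr (1 / n)) * q powr (-\<kappa> / n)" by simp
      also have "\<dots> \<le> x * q powr (-\<kappa> / n)" using x(3) by (intro mult_right_mono) auto
      finally show ?thesis using x1 c0 \<open>p = n\<close> by (simp add: field_simps)
    qed
    have "N ^ (n + 1 - p) * x ^ (p - 1) / q \<le> q powr (-\<kappa> / n)"
    \<comment> \<open>\<open>power_le_scale\<close> starts at \<open>s = 2\<close>. For
      \<open>p = 1\<close> the power of \<open>x\<close> is trivial, and \<open>n <= D\<close> is
      enough.\<close>
    proof (cases "p = 1")
      case True
      have "N ^ n / q \<le> q powr (-\<kappa>)" by (rule power_le[OF n_le_D])
      then show ?thesis
        using True le_powr_of_power_le[of "N ^ n / q" 1 n q \<kappa>] n N q \<kappa> by simp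
    next
      case False
      show ?thesis
      proof (rule le_powr_of_power_le[of _ p])
        have "(N ^ (n + 1 - p) * x ^ (p - 1) / q) ^ p = (N ^ (n + 1 - p)) ^ p * (x ^ p) ^ (p - 1) / q ^ p"
          by (simp add: power_divide power_mult_distrib power_mult[symmetric] mult.commute)
        also have "\<dots> \<le> (N ^ (n + 1 - p)) ^ p * (N * q) ^ (p - 1) / q ^ p"
          using xp N x1 q by (intro divide_right_mono mult_left_mono power_mono) auto
        also have "\<dots> = N ^ (p * (n + 2 - p)) / (N * q)"
        proof -
          obtain p' where p': "p = Suc p'" using p by (cases p) auto
          have e: "p * (n + 2 - p) = (n + 1 - p) * p + p' + 1" using p p' by (simp add: Suc_diff_le algebra_simps)
          define w where "w = (n + 1 - p) * p"
          have "N ^ w * (N * q) ^ p' / q ^ Suc p' = N ^ (w + p' + 1) / (N * q)"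
            using N q by (simp add: power_mult_distrib power_add field_simps)
          then show ?thesis unfolding e power_mult[symmetric] w_def[symmetric] by (simp add: p')
        qed
        also have "\<dots> \<le> q powr (-\<kappa>)" using p False by (intro power_le_scale) auto
        finally show "(N ^ (n + 1 - p) * x ^ (p - 1) / q) ^ p \<le> q powr (-\<kappa>)" .
      qed (use N x1 p q \<kappa> in auto)
    qed
    then show "N ^ (n + 1 - p) * x ^ (p - 1) / q \<le> q powr (-\<kappa> / n) / c0" using weaken by simp
  qed simp
  also have "\<dots> = 2 ^ Suc n / c0 * q powr (-\<kappa> / n)" by simp
  finally show ?thesis by (simp add: f_def)
qed

end

text \<open>The largest \<open>i < M\<close> with \<open>2 ^ i * r < J\<close> alone contributes
  \<open>2 * (2 ^ i * r) >= J\<close>. The form with \<open>of_bool\<close> turns a sum over many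
  \<open>J\<close> into cardinalities of level sets.\<close>

lemma dyadic_le_sum:
  fixes J r :: real
  assumes "0 \<le> r" "J \<le> 2 ^ M * r"
  shows "J \<le> r + (\<Sum>i<M. 2 * (2 ^ i * r) * of_bool (2 ^ i * r < J))"
  using assms(2)
proof (induction M)
  case 0
  then show ?case by simp
next
  case (Suc M)
  show ?case
  proof (cases "J \<le> 2 ^ M * r")
    case True
    then show ?thesis using Suc.IH assms(1) by simp
  next
    case False
    have "0 \<le> (\<Sum>i<M. 2 * (2 ^ i * r) * of_bool (2 ^ i * r < J))" using assms(1) by (intro sum_nonneg) auto
    then show ?thesis using False Suc.prems assms(1) by simp
  qed
qed

context nondegenerate_arc
begin

definition wave_sum :: "real \<Rightarrow> real \<Rightarrow> real" where
  "wave_sum N q = (\<Sum>k\<in>lattice_box N - {0}. norm (wave q k))"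

text \<open>Lower bound for \<open>1 / r\<close> in units of \<open>q powr (1 / n)\<close> at any
  level containing a nonzero \<open>k\<close>: at a flat point some \<open>|k . G m t|\<close> is at
  least \<open>c\<close>, since \<open>norm k >= 1\<close>, but at most
  \<open>wave_const * (1/r)^n / q\<close>. The cap at 1 is what \<open>scale_bound\<close> asks of
  \<open>c0\<close>.\<close>

definition base_const :: real where
  "base_const = min 1 ((c / wave_const) powr (1 / CARD('n)))"

lemma base_const: "0 < base_const" "base_const \<le> 1"
  using c_pos wave_const_ge(1) by (auto simp: base_const_def)

definition level_const :: real where
  "level_const = flat_const * wave_const ^ CARD('n) * (2 ^ Suc CARD('n) / base_const)"

lemma flat_const_nonneg: "0 \<le> flat_const"
  using ab c_pos B_nonneg by (simp add: flat_const_def)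

lemma level_const_nonneg: "0 \<le> level_const"
  using base_const flat_const_nonneg wave_const_ge(1) by (auto simp: level_const_def)

text \<open>If the level is nonempty, a single nonzero frequency in it already yields
  \<open>r <= 1\<close>, \<open>N <= 1 / r\<close> and the lower bound for \<open>1 / r\<close>
  needed in \<open>scale_bound\<close>; the count itself comes from
  \<open>card_flat_points\<close>.\<close>

lemma wave_level_count:
  assumes "scale_exponents CARD('n) N q D \<kappa>" and qb: "q powr (-\<kappa> / CARD('n)) \<le> base_const"
    and r: "0 < r" "1 \<le> r\<^sup>2 * (N * q)"
  shows "r * card {k \<in> lattice_box N - {0}. wave_const * r < norm (wave q k)}
    \<le> level_const * q powr (-\<kappa> / CARD('n))"
proof (cases "{k \<in> lattice_box N - {0}. wave_const * r < norm (wave q k)} = {}")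
  case True
  then show ?thesis using level_const_nonneg by (simp only: card.empty) simp
next
  case False
  interpret scale_exponents "CARD('n)" N q D \<kappa> by fact
  define n where "n = CARD('n)"
  define x where "x = 1 / r"
  have n1: "1 \<le> n" using n by (simp add: n_def)
  obtain k where k: "k \<in> lattice_box N" "k \<noteq> 0" "wave_const * r < norm (wave q k)" using False by auto
  have "wave_const * r < wave_const * 1" using k(3) wave_trivial[of q k] wave_const_ge(4) by linarith
  then have r1: "r \<le> 1" using wave_const_ge(1) by (simp add: mult_less_cancel_left_pos)
  have x1: "x \<ge> 1" using r r1 by (simp add: x_def)
  have flat: "\<exists>t\<in>{a..b}. \<forall>j\<in>{1..n}. \<bar>l \<bullet> G j t\<bar> \<le> wave_const * (x ^ j / q)"
    if "wave_const * r < norm (wave q l)" for l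
    using large_wave_imp_flat_point[OF _ r(1) r1 that] q by (simp add: x_def n_def)
  obtain t where t: "t \<in> {a..b}" "\<And>j. j \<in> {1..n} \<Longrightarrow> \<bar>k \<bullet> G j t\<bar> \<le> wave_const * (x ^ j / q)"
    using flat[OF k(3)] by blast
  obtain m where m: "m \<in> {1..n}" "c * norm k \<le> \<bar>k \<bullet> G m t\<bar>" using nondeg[of k] t(1) by (auto simp: n_def)
  have "k \<in> lattice" using k(1) by (simp add: lattice_box_def)
  then have "1 \<le> norm k" using lattice_norm_less_one[of k] k(2) by force
  then have "c * 1 \<le> c * norm k" using c_pos by (intro mult_left_mono) auto
  also have "\<dots> \<le> wave_const * (x ^ m / q)" using m t(2)[OF m(1)] by linarith
  also have "\<dots> \<le> wave_const * (x ^ n / q)"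
    using m x1 q wave_const_ge(1) by (intro mult_left_mono divide_right_mono power_increasing) auto
  finally have "c / wave_const * q \<le> x ^ n" using q wave_const_ge(1) by (simp add: field_simps)
  then have "(c / wave_const * q) powr (1 / n) \<le> (x ^ n) powr (1 / n)"
    using c_pos q wave_const_ge(1) by (intro powr_mono2) auto
  also have "\<dots> = x" using x1 n1 by (simp add: powr_realpow[symmetric] powr_powr)
  finally have "(c / wave_const) powr (1 / n) * q powr (1 / n) \<le> x"
    using c_pos q wave_const_ge(1) powr_mult[of "c / wave_const" q "1 / n"] by simp
  moreover have "base_const * q powr (1 / n) \<le> (c / wave_const) powr (1 / n) * q powr (1 / n)"
    by (rule mult_right_mono) (auto simp: base_const_def n_def)
  ultimately have xq: "base_const * q powr (1 / n) \<le> x" by linarith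
  have "N \<le> q powr (1 / n) * q powr (-\<kappa> / n)" using N_le by (simp add: n_def)
  also have "\<dots> \<le> q powr (1 / n) * base_const" using qb by (intro mult_left_mono) (auto simp: n_def)
  finally have Nx: "N \<le> x" using xq by (simp add: mult.commute)
  have x2: "x\<^sup>2 \<le> N * q" using r by (simp add: x_def power_divide field_simps)
  have "card {k \<in> lattice_box N - {0}. wave_const * r < norm (wave q k)}
      \<le> card {k \<in> lattice_box N. \<exists>t\<in>{a..b}. \<forall>j\<in>{1..CARD('n)}. \<bar>k \<bullet> G j t\<bar> \<le> wave_const * (x ^ j / q)}"
    by (rule card_mono) (use finite_lattice_box[of N] flat in \<open>auto simp: n_def\<close>)
  also have "real \<dots> \<le> flat_const * N * (\<Prod>j=1..CARD('n). min N (1 + wave_const * (x ^ j / q)))"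
    using N x1 q wave_const_ge(1) by (intro card_flat_points) auto
  also have "\<dots> \<le> flat_const * N * (\<Prod>j=1..CARD('n). wave_const * min N (1 + x ^ j / q))"
  proof (intro mult_left_mono prod_mono conjI)
    fix j
    have y: "0 \<le> x ^ j / q" using x1 q by simp
    show "0 \<le> min N (1 + wave_const * (x ^ j / q))" using N mult_nonneg_nonneg[OF _ y, of wave_const] wave_const_ge(1) by simp
    have "N \<le> wave_const * N" using wave_const_ge(1) N by simp
    moreover have "1 + wave_const * (x ^ j / q) \<le> wave_const * (1 + x ^ j / q)"
      using wave_const_ge(1) by (simp add: algebra_simps)
    ultimately show "min N (1 + wave_const * (x ^ j / q)) \<le> wave_const * min N (1 + x ^ j / q)"
      by (auto simp: min_def)
  qed (use flat_const_nonneg N in auto)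
  also have "\<dots> = flat_const * wave_const ^ n * (N * (\<Prod>j=1..n. min N (1 + x ^ j / q)))"
    by (simp add: prod.distrib n_def)
  finally have "r * card {k \<in> lattice_box N - {0}. wave_const * r < norm (wave q k)}
      \<le> r * (flat_const * wave_const ^ n * (N * (\<Prod>j=1..n. min N (1 + x ^ j / q))))"
    using r by (intro mult_left_mono) auto
  also have "\<dots> = flat_const * wave_const ^ n * (N / x * (\<Prod>j=1..n. min N (1 + x ^ j / q)))"
    by (simp add: x_def)
  also have "\<dots> \<le> flat_const * wave_const ^ n * (2 ^ Suc n / base_const * q powr (-\<kappa> / n))"
    using scale_bound[OF Nx x2, of base_const] xq base_const flat_const_nonneg wave_const_ge(1)
    by (intro mult_left_mono) (auto simp: n_def)
  also have "\<dots> = level_const * q powr (-\<kappa> / n)" by (simp add: level_const_def n_def)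
  finally show ?thesis by (simp add: n_def)
qed

text \<open>The dyadic levels start at \<open>1 / sqrt (N * q)\<close>. Below that, counting all
  frequencies costs a multiple of \<open>N ^ n / sqrt (N * q)\<close>, whose square is the case
  \<open>s = 2\<close> of \<open>power_le_scale\<close>, so stopping there loses nothing. Each of
  the \<open>M\<close> levels above contributes the same bound.\<close>

lemma wave_sum_bound:
  assumes "scale_exponents CARD('n) N q D \<kappa>" and qb: "q powr (-\<kappa> / CARD('n)) \<le> base_const"
    and M: "N * q \<le> (2 ^ M)\<^sup>2"
  shows "wave_sum N q \<le> wave_const * ((4 * real CARD('n)) ^ CARD('n) + 2 * real M * level_const) * q powr (-\<kappa> / CARD('n))"
proof -
  interpret scale_exponents "CARD('n)" N q D \<kappa> by fact
  define n where "n = CARD('n)"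
  define L where "L = (lattice_box N - {0} :: (real^'n) set)"
  have finL: "finite L" by (simp add: L_def finite_lattice_box)
  define r where "r = 1 / sqrt (N * q)"
  have Nq: "N * q > 0" using N q by auto
  have r: "r > 0" "r\<^sup>2 * (N * q) = 1" using Nq by (auto simp: r_def power_divide)
  define J where "J k = norm (wave q k) / wave_const" for k
  have W: "wave_const > 0" using wave_const_ge(1) by simp
  have "sqrt (N * q) \<le> 2 ^ M" using real_sqrt_le_mono[OF M] by simp
  then have "1 \<le> 2 ^ M * r" using Nq by (simp add: r_def field_simps)
  moreover have "J k \<le> 1" for k using wave_trivial[of q k] wave_const_ge(4) W by (simp add: J_def field_simps)
  ultimately have J: "J k \<le> r + (\<Sum>i<M. 2 * (2 ^ i * r) * of_bool (2 ^ i * r < J k))" for k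
    using r(1) by (intro dyadic_le_sum) (auto intro: order_trans)
  have "(\<Sum>k\<in>L. J k) \<le> (\<Sum>k\<in>L. r + (\<Sum>i<M. 2 * (2 ^ i * r) * of_bool (2 ^ i * r < J k)))"
    by (rule sum_mono[OF J])
  also have "\<dots> = r * card L + (\<Sum>i<M. \<Sum>k\<in>L. 2 * (2 ^ i * r) * of_bool (2 ^ i * r < J k))"
    unfolding sum.distrib sum.swap[of _ L "{..<M}"] by simp
  also have "(\<Sum>i<M. \<Sum>k\<in>L. 2 * (2 ^ i * r) * of_bool (2 ^ i * r < J k))
      = (\<Sum>i<M. 2 * (2 ^ i * r * card {k \<in> L. wave_const * (2 ^ i * r) < norm (wave q k)}))"
  proof (rule sum.cong[OF refl])
    fix i
    have "{k \<in> L. 2 ^ i * r < J k} = {k \<in> L. wave_const * (2 ^ i * r) < norm (wave q k)}"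
      using W by (auto simp: J_def field_simps)
    moreover have "(\<Sum>k\<in>L. of_bool (2 ^ i * r < J k) :: real) = card {k \<in> L. 2 ^ i * r < J k}"
      using finL by (simp add: Int_def)
    ultimately show "(\<Sum>k\<in>L. 2 * (2 ^ i * r) * of_bool (2 ^ i * r < J k))
        = 2 * (2 ^ i * r * card {k \<in> L. wave_const * (2 ^ i * r) < norm (wave q k)})"
      by (simp add: sum_distrib_left[symmetric])
  qed
  also have "\<dots> \<le> (\<Sum>i<M. 2 * (level_const * q powr (-\<kappa> / n)))"
  proof (intro sum_mono mult_left_mono)
    fix i
    have "1 * 1 \<le> (2 ^ i)\<^sup>2 * (r\<^sup>2 * (N * q))" unfolding r(2) by simp
    then have "1 \<le> (2 ^ i * r)\<^sup>2 * (N * q)" by (simp add: power_mult_distrib mult.assoc)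
    then show "2 ^ i * r * card {k \<in> L. wave_const * (2 ^ i * r) < norm (wave q k)} \<le> level_const * q powr (-\<kappa> / n)"
      unfolding L_def n_def using r(1) by (intro wave_level_count[OF assms(1) qb]) auto
  qed auto
  also have "r * card L \<le> (4 * real n) ^ n * q powr (-\<kappa> / n)"
  proof -
    have "card L \<le> card (lattice_box N :: (real^'n) set)" unfolding L_def
      by (intro card_mono finite_lattice_box) auto
    also have "real \<dots> \<le> (4 * n * N) ^ n" using card_lattice_box[OF N, where 'n='n] by (simp add: n_def)
    finally have "r * card L \<le> r * (4 * n * N) ^ n" using r(1) by (intro mult_left_mono) auto
    also have "\<dots> = (4 * real n) ^ n * (r * N ^ n)" by (simp add: power_mult_distrib)
    also have "\<dots> \<le> (4 * real n) ^ n * q powr (-\<kappa> / n)"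
    proof (intro mult_left_mono)
      show "r * N ^ n \<le> q powr (-\<kappa> / n)"
      proof (rule le_powr_of_power_le[of _ 2])
        have "(r * N ^ n)\<^sup>2 = r\<^sup>2 * N ^ (2 * n)"
          by (simp add: power_mult_distrib power_mult[symmetric] mult.commute)
        also have "r\<^sup>2 = 1 / (N * q)" using Nq by (simp add: r_def power_divide)
        finally have "(r * N ^ n)\<^sup>2 = N ^ (2 * n) / (N * q)" by simp
        then show "(r * N ^ n)\<^sup>2 \<le> q powr (-\<kappa>)"
          using power_le_scale[of 2] n by (simp add: n_def)
      qed (use r N n q \<kappa> in \<open>auto simp: n_def\<close>)
    qed auto
    finally show ?thesis .
  qed
  finally have "(\<Sum>k\<in>L. J k) \<le> ((4 * real n) ^ n + 2 * real M * level_const) * q powr (-\<kappa> / n)"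
    by (simp add: algebra_simps)
  moreover have "wave_sum N q = wave_const * (\<Sum>k\<in>L. J k)"
    using W by (simp add: wave_sum_def L_def J_def sum_divide_distrib[symmetric])
  ultimately show ?thesis using W by (simp add: n_def mult.assoc)
qed

text \<open>Since \<open>N <= q\<close>, about \<open>log 2 q\<close> levels lead from
  \<open>1 / sqrt (N * q)\<close> up to 1. Half of the saving \<open>q powr (-e)\<close> absorbs
  this logarithm, so the sum tends to 0 uniformly in the admissible \<open>N\<close>.\<close>

lemma wave_sum_small:
  assumes n: "2 \<le> CARD('n)" and \<kappa>: "0 < \<kappa>" and \<eta>: "0 < \<eta>"
    and D: "\<And>s. s \<in> {2..CARD('n)} \<Longrightarrow> real s * (real CARD('n) + 2 - real s) - 1 \<le> D"
  shows "\<exists>Q\<ge>1. \<forall>q>Q. \<forall>N\<ge>1. N powr D \<le> q powr (1 - \<kappa>) \<longrightarrow> wave_sum N q \<le> \<eta>"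
proof -
  define e where "e = \<kappa> / CARD('n)"
  have e: "e > 0" using \<kappa> by (simp add: e_def)
  define A where "A = wave_const * ((4 * real CARD('n)) ^ CARD('n) + 2 * level_const)"
  define A' where "A' = wave_const * (2 * level_const) / ln 2"
  have l1: "((\<lambda>q. q powr (-e)) \<longlongrightarrow> 0) at_top"
    using e by (intro tendsto_neg_powr filterlim_ident) auto
  have l2: "((\<lambda>q. q powr (-(e/2)) / (e/2)) \<longlongrightarrow> 0) at_top"
    using e by (intro tendsto_divide_zero tendsto_neg_powr filterlim_ident) auto
  have "((\<lambda>q. A * q powr (-e) + A' * (q powr (-(e/2)) / (e/2))) \<longlongrightarrow> A * 0 + A' * 0) at_top"
    by (intro tendsto_intros l1 l2)
  then have "\<forall>\<^sub>F q in at_top. A * q powr (-e) + A' * (q powr (-(e/2)) / (e/2)) < \<eta>"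
    using \<eta> by (intro order_tendstoD(2)) auto
  moreover have "\<forall>\<^sub>F q in at_top. q powr (-e) < base_const"
    using base_const by (intro order_tendstoD(2)[OF l1]) auto
  ultimately have "\<forall>\<^sub>F q in at_top. A * q powr (-e) + A' * (q powr (-(e/2)) / (e/2)) < \<eta> \<and> q powr (-e) < base_const"
    by (rule eventually_conj)
  then obtain Q where Q: "\<And>q. q \<ge> Q \<Longrightarrow> A * q powr (-e) + A' * (q powr (-(e/2)) / (e/2)) < \<eta> \<and> q powr (-e) < base_const"
    by (auto simp: eventually_at_top_linorder)
  have "wave_sum N q \<le> \<eta>" if qQ: "q > max Q 1" and N: "N \<ge> 1" and ND: "N powr D \<le> q powr (1 - \<kappa>)" for q N
  proof -
    have sc: "scale_exponents CARD('n) N q D \<kappa>"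
      by standard (use n N qQ ND D \<kappa> in auto)
    interpret scale_exponents "CARD('n)" N q D \<kappa> by fact
    define M where "M = nat \<lceil>log 2 q\<rceil>"
    have lg: "log 2 q \<ge> 0" using q by simp
    have Mle: "real M \<le> log 2 q + 1" "log 2 q \<le> M" using lg unfolding M_def by linarith+
    have "q = 2 powr (log 2 q)" using q by simp
    also have "\<dots> \<le> 2 powr M" using Mle by (intro powr_mono) auto
    finally have qM: "q \<le> 2 ^ M" by (simp add: powr_realpow)
    have "N ^ 1 / q \<le> q powr (-\<kappa>)" using n_le_D n by (intro power_le) auto
    also have "\<dots> \<le> q powr 0" using q \<kappa> by (intro powr_mono) auto
    finally have "N \<le> q" using q by simp
    then have "N * q \<le> 2 ^ M * 2 ^ M" using qM q N by (intro mult_mono) auto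
    then have "N * q \<le> (2 ^ M)\<^sup>2" by (simp add: power2_eq_square)
    then have "wave_sum N q \<le> wave_const * ((4 * real CARD('n)) ^ CARD('n) + 2 * real M * level_const) * q powr (-\<kappa> / CARD('n))"
      using Q[of q] qQ by (intro wave_sum_bound[OF sc]) (auto simp: e_def)
    also have "\<dots> \<le> wave_const * ((4 * real CARD('n)) ^ CARD('n) + 2 * (log 2 q + 1) * level_const) * q powr (-e)"
      using Mle wave_const_ge(1) level_const_nonneg unfolding e_def
      by (intro mult_mono mult_left_mono add_mono mult_right_mono add_nonneg_nonneg mult_nonneg_nonneg) (use lg in auto)
    also have "\<dots> = A * q powr (-e) + A' * (ln q / q powr e)"
      by (simp add: A_def A'_def log_def algebra_simps powr_minus_divide)
    also have "\<dots> \<le> A * q powr (-e) + A' * (q powr (-(e/2)) / (e/2))"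
    proof (intro add_left_mono mult_left_mono)
      have "ln q \<le> q powr (e/2) / (e/2)" using ln_powr_bound[of q "e/2"] q e by simp
      then have "ln q / q powr e \<le> q powr (e/2) / (e/2) / q powr e" by (rule divide_right_mono) simp
      also have "\<dots> = q powr (-(e/2)) / (e/2)"
        using q e powr_diff[of q "e/2" e] by simp
      finally show "ln q / q powr e \<le> q powr (-(e/2)) / (e/2)" .
      show "0 \<le> A'" using wave_const_ge(1) level_const_nonneg by (simp add: A'_def)
    qed
    also have "\<dots> \<le> \<eta>" using Q[of q] qQ by auto
    finally show ?thesis .
  qed
  then show ?thesis by (intro exI[of _ "max Q 1"]) auto
qed

end

section \<open>Trigonometric kernels along an arc\<close>

lemma sin_ge_half:
  fixes u :: real
  assumes "0 \<le> u" "u \<le> pi / 2"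
  shows "u / 2 \<le> sin u"
proof (cases "u \<le> pi / 3")
  case True
  show ?thesis
  proof (cases "u = 0")
    case False
    then have "0 < u" using assms by simp
    have "\<exists>z. z > 0 \<and> z < u \<and> sin u - sin 0 = (u - 0) * cos z"
      by (rule MVT2[OF \<open>0 < u\<close>]) (auto intro!: derivative_eq_intros)
    then obtain z where z: "z > 0" "z < u" "sin u = u * cos z" by auto
    have "cos (pi / 3) \<le> cos z" using z True by (intro cos_monotone_0_pi_le) auto
    then have "u * (1/2) \<le> u * cos z" using \<open>0 < u\<close> by (intro mult_left_mono) (auto simp: cos_60)
    then show ?thesis using z by simp
  qed simp
next
  case False
  have "sin (pi / 3) \<le> sin u" using False assms by (intro sin_monotone_2pi_le) auto
  moreover have "pi / 4 \<le> sqrt 3 / 2"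
  proof -
    have "1.6 \<le> sqrt (3::real)" by (rule real_le_rsqrt) (simp add: power2_eq_square)
    moreover have "pi < 3.2" using pi_less_4 pi_approx by simp
    ultimately show ?thesis by simp
  qed
  ultimately show ?thesis using assms by (simp add: sin_60)
qed

lemma norm_one_minus_cis_ge:
  fixes w :: real
  assumes "\<bar>w\<bar> \<le> 1 / 2"
  shows "\<bar>w\<bar> \<le> norm (1 - cis (2 * pi * w))"
proof -
  have e: "cos (2 * pi * w) = 1 - 2 * (sin (pi * w))\<^sup>2"
    using cos_double_sin[of "pi * w"] by (simp add: mult.assoc)
  have "(norm (1 - cis (2 * pi * w)))\<^sup>2 = (1 - cos (2 * pi * w))\<^sup>2 + (sin (2 * pi * w))\<^sup>2"
    by (simp add: cmod_power2)
  also have "\<dots> = 2 - 2 * cos (2 * pi * w)"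
    using sin_cos_squared_add[of "2 * pi * w"] by (simp add: power2_diff)
  also have "\<dots> = (2 * sin (pi * w))\<^sup>2" using e by (simp add: power_mult_distrib)
  finally have n: "norm (1 - cis (2 * pi * w)) = \<bar>2 * sin (pi * w)\<bar>"
    by (metis abs_norm_cancel power2_eq_iff_nonneg abs_ge_zero power2_abs)
  have "\<bar>sin (pi * w)\<bar> = \<bar>sin (pi * \<bar>w\<bar>)\<bar>" by (auto simp: abs_if)
  moreover have "pi * \<bar>w\<bar> / 2 \<le> sin (pi * \<bar>w\<bar>)"
    by (rule sin_ge_half) (use assms in auto)
  ultimately have "pi * \<bar>w\<bar> \<le> \<bar>2 * sin (pi * w)\<bar>" by linarith
  moreover have "1 * \<bar>w\<bar> \<le> pi * \<bar>w\<bar>" using pi_gt3 by (intro mult_right_mono) auto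
  ultimately show ?thesis using n by simp
qed

lemma cis_two_pi_Ints:
  assumes "m \<in> \<int>" shows "cis (2 * pi * (y - m)) = cis (2 * pi * y)"
proof -
  have "cis (2 * pi * (y - m)) = cis (2 * pi * y) / cis (2 * pi * m)"
    by (simp add: cis_divide algebra_simps)
  then show ?thesis using assms by (simp add: cis_multiple_2pi)
qed

lemma near_integer_of_cis:
  assumes "norm (1 - cis (2 * pi * y)) \<le> s"
  shows "\<exists>m\<in>\<int>. \<bar>m - y\<bar> \<le> s"
proof
  define m where "m = real_of_int (round y)"
  show m: "m \<in> \<int>" by (simp add: m_def)
  have "\<bar>y - m\<bar> \<le> 1 / 2" using of_int_round_abs_le[of y] by (simp add: m_def abs_minus_commute)
  then have "\<bar>y - m\<bar> \<le> norm (1 - cis (2 * pi * (y - m)))" by (rule norm_one_minus_cis_ge)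
  then show "\<bar>m - y\<bar> \<le> s" using assms cis_two_pi_Ints[OF m] by (simp add: abs_minus_commute)
qed

section \<open>Trigonometric polynomials with frequencies in a cube\<close>

abbreviation grid :: "nat \<Rightarrow> ('n \<Rightarrow> nat) set" where
  "grid L \<equiv> PiE UNIV (\<lambda>_. {..L})"

definition vec_of :: "('n \<Rightarrow> nat) \<Rightarrow> real ^ 'n" where
  "vec_of f = (\<chi> i. real (f i))"

lemma vec_of_inject: "vec_of f = vec_of g \<Longrightarrow> f = g"
  by (auto simp: vec_of_def vec_eq_iff)

lemma vec_of_diff:
  assumes "f \<in> grid L" "g \<in> grid L"
  shows "vec_of f - vec_of g \<in> lattice_box L"
proof -
  have "f i \<le> L" "g i \<le> L" for i using assms by (auto simp: PiE_iff)
  then show ?thesis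
    by (auto simp: lattice_box_def lattice_def vec_of_def abs_le_iff of_nat_diff intro: le_diff_conv)
      (metis of_nat_le_iff of_nat_0_le_iff add_increasing2 diff_le_eq order_trans)+
qed

text \<open>Frequencies run from 0 to \<open>L\<close> in each coordinate, so that differences of
  two of them lie in \<open>lattice_box L\<close>, the range of \<open>wave_sum\<close>.\<close>

definition trig_poly :: "nat \<Rightarrow> (('n \<Rightarrow> nat) \<Rightarrow> real) \<Rightarrow> real ^ 'n \<Rightarrow> complex" where
  "trig_poly L \<beta> x = (\<Sum>f\<in>grid L. of_real (\<beta> f) * cis (2 * pi * (vec_of f \<bullet> x)))"

lemma trig_poly_prod:
  fixes x :: "real ^ 'n"
  shows "trig_poly L (\<lambda>f. \<Prod>i\<in>UNIV. \<alpha> i (f i)) x =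
    (\<Prod>i\<in>UNIV. \<Sum>j\<le>L. of_real (\<alpha> i j) * cis (2 * pi * (real j * x $ i)))"
proof -
  have "(\<Prod>i\<in>UNIV. \<Sum>j\<le>L. of_real (\<alpha> i j) * cis (2 * pi * (real j * x $ i)))
      = (\<Sum>f\<in>grid L. \<Prod>i\<in>UNIV. of_real (\<alpha> i (f i)) * cis (2 * pi * (real (f i) * x $ i)))"
    by (rule prod_sum_PiE) auto
  also have "\<dots> = trig_poly L (\<lambda>f. \<Prod>i\<in>UNIV. \<alpha> i (f i)) x"
    unfolding trig_poly_def
  proof (rule sum.cong[OF refl])
    fix f :: "'n \<Rightarrow> nat"
    have cp: "(\<Prod>i\<in>A. cis (g i)) = cis (\<Sum>i\<in>A. g i)" if "finite A" for A and g :: "'n \<Rightarrow> real"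
      using that by (induction A rule: finite_induct) (auto simp: cis_mult)
    have "(\<Prod>i\<in>UNIV. cis (2 * pi * (real (f i) * x $ i))) = cis (2 * pi * (vec_of f \<bullet> x))"
      by (subst cp) (auto simp: vec_of_def inner_vec_def sum_distrib_left)
    then show "(\<Prod>i\<in>UNIV. of_real (\<alpha> i (f i)) * cis (2 * pi * (real (f i) * x $ i)))
        = of_real (\<Prod>i\<in>UNIV. \<alpha> i (f i)) * cis (2 * pi * (vec_of f \<bullet> x))"
      by (simp add: prod.distrib)
  qed
  finally show ?thesis by simp
qed

lemma sum_prod_square:
  "(\<Sum>f\<in>grid L. (\<Prod>i\<in>UNIV. \<alpha> i (f i))\<^sup>2) = (\<Prod>i\<in>(UNIV::'n::finite set). \<Sum>j\<le>L. (\<alpha> i j :: real)\<^sup>2)"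
  by (subst prod_sum_PiE) (auto simp: prod_power_distrib)

context nondegenerate_arc
begin

lemma wave_sum_nonneg: "0 \<le> wave_sum N q"
  unfolding wave_sum_def by (intro sum_nonneg) auto

text \<open>Schur's test for the off-diagonal terms.\<close>

lemma mean_square:
  fixes \<beta> :: "('n \<Rightarrow> nat) \<Rightarrow> real" and L :: nat
  defines "E \<equiv> \<Sum>f\<in>grid L. (\<beta> f)\<^sup>2"
  shows "(\<lambda>t. (norm (trig_poly L \<beta> (q *\<^sub>R G 0 t)))\<^sup>2) integrable_on {a..b}"
    and "\<bar>integral {a..b} (\<lambda>t. (norm (trig_poly L \<beta> (q *\<^sub>R G 0 t)))\<^sup>2) - (b - a) * E\<bar> \<le> E * wave_sum L q"
proof -
  define F where "F = (grid L :: ('n \<Rightarrow> nat) set)"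
  have finF: "finite F" by (auto simp: F_def intro!: finite_PiE)
  define w where "w f g = wave q (vec_of f - vec_of g)" for f g :: "'n \<Rightarrow> nat"
  define h where "h f g t = cis (2 * pi * q * ((vec_of f - vec_of g) \<bullet> G 0 t))" for f g :: "'n \<Rightarrow> nat" and t
  have h: "(h f g has_integral w f g) {a..b}" for f g
    unfolding h_def w_def wave_def osc_def
    by (intro integrable_integral integrable_continuous_real continuous_intros continuous_G)
  have exp: "of_real ((norm (trig_poly L \<beta> (q *\<^sub>R G 0 t)))\<^sup>2) = (\<Sum>f\<in>F. \<Sum>g\<in>F. of_real (\<beta> f * \<beta> g) * h f g t)" for t
  proof -
    have "of_real ((norm (trig_poly L \<beta> (q *\<^sub>R G 0 t)))\<^sup>2)
        = trig_poly L \<beta> (q *\<^sub>R G 0 t) * cnj (trig_poly L \<beta> (q *\<^sub>R G 0 t))"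
      by (simp only: complex_norm_square)
    also have "\<dots> = (\<Sum>f\<in>F. \<Sum>g\<in>F. of_real (\<beta> f * \<beta> g) * h f g t)"
      unfolding trig_poly_def F_def[symmetric] cnj_sum sum_product
      by (intro sum.cong refl)
        (simp add: h_def cis_cnj cis_mult inner_diff_left algebra_simps)
    finally show ?thesis .
  qed
  define I where "I = (\<Sum>f\<in>F. \<Sum>g\<in>F. of_real (\<beta> f * \<beta> g) * w f g)"
  have "((\<lambda>t. \<Sum>f\<in>F. \<Sum>g\<in>F. of_real (\<beta> f * \<beta> g) * h f g t) has_integral I) {a..b}"
    unfolding I_def by (intro has_integral_sum has_integral_mult_right h finF)
  then have "((\<lambda>t. complex_of_real ((norm (trig_poly L \<beta> (q *\<^sub>R G 0 t)))\<^sup>2)) has_integral I) {a..b}"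
    unfolding exp .
  from has_integral_linear[OF this bounded_linear_Re]
  have int: "((\<lambda>t. (norm (trig_poly L \<beta> (q *\<^sub>R G 0 t)))\<^sup>2) has_integral Re I) {a..b}"
    by (simp only: o_def Re_complex_of_real)
  then show "(\<lambda>t. (norm (trig_poly L \<beta> (q *\<^sub>R G 0 t)))\<^sup>2) integrable_on {a..b}" by blast
  have w0: "w f f = of_real (b - a)" for f
    using ab by (simp add: w_def wave_def osc_def scaleR_conv_of_real)
  define R where "R = (\<Sum>f\<in>F. \<Sum>g\<in>F - {f}. of_real (\<beta> f * \<beta> g) * w f g)"
  have "I = (\<Sum>f\<in>F. of_real (\<beta> f * \<beta> f) * w f f + (\<Sum>g\<in>F - {f}. of_real (\<beta> f * \<beta> g) * w f g))"
    unfolding I_def by (intro sum.cong refl sum.remove finF)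
  also have "\<dots> = of_real ((b - a) * E) + R"
    by (simp add: sum.distrib R_def w0 E_def F_def sum_distrib_left power2_eq_square mult.commute
        del: of_real_diff)
  finally have IR: "I = of_real ((b - a) * E) + R" .
  \<comment> \<open>For fixed \<open>f\<close> the differences with the other \<open>g\<close> are
    distinct nonzero points of the box, so a row or column sum is part of
    \<open>wave_sum\<close>.\<close>
  have row: "(\<Sum>g\<in>F - {f}. norm (w f g)) \<le> wave_sum L q" "(\<Sum>g\<in>F - {f}. norm (w g f)) \<le> wave_sum L q"
    if f: "f \<in> F" for f
  proof -
    have "(\<Sum>g\<in>F - {f}. norm (w f g)) = (\<Sum>k\<in>(\<lambda>g. vec_of f - vec_of g) ` (F - {f}). norm (wave q k))"
      by (subst sum.reindex) (auto simp: inj_on_def w_def dest: vec_of_inject)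
    also have "\<dots> \<le> wave_sum L q" unfolding wave_sum_def
      by (rule sum_mono2) (use f finite_lattice_box[of "real L"] vec_of_diff in
          \<open>auto simp: F_def dest: vec_of_inject\<close>)
    finally show "(\<Sum>g\<in>F - {f}. norm (w f g)) \<le> wave_sum L q" .
    have "(\<Sum>g\<in>F - {f}. norm (w g f)) = (\<Sum>k\<in>(\<lambda>g. vec_of g - vec_of f) ` (F - {f}). norm (wave q k))"
      by (subst sum.reindex) (auto simp: inj_on_def w_def dest: vec_of_inject)
    also have "\<dots> \<le> wave_sum L q" unfolding wave_sum_def
      by (rule sum_mono2) (use f finite_lattice_box[of "real L"] vec_of_diff in
          \<open>auto simp: F_def dest: vec_of_inject\<close>)
    finally show "(\<Sum>g\<in>F - {f}. norm (w g f)) \<le> wave_sum L q" .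
  qed
  have "norm R \<le> (\<Sum>f\<in>F. \<Sum>g\<in>F - {f}. \<bar>\<beta> f * \<beta> g\<bar> * norm (w f g))"
    unfolding R_def by (intro sum_norm_le) (simp add: norm_mult abs_mult)
  \<comment> \<open>The inequality \<open>|x y| <= x^2 / 2 + y^2 / 2\<close> separates the two
    coefficients, leaving only row sums and column sums.\<close>
  also have "\<dots> \<le> (\<Sum>f\<in>F. \<Sum>g\<in>F - {f}. ((\<beta> f)\<^sup>2 / 2 + (\<beta> g)\<^sup>2 / 2) * norm (w f g))"
  proof (intro sum_mono mult_right_mono)
    fix f g
    have "0 \<le> (\<bar>\<beta> f\<bar> - \<bar>\<beta> g\<bar>)\<^sup>2" by simp
    then show "\<bar>\<beta> f * \<beta> g\<bar> \<le> (\<beta> f)\<^sup>2 / 2 + (\<beta> g)\<^sup>2 / 2" by (simp add: power2_diff abs_mult)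
  qed auto
  also have "\<dots> = (\<Sum>f\<in>F. \<Sum>g\<in>F - {f}. (\<beta> f)\<^sup>2 / 2 * norm (w f g))
      + (\<Sum>f\<in>F. \<Sum>g\<in>F - {f}. (\<beta> g)\<^sup>2 / 2 * norm (w f g))"
    by (simp add: distrib_right sum.distrib)
  also have "(\<Sum>f\<in>F. \<Sum>g\<in>F - {f}. (\<beta> g)\<^sup>2 / 2 * norm (w f g))
      = (\<Sum>g\<in>F. \<Sum>f\<in>F - {g}. (\<beta> g)\<^sup>2 / 2 * norm (w f g))"
  proof -
    have "F - {f} = {g. g \<in> F \<and> f \<noteq> g}" for f by auto
    moreover have "F - {g} = {f. f \<in> F \<and> f \<noteq> g}" for g by auto
    ultimately show ?thesis
      using sum.swap_restrict[OF finF finF, of "\<lambda>f g. (\<beta> g)\<^sup>2 / 2 * norm (w f g)" "\<lambda>f g. f \<noteq> g"] by simp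
  qed
  also have "(\<Sum>f\<in>F. \<Sum>g\<in>F - {f}. (\<beta> f)\<^sup>2 / 2 * norm (w f g)) \<le> (\<Sum>f\<in>F. (\<beta> f)\<^sup>2 / 2 * wave_sum L q)"
    unfolding sum_distrib_left[symmetric] by (intro sum_mono mult_left_mono row) auto
  also have "(\<Sum>g\<in>F. \<Sum>f\<in>F - {g}. (\<beta> g)\<^sup>2 / 2 * norm (w f g)) \<le> (\<Sum>g\<in>F. (\<beta> g)\<^sup>2 / 2 * wave_sum L q)"
    unfolding sum_distrib_left[symmetric] by (intro sum_mono mult_left_mono row) auto
  finally have "norm R \<le> (\<Sum>f\<in>F. (\<beta> f)\<^sup>2 / 2 * wave_sum L q) + (\<Sum>f\<in>F. (\<beta> f)\<^sup>2 / 2 * wave_sum L q)"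
    by simp
  also have "\<dots> = E * wave_sum L q"
    by (simp add: E_def F_def sum_distrib_right sum.distrib[symmetric])
  finally have "norm R \<le> E * wave_sum L q" .
  moreover have "integral {a..b} (\<lambda>t. (norm (trig_poly L \<beta> (q *\<^sub>R G 0 t)))\<^sup>2) = (b - a) * E + Re R"
    using int IR by (simp add: integral_unique)
  ultimately show "\<bar>integral {a..b} (\<lambda>t. (norm (trig_poly L \<beta> (q *\<^sub>R G 0 t)))\<^sup>2) - (b - a) * E\<bar> \<le> E * wave_sum L q"
    using abs_Re_le_cmod[of R] by simp
qed

definition near :: "real \<Rightarrow> real \<Rightarrow> (real ^ 'n) set" where
  "near q \<delta> = {k \<in> lattice. \<exists>t\<in>{a..b}. norm (k - q *\<^sub>R G 0 t) \<le> \<delta>}"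

lemma finite_near: "finite (near q \<delta>)"
proof -
  have "near q \<delta> \<subseteq> {k \<in> lattice. norm (k - 0) \<le> \<bar>\<delta>\<bar> + \<bar>q\<bar> * B}"
  proof
    fix k assume "k \<in> near q \<delta>"
    then obtain t where t: "k \<in> lattice" "t \<in> {a..b}" "norm (k - q *\<^sub>R G 0 t) \<le> \<delta>" by (auto simp: near_def)
    have "norm (q *\<^sub>R G 0 t) \<le> \<bar>q\<bar> * B" using bounded[of 0 t] t by (auto intro: mult_left_mono)
    then have "norm k \<le> \<bar>\<delta>\<bar> + \<bar>q\<bar> * B" using t(3) norm_triangle_sub[of k "q *\<^sub>R G 0 t"] by linarith
    then show "k \<in> {k \<in> lattice. norm (k - 0) \<le> \<bar>\<delta>\<bar> + \<bar>q\<bar> * B}" using t by simp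
  qed
  then show ?thesis by (rule finite_subset) (intro lattice_near_point; use B_nonneg in simp)
qed

lemma has_integral_indicator_interval:
  assumes "a \<le> u" "u \<le> v" "v \<le> b"
  shows "((\<lambda>t. if t \<in> {u..v} then C else 0) has_integral C * (v - u)) {a..b::real}"
proof -
  have "((\<lambda>t. C) has_integral C * (v - u)) {u..v}"
    using has_integral_const_real[of C u v] assms by (simp add: mult.commute)
  then show ?thesis
    using has_integral_restrict[of "{u..v}" "{a..b}" "\<lambda>t. C"] assms by auto
qed

end

text \<open>Within \<open>1 / (6 N)\<close> of an integer, every phase \<open>2 pi j y\<close> with
  \<open>j <= N\<close> is within \<open>pi / 3\<close> of a multiple of \<open>2 pi\<close>, so
  each cosine is at least 1/2 and nothing cancels.\<close>

lemma norm_exp_sum_ge: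
  assumes "1 \<le> N" "m \<in> \<int>" "\<bar>m - y\<bar> \<le> 1 / (6 * real N)"
  shows "(real N + 1) / 2 \<le> norm (\<Sum>j\<le>N. cis (2 * pi * (real j * y)))"
proof -
  have half: "1 / 2 \<le> cos (2 * pi * (real j * y))" if "j \<le> N" for j
  proof -
    define \<theta> where "\<theta> = 2 * pi * (real j * y - real j * m)"
    have "cis \<theta> = cis (2 * pi * (real j * y))"
      unfolding \<theta>_def by (rule cis_two_pi_Ints) (use assms(2) in auto)
    then have "Re (cis \<theta>) = Re (cis (2 * pi * (real j * y)))" by simp
    then have "cos \<theta> = cos (2 * pi * (real j * y))" by simp
    moreover have "\<bar>\<theta>\<bar> = 2 * pi * (real j * \<bar>m - y\<bar>)"
      by (simp add: \<theta>_def abs_mult right_diff_distrib[symmetric] abs_minus_commute)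
    moreover have "2 * pi * (real j * \<bar>m - y\<bar>) \<le> 2 * pi * (real N * (1 / (6 * real N)))"
      using that assms by (intro mult_left_mono mult_mono) auto
    ultimately have "\<bar>\<theta>\<bar> \<le> pi / 3" using assms(1) by simp
    then have "cos (pi / 3) \<le> cos \<bar>\<theta>\<bar>" by (intro cos_monotone_0_pi_le) auto
    then show ?thesis using \<open>cos \<theta> = _\<close> by (simp add: cos_60)
  qed
  have "(real N + 1) / 2 = (\<Sum>j\<le>N. 1 / 2)" by simp
  also have "\<dots> \<le> (\<Sum>j\<le>N. cos (2 * pi * (real j * y)))" by (rule sum_mono) (use half in auto)
  also have "\<dots> = Re (\<Sum>j\<le>N. cis (2 * pi * (real j * y)))" by simp
  also have "\<dots> \<le> norm (\<Sum>j\<le>N. cis (2 * pi * (real j * y)))" by (rule complex_Re_le_cmod)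
  finally show ?thesis .
qed

lemma trig_poly_one_ge:
  fixes x k :: "real ^ 'n"
  assumes "1 \<le> N" "k \<in> lattice" "norm (k - x) \<le> 1 / (6 * real N)"
  shows "((real N + 1) / 2) ^ CARD('n) \<le> norm (trig_poly N (\<lambda>f. 1) x)"
proof -
  have "((real N + 1) / 2) ^ CARD('n) = (\<Prod>i\<in>(UNIV::'n set). (real N + 1) / 2)" by simp
  also have "\<dots> \<le> (\<Prod>i\<in>UNIV. norm (\<Sum>j\<le>N. cis (2 * pi * (real j * x $ i))))"
  proof (intro prod_mono conjI)
    fix i
    have "\<bar>k $ i - x $ i\<bar> \<le> 1 / (6 * real N)"
      using component_le_norm_cart[of "k - x" i] assms(3) by simp
    then show "(real N + 1) / 2 \<le> norm (\<Sum>j\<le>N. cis (2 * pi * (real j * x $ i)))"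
      using assms by (intro norm_exp_sum_ge) (auto simp: lattice_def)
  qed simp
  also have "\<dots> = norm (trig_poly N (\<lambda>f. 1) x)"
    using trig_poly_prod[of N "\<lambda>i j. 1" x] by (simp add: prod_norm)
  finally show ?thesis .
qed

section \<open>The tent kernel and its coordinate differences\<close>

definition hat :: "nat \<Rightarrow> nat \<Rightarrow> real" where
  "hat M j = real (min j (2 * M - j))"

text \<open>Backward difference of the triangle \<open>hat\<close>. The triangle vanishes at both
  ends, so differencing lowers the energy from order \<open>M^3\<close> to order \<open>M\<close>; a
  rectangular window, with its jumps, would gain only one power of \<open>M\<close> instead of
  two.\<close>

definition slope :: "nat \<Rightarrow> nat \<Rightarrow> real" where
  "slope M j = (if j = 0 then hat M 0 else hat M j - hat M (j - 1))"

text \<open>Multiplication by \<open>1 - z\<close> differences the coefficients. The boundary term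
  at \<open>L\<close> vanishes for the tent because \<open>hat M (2 * M) = 0\<close>.\<close>

lemma summation_by_parts_geometric:
  fixes z :: complex and \<alpha> :: "nat \<Rightarrow> real"
  shows "(\<Sum>j\<le>L. of_real (if j = 0 then \<alpha> 0 else \<alpha> j - \<alpha> (j - 1)) * z ^ j)
    = (1 - z) * (\<Sum>j\<le>L. of_real (\<alpha> j) * z ^ j) + of_real (\<alpha> L) * z ^ Suc L"
  by (induction L) (auto simp: algebra_simps)

lemma slope_sum:
  "(\<Sum>j\<le>2*M. of_real (slope M j) * cis (2 * pi * (real j * y)))
    = (1 - cis (2 * pi * y)) * (\<Sum>j\<le>2*M. of_real (hat M j) * cis (2 * pi * (real j * y)))"
proof -
  have "cis (2 * pi * (real j * y)) = cis (2 * pi * y) ^ j" for j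
  proof -
    have "2 * pi * (real j * y) = real j * (2 * pi * y)" by simp
    then show ?thesis by (simp only: Complex.DeMoivre)
  qed
  then show ?thesis
    using summation_by_parts_geometric[of "hat M" "cis (2 * pi * y)" "2 * M"]
    by (simp add: slope_def hat_def)
qed

lemma hat_energy: "real M ^ 3 / 3 \<le> (\<Sum>j\<le>2*M. (hat M j)\<^sup>2)"
proof -
  have "real m ^ 3 / 3 \<le> (\<Sum>j\<le>m. (real j)\<^sup>2)" for m
    by (induction m) (auto simp: power2_eq_square power3_eq_cube field_simps)
  then have "real M ^ 3 / 3 \<le> (\<Sum>j\<le>M. (real j)\<^sup>2)" .
  also have "\<dots> = (\<Sum>j\<le>M. (hat M j)\<^sup>2)" by (intro sum.cong refl) (auto simp: hat_def min_def)
  also have "\<dots> \<le> (\<Sum>j\<le>2*M. (hat M j)\<^sup>2)" by (rule sum_mono2) auto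
  finally show ?thesis .
qed

lemma slope_energy: "(\<Sum>j\<le>2*M. (slope M j)\<^sup>2) \<le> 2 * real M"
proof -
  have "(slope M j)\<^sup>2 \<le> (if j = 0 then 0 else 1)" if "j \<le> 2 * M" for j
  proof (cases "j = 0")
    case False
    have "\<bar>slope M j\<bar> \<le> 1"
      using that False by (auto simp: slope_def hat_def min_def of_nat_diff)
    then show ?thesis using False abs_square_le_1[of "slope M j"] by simp
  qed (simp add: slope_def hat_def)
  then have "(\<Sum>j\<le>2*M. (slope M j)\<^sup>2) \<le> (\<Sum>j\<le>2*M. if j = 0 then 0 else 1)" by (intro sum_mono) auto
  also have "\<dots> = real (card ({..2*M} - {0}))"
    by (simp add: sum.If_cases Diff_eq Collect_neg_eq[symmetric] Compl_eq)
  also have "\<dots> = 2 * real M" by (simp add: card_Diff_singleton)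
  finally show ?thesis .
qed

lemma hat_sum_le: "norm (\<Sum>j\<le>2*M. of_real (hat M j) * cis (2 * pi * (real j * y))) \<le> 3 * (real M)\<^sup>2"
proof -
  have "norm (\<Sum>j\<le>2*M. of_real (hat M j) * cis (2 * pi * (real j * y))) \<le> (\<Sum>j\<le>2*M. real M)"
    by (rule sum_norm_le) (auto simp: norm_mult hat_def min_def)
  also have "\<dots> = 2 * (real M)\<^sup>2 + real M" by (simp add: power2_eq_square algebra_simps)
  finally have "norm (\<Sum>j\<le>2*M. of_real (hat M j) * cis (2 * pi * (real j * y))) \<le> 2 * (real M)\<^sup>2 + real M" .
  moreover have "real M \<le> (real M)\<^sup>2" by (cases M) (auto simp: power2_eq_square)
  ultimately show ?thesis by linarith
qed

definition tent :: "nat \<Rightarrow> ('n::finite \<Rightarrow> nat) \<Rightarrow> real" where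
  "tent M f = (\<Prod>i\<in>UNIV. hat M (f i))"

text \<open>Differencing in coordinate \<open>l\<close> only amounts to multiplying the tent kernel
  by \<open>1 - e(x_l)\<close>. The product is therefore again a trigonometric polynomial,
  accessible to \<open>mean_square\<close>.\<close>

definition tent_diff :: "nat \<Rightarrow> 'n \<Rightarrow> ('n::finite \<Rightarrow> nat) \<Rightarrow> real" where
  "tent_diff M l f = (\<Prod>i\<in>UNIV. (if i = l then slope M else hat M) (f i))"

lemma norm_tent_le:
  fixes x :: "real ^ 'n"
  shows "norm (trig_poly (2*M) (tent M) x) \<le> (3 * (real M)\<^sup>2) ^ CARD('n)"
proof -
  have "norm (trig_poly (2*M) (tent M) x)
      = (\<Prod>i\<in>UNIV. norm (\<Sum>j\<le>2*M. of_real (hat M j) * cis (2 * pi * (real j * x $ i))))"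
    unfolding tent_def[abs_def] trig_poly_prod[of "2*M" "\<lambda>i. hat M"] by (simp add: prod_norm)
  also have "\<dots> \<le> (\<Prod>i\<in>(UNIV::'n set). 3 * (real M)\<^sup>2)"
    by (intro prod_mono conjI hat_sum_le) auto
  finally show ?thesis by simp
qed

lemma tent_diff_eq:
  fixes x :: "real ^ 'n"
  shows "trig_poly (2*M) (tent_diff M l) x = (1 - cis (2 * pi * x $ l)) * trig_poly (2*M) (tent M) x"
proof -
  let ?S = "\<lambda>i. \<Sum>j\<le>2*M. of_real (hat M j) * cis (2 * pi * (real j * x $ i))"
  have "trig_poly (2*M) (tent_diff M l) x
      = (\<Prod>i\<in>UNIV. \<Sum>j\<le>2*M. of_real ((if i = l then slope M else hat M) j) * cis (2 * pi * (real j * x $ i)))"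
    unfolding tent_diff_def[abs_def] by (rule trig_poly_prod)
  also have "\<dots> = (\<Prod>i\<in>UNIV. (if i = l then 1 - cis (2 * pi * x $ l) else 1) * ?S i)"
    by (intro prod.cong refl) (auto simp: slope_sum)
  also have "\<dots> = (1 - cis (2 * pi * x $ l)) * (\<Prod>i\<in>UNIV. ?S i)"
    by (simp add: prod.distrib)
  also have "(\<Prod>i\<in>UNIV. ?S i) = trig_poly (2*M) (tent M) x"
    unfolding tent_def[abs_def] by (rule trig_poly_prod[symmetric])
  finally show ?thesis .
qed

lemma tent_energy:
  "(\<Sum>f\<in>(grid (2*M) :: ('n::finite \<Rightarrow> nat) set). (tent M f)\<^sup>2) = (\<Sum>j\<le>2*M. (hat M j)\<^sup>2) ^ CARD('n)"
  unfolding tent_def sum_prod_square[where L = "2*M" and \<alpha> = "\<lambda>i::'n. hat M"] by simp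

lemma tent_diff_energy:
  fixes l :: "'n::finite"
  shows "(\<Sum>f\<in>grid (2*M). (tent_diff M l f)\<^sup>2)
    = (\<Sum>j\<le>2*M. (slope M j)\<^sup>2) * (\<Sum>j\<le>2*M. (hat M j)\<^sup>2) ^ (CARD('n) - 1)"
proof -
  have "(\<Sum>f\<in>grid (2*M). (tent_diff M l f)\<^sup>2)
      = (\<Prod>i\<in>UNIV. \<Sum>j\<le>2*M. ((if i = l then slope M else hat M) j)\<^sup>2)"
    unfolding tent_diff_def by (rule sum_prod_square)
  also have "\<dots> = (\<Sum>j\<le>2*M. (slope M j)\<^sup>2) * (\<Prod>i\<in>UNIV - {l}. \<Sum>j\<le>2*M. ((if i = l then slope M else hat M) j)\<^sup>2)"
    by (subst prod.remove[of _ l]) auto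
  also have "(\<Prod>i\<in>UNIV - {l}. \<Sum>j\<le>2*M. ((if i = l then slope M else hat M) j)\<^sup>2)
      = (\<Prod>i\<in>UNIV - {l}. \<Sum>j\<le>2*M. (hat M j)\<^sup>2)"
    by (rule prod.cong) auto
  finally show ?thesis by simp
qed

section \<open>The two counting estimates at distance of order 1/N\<close>

context nondegenerate_arc
begin

lemma q_lipschitz:
  assumes "s \<in> {a..b}" "t \<in> {a..b}" "0 \<le> q"
  shows "norm (q *\<^sub>R G 0 s - q *\<^sub>R G 0 t) \<le> q * (B * \<bar>s - t\<bar>)"
  using mult_left_mono[OF G_lipschitz[of 0 s t] assms(3)] assms
  by (simp add: scaleR_diff_right[symmetric])

definition upper_const :: real where
  "upper_const = 24 * (B + 1 + 2 / (b - a)) * 4 ^ CARD('n) * (b - a)"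

text \<open>Every lattice point close to the dilated arc forces a product of Dirichlet kernels to be
  large on an interval of parameters, and these intervals are disjoint.\<close>

lemma card_near_upper:
  assumes q: "1 \<le> q" and N: "1 \<le> N" and S: "wave_sum (real N) q \<le> b - a"
  shows "real (card (near q (1 / (12 * real N)))) * real N ^ (CARD('n) - 1) \<le> upper_const * q"
proof -
  define n where "n = CARD('n)"
  have n1: "n \<ge> 1" by (simp add: n_def Suc_leI)
  define \<delta> where "\<delta> = 1 / (12 * real N)"
  \<comment> \<open>\<open>K >= B\<close> keeps the dilated arc within \<open>\<delta>\<close> of
    its starting point over a parameter interval of length \<open>l\<close>;
    \<open>K >= 2 / (b - a)\<close> makes \<open>l\<close> so short that such an interval fits into
    \<open>{a..b}\<close> on one side of any \<open>t0\<close>.\<close>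
  define K where "K = B + 1 + 2 / (b - a)"
  define l where "l = \<delta> / (q * K)"
  have K: "K \<ge> 1" "K \<ge> 2 / (b - a)" "K \<ge> B" using B_nonneg ab by (auto simp: K_def)
  then have "K > 0" by linarith
  note K = K this
  have \<delta>: "0 < \<delta>" "\<delta> \<le> 1 / 12" using N by (auto simp: \<delta>_def field_simps)
  have qK: "q * K > 0" using q K by simp
  have l0: "l > 0" using \<delta> qK by (simp add: l_def)
  have "l \<le> 1 / K"
  proof -
    have "1 * K \<le> q * K" using q K by (intro mult_right_mono) auto
    then have "\<delta> / (q * K) \<le> 1 / (1 * K)" using \<delta> K by (intro frac_le) auto
    then show ?thesis by (simp add: l_def)
  qed
  also have "1 / K \<le> 1 / (2 / (b - a))" using K ab by (intro divide_left_mono) auto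
  finally have l2: "2 * l \<le> b - a" by simp
  have ql: "q * (B * l) \<le> \<delta>"
  proof -
    have "q * (B * l) \<le> q * (K * l)" using K l0 q by (intro mult_left_mono mult_right_mono) auto
    also have "\<dots> = \<delta>" using q K by (simp add: l_def)
    finally show ?thesis .
  qed
  let ?P = "near q \<delta>"
  have "\<exists>u. a \<le> u \<and> u + l \<le> b \<and> (\<forall>t\<in>{u..u+l}. norm (k - q *\<^sub>R G 0 t) \<le> 2 * \<delta>)" if k: "k \<in> ?P" for k
  proof -
    obtain t0 where t0: "t0 \<in> {a..b}" "norm (k - q *\<^sub>R G 0 t0) \<le> \<delta>" using k by (auto simp: near_def)
    define u where "u = (if t0 + l \<le> b then t0 else t0 - l)"
    have u: "a \<le> u" "u + l \<le> b" "u \<le> t0" "t0 \<le> u + l" using t0 l0 l2 by (auto simp: u_def)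
    have "norm (k - q *\<^sub>R G 0 t) \<le> 2 * \<delta>" if t: "t \<in> {u..u+l}" for t
    proof -
      have tab: "t \<in> {a..b}" using t u by auto
      have "norm (q *\<^sub>R G 0 t0 - q *\<^sub>R G 0 t) \<le> q * (B * \<bar>t0 - t\<bar>)"
        by (rule q_lipschitz) (use t0 tab q in auto)
      also have "\<dots> \<le> q * (B * l)" using t u q B_nonneg by (intro mult_left_mono) auto
      finally have "norm (q *\<^sub>R G 0 t0 - q *\<^sub>R G 0 t) \<le> \<delta>" using ql by simp
      then show ?thesis
        using t0(2) norm_triangle_ineq[of "k - q *\<^sub>R G 0 t0" "q *\<^sub>R G 0 t0 - q *\<^sub>R G 0 t"] by simp
    qed
    then show ?thesis using u by (intro exI[of _ u]) auto
  qed
  then obtain u where u: "\<And>k. k \<in> ?P \<Longrightarrow> a \<le> u k" "\<And>k. k \<in> ?P \<Longrightarrow> u k + l \<le> b"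
    "\<And>k t. k \<in> ?P \<Longrightarrow> t \<in> {u k..u k + l} \<Longrightarrow> norm (k - q *\<^sub>R G 0 t) \<le> 2 * \<delta>"
    by metis
  define m where "m = ((real N + 1) / 2) ^ (2 * n)"
  define T where "T t = (norm (trig_poly N (\<lambda>f. 1) (q *\<^sub>R G 0 t)))\<^sup>2" for t
  have point: "(\<Sum>k\<in>?P. if t \<in> {u k..u k + l} then m else 0) \<le> T t" for t
  proof (cases "\<exists>k\<in>?P. t \<in> {u k..u k + l}")
    case False
    then have "(\<Sum>k\<in>?P. if t \<in> {u k..u k + l} then m else 0) = 0" by (intro sum.neutral) auto
    then show ?thesis by (simp add: T_def)
  next
    case True
    then obtain k where k: "k \<in> ?P" "t \<in> {u k..u k + l}" by blast
    \<comment> \<open>Disjointness of the intervals: two lattice points sharing a parameter would be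
      at distance at most \<open>4 * \<delta> < 1\<close>.\<close>
    have uniq: "k' = k" if "k' \<in> ?P" "t \<in> {u k'..u k' + l}" for k'
    proof -
      have "norm (k' - k) \<le> norm (k' - q *\<^sub>R G 0 t) + norm (k - q *\<^sub>R G 0 t)"
        using norm_triangle_ineq4[of "k' - q *\<^sub>R G 0 t" "k - q *\<^sub>R G 0 t"] by simp
      also have "\<dots> \<le> 4 * \<delta>" using u(3)[OF that] u(3)[OF k] by simp
      also have "\<dots> < 1" using \<delta> by simp
      finally have "k' - k = 0"
        using that k lattice_diff[of k' k] by (intro lattice_norm_less_one) (auto simp: near_def)
      then show ?thesis by simp
    qed
    have "(\<Sum>k'\<in>?P. if t \<in> {u k'..u k' + l} then m else 0) = (\<Sum>k'\<in>?P. if k' = k then m else 0)"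
    proof (rule sum.cong[OF refl])
      fix k' assume k': "k' \<in> ?P"
      show "(if t \<in> {u k'..u k' + l} then m else 0) = (if k' = k then m else 0)"
      proof (cases "k' = k")
        case True
        then show ?thesis using k(2) by simp
      next
        case False
        then show ?thesis using uniq[OF k'] by metis
      qed
    qed
    also have "\<dots> = m" using k finite_near by simp
    also have "m = (((real N + 1) / 2) ^ n)\<^sup>2" by (simp add: m_def power_mult[symmetric] mult.commute)
    also have "\<dots> \<le> T t" unfolding T_def
    proof (rule power_mono)
      have "2 * \<delta> = 1 / (6 * real N)" by (simp add: \<delta>_def)
      then show "((real N + 1) / 2) ^ n \<le> norm (trig_poly N (\<lambda>f. 1) (q *\<^sub>R G 0 t))"
        unfolding n_def using u(3)[OF k] k N by (intro trig_poly_one_ge[of N k]) (auto simp: near_def)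
    qed simp
    finally show ?thesis .
  qed
  have E: "(\<Sum>f\<in>(grid N :: ('n \<Rightarrow> nat) set). (1::real)\<^sup>2) = (real N + 1) ^ n"
    using sum_prod_square[where L = N and \<alpha> = "\<lambda>(i::'n) j. 1"] by (simp add: n_def add.commute)
  note ms = mean_square[of N "\<lambda>f. 1" q, unfolded E, folded T_def]
  have "((\<lambda>t. \<Sum>k\<in>?P. if t \<in> {u k..u k + l} then m else 0) has_integral (\<Sum>k\<in>?P. m * (u k + l - u k))) {a..b}"
    by (intro has_integral_sum finite_near has_integral_indicator_interval) (use u l0 in auto)
  then have "(\<Sum>k\<in>?P. m * (u k + l - u k)) \<le> integral {a..b} T"
    using point ms(1) by (intro has_integral_le[OF _ integrable_integral]) auto
  also have "\<dots> \<le> (b - a) * (real N + 1) ^ n + (real N + 1) ^ n * wave_sum N q"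
    using ms(2) by linarith
  also have "\<dots> \<le> (b - a) * (real N + 1) ^ n + (real N + 1) ^ n * (b - a)"
    using S ab by (intro add_mono mult_left_mono) auto
  also have "\<dots> = (real N + 1) ^ n * (2 * (b - a))" by (simp add: algebra_simps)
  finally have "card ?P * m * l \<le> (real N + 1) ^ n * (2 * (b - a))" by (simp add: mult_ac)
  \<comment> \<open>The height \<open>m\<close> is \<open>(N + 1)^(2 n) / 4^n\<close>, the energy
    only \<open>(N + 1)^n\<close>. After cancelling one such factor, \<open>1 / l\<close>, of order
    \<open>q * N\<close>, turns \<open>N ^ n\<close> into \<open>N ^ (n - 1)\<close>.\<close>
  moreover have "card ?P * m * l = (real N + 1) ^ n * (card ?P * (real N + 1) ^ n * l) / 4 ^ n"
    by (simp add: m_def power_divide power_mult power2_eq_square power_mult_distrib)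
  ultimately have "(real N + 1) ^ n * (card ?P * (real N + 1) ^ n * l) \<le> (real N + 1) ^ n * (2 * (b - a)) * 4 ^ n"
    by (simp only: pos_divide_le_eq[of "4 ^ n"] zero_less_power zero_less_numeral)
  then have "(real N + 1) ^ n * (card ?P * (real N + 1) ^ n * l) \<le> (real N + 1) ^ n * (2 * (b - a) * 4 ^ n)"
    by (simp only: mult.assoc)
  then have "card ?P * (real N + 1) ^ n * l \<le> 2 * (b - a) * 4 ^ n"
    by (subst (asm) mult_le_cancel_left_pos) auto
  moreover have "card ?P * real N ^ n * l \<le> card ?P * (real N + 1) ^ n * l"
    using l0 by (intro mult_right_mono mult_left_mono power_mono) auto
  ultimately have "card ?P * real N ^ n * l \<le> 2 * (b - a) * 4 ^ n" by linarith
  moreover have "card ?P * real N ^ n * l = card ?P * real N ^ (n - 1) / (12 * q * K)"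
  proof -
    have "real N ^ n = real N * real N ^ (n - 1)" using n1 by (simp add: power_eq_if)
    then show ?thesis using N by (simp add: l_def \<delta>_def)
  qed
  ultimately have "card ?P * real N ^ (n - 1) \<le> 2 * (b - a) * 4 ^ n * (12 * q * K)"
    using qK pos_divide_le_eq[of "12 * q * K"] by (simp add: mult.assoc)
  also have "\<dots> = 24 * K * 4 ^ n * (b - a) * q" by simp
  also have "\<dots> = upper_const * q" by (simp only: upper_const_def K_def n_def)
  finally show ?thesis by (simp add: \<delta>_def n_def)
qed

text \<open>This is \<open>M * n * sqrt \<tau>\<close> for the \<open>\<tau>\<close> of
  \<open>card_near_lower\<close>: each coordinate is within \<open>sqrt \<tau>\<close> of an
  integer, and the Euclidean norm is at most the sum of the \<open>n\<close> absolute
  values.\<close>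

definition near_radius :: real where
  "near_radius = CARD('n) * sqrt (20 * CARD('n))"

definition lower_const :: real where
  "lower_const = (b - a) * c / (80 * 27 ^ CARD('n) * near_radius)"

lemma near_radius_pos: "0 < near_radius"
  by (simp add: near_radius_def)

lemma lower_const_pos: "0 < lower_const"
  using ab c_pos near_radius_pos by (simp add: lower_const_def)

text \<open>The trigonometric polynomial T below is positive only near lattice points, because of
  its factor \<open>\<tau> - (\<Sum>i. \<bar>1 - e(x\<^sub>i)\<bar>\<^sup>2)\<close>, yet has a large mean value.\<close>

lemma card_near_lower:
  assumes q: "0 < q" and M: "1 \<le> M" and S: "wave_sum (2 * real M) q \<le> (b - a) / 2"
  shows "lower_const * q \<le> real (card (near q (near_radius / M))) * real M ^ (CARD('n) - 1)"
proof -
  define n where "n = CARD('n)"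
  have n1: "n \<ge> 1" by (simp add: n_def Suc_leI)
  \<comment> \<open>With the factor 20 the main term is at least \<open>10 * n / M^2\<close> and the
    subtracted terms at most \<open>9 * n / M^2\<close>, both times \<open>A ^ n * (b - a)\<close>;
    the surplus \<open>n / M^2\<close> is \<open>\<tau> / 20\<close>.\<close>
  define \<tau> where "\<tau> = 20 * real n / (real M)\<^sup>2"
  define \<delta> where "\<delta> = near_radius / M"
  have M0: "real M > 0" using M by simp
  have \<tau>: "\<tau> > 0" using M0 n1 by (simp add: \<tau>_def)
  have \<delta>: "\<delta> = n * sqrt \<tau>" using M0 by (simp add: \<delta>_def near_radius_def \<tau>_def real_sqrt_divide n_def)
  have \<delta>0: "\<delta> > 0" using near_radius_pos M0 by (simp add: \<delta>_def)
  define x where "x t = q *\<^sub>R G 0 t" for t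
  define P where "P t = (norm (trig_poly (2*M) (tent M) (x t)))\<^sup>2" for t
  define R where "R l t = (norm (trig_poly (2*M) (tent_diff M l) (x t)))\<^sup>2" for l t
  have R: "R l t = (norm (1 - cis (2 * pi * x t $ l)))\<^sup>2 * P t" for l t
    by (simp add: R_def P_def tent_diff_eq norm_mult power_mult_distrib)
  define A where "A = (\<Sum>j\<le>2*M. (hat M j)\<^sup>2)"
  define Z where "Z = (\<Sum>j\<le>2*M. (slope M j)\<^sup>2)"
  have A: "real M ^ 3 / 3 \<le> A" unfolding A_def by (rule hat_energy)
  have A0: "A > 0" using A M0 by (smt (verit) divide_pos_pos zero_less_power)
  have ZA: "Z \<le> 6 * A / (real M)\<^sup>2"
  proof -
    have "2 * real M = 6 * (real M ^ 3 / 3) / (real M)\<^sup>2" using M0 by (simp add: power3_eq_cube power2_eq_square)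
    also have "\<dots> \<le> 6 * A / (real M)\<^sup>2" using A by (intro divide_right_mono mult_left_mono) auto
    finally show ?thesis using slope_energy[of M] by (simp add: Z_def)
  qed
  have Z0: "Z \<ge> 0" by (simp add: Z_def sum_nonneg)
  let ?S = "near q \<delta>"
  define l where "l = 2 * \<delta> / (q * c)"
  have l0: "l > 0" using \<delta>0 q c_pos by (simp add: l_def)
  \<comment> \<open>All parameters at which the dilated arc is within \<open>\<delta>\<close> of
    \<open>k\<close> lie in one interval of length at most \<open>2 * l\<close>: by
    \<open>chord\<close>, the arc cannot come back to \<open>k\<close> at a distant parameter. So
    each lattice point accounts for only a small part of the mean value.\<close>
  define W where "W k w \<longleftrightarrow> a \<le> fst w \<and> fst w \<le> snd w \<and> snd w \<le> b \<and> snd w - fst w \<le> 2 * l \<and>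
    (\<forall>t\<in>{a..b}. norm (k - x t) \<le> \<delta> \<longrightarrow> t \<in> {fst w..snd w})" for k w
  have "\<exists>w. W k w" if k: "k \<in> ?S" for k
  proof -
    obtain t0 where t0: "t0 \<in> {a..b}" "norm (k - x t0) \<le> \<delta>" using k by (auto simp: near_def x_def)
    have "\<bar>t - t0\<bar> \<le> l" if t: "t \<in> {a..b}" "norm (k - x t) \<le> \<delta>" for t
    proof -
      have "q * (c * \<bar>t - t0\<bar>) \<le> q * norm (G 0 t - G 0 t0)"
        using chord[OF t(1) t0(1)] q by (intro mult_left_mono) auto
      also have "\<dots> = norm ((k - x t0) - (k - x t))" using q by (simp add: x_def scaleR_diff_right[symmetric])
      also have "\<dots> \<le> 2 * \<delta>" using norm_triangle_ineq4[of "k - x t0" "k - x t"] t t0 by linarith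
      finally show ?thesis using q c_pos by (simp add: l_def field_simps)
    qed
    then show ?thesis using t0 l0
      by (intro exI[of _ "(max a (t0 - l), min b (t0 + l))"]) (force simp: abs_le_iff W_def)
  qed
  then obtain w where w: "\<And>k. k \<in> ?S \<Longrightarrow> W k (w k)" by metis
  define u where "u k = fst (w k)" for k
  define v where "v k = snd (w k)" for k
  have uv: "\<And>k. k \<in> ?S \<Longrightarrow> a \<le> u k" "\<And>k. k \<in> ?S \<Longrightarrow> u k \<le> v k"
    "\<And>k. k \<in> ?S \<Longrightarrow> v k \<le> b" "\<And>k. k \<in> ?S \<Longrightarrow> v k - u k \<le> 2 * l"
    "\<And>k t. k \<in> ?S \<Longrightarrow> t \<in> {a..b} \<Longrightarrow> norm (k - x t) \<le> \<delta> \<Longrightarrow> t \<in> {u k..v k}"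
    using w unfolding W_def u_def v_def by blast+
  define m where "m = \<tau> * ((3 * (real M)\<^sup>2) ^ n)\<^sup>2"
  have m0: "m \<ge> 0" using \<tau> by (simp add: m_def)
  have P0: "0 \<le> P t" for t by (simp add: P_def)
  define T where "T t = \<tau> * P t - (\<Sum>i\<in>UNIV. R i t)" for t
  have point: "T t \<le> (\<Sum>k\<in>?S. if t \<in> {u k..v k} then m else 0)" if t: "t \<in> {a..b}" for t
  proof (cases "T t \<le> 0")
    case True
    have "0 \<le> (\<Sum>k\<in>?S. if t \<in> {u k..v k} then m else 0)" using m0 by (intro sum_nonneg) auto
    then show ?thesis using True by linarith
  next
    case False
    have "T t = (\<tau> - (\<Sum>i\<in>UNIV. (norm (1 - cis (2 * pi * x t $ i)))\<^sup>2)) * P t"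
      by (simp add: T_def R sum_distrib_right left_diff_distrib)
    then have "0 < \<tau> - (\<Sum>i\<in>UNIV. (norm (1 - cis (2 * pi * x t $ i)))\<^sup>2)"
      using False P0[of t] by (simp add: zero_less_mult_iff not_le)
    then have "(norm (1 - cis (2 * pi * x t $ i)))\<^sup>2 \<le> \<tau>" for i
      using member_le_sum[of i UNIV "\<lambda>i. (norm (1 - cis (2 * pi * x t $ i)))\<^sup>2"] by simp
    then have "norm (1 - cis (2 * pi * x t $ i)) \<le> sqrt \<tau>" for i by (simp add: real_le_rsqrt)
    then have "\<forall>i. \<exists>z\<in>\<int>. \<bar>z - x t $ i\<bar> \<le> sqrt \<tau>" using near_integer_of_cis by blast
    then obtain z where z: "\<And>i. z i \<in> \<int>" "\<And>i. \<bar>z i - x t $ i\<bar> \<le> sqrt \<tau>" by metis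
    define k where "k = (\<chi> i. z i)"
    have "norm (k - x t) \<le> (\<Sum>i\<in>UNIV. \<bar>(k - x t) $ i\<bar>)" by (rule norm_le_l1_cart)
    also have "\<dots> \<le> (\<Sum>i\<in>(UNIV::'n set). sqrt \<tau>)" by (rule sum_mono) (use z in \<open>auto simp: k_def\<close>)
    also have "\<dots> = \<delta>" by (simp add: \<delta> n_def)
    finally have nk: "norm (k - x t) \<le> \<delta>" .
    then have kS: "k \<in> ?S" using z t by (auto simp: near_def lattice_def k_def x_def)
    have "T t \<le> \<tau> * P t" unfolding T_def R_def by (simp add: sum_nonneg)
    also have "\<dots> \<le> m" unfolding m_def P_def n_def
      using \<tau> norm_tent_le by (intro mult_left_mono power_mono) auto
    also have "\<dots> = (if t \<in> {u k..v k} then m else 0)" using uv(5)[OF kS t nk] by simp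
    also have "\<dots> \<le> (\<Sum>k\<in>?S. if t \<in> {u k..v k} then m else 0)"
      by (rule member_le_sum[OF kS]) (use m0 finite_near in auto)
    finally show ?thesis .
  qed
  have intP: "P integrable_on {a..b}" "\<bar>integral {a..b} P - (b - a) * A ^ n\<bar> \<le> A ^ n * wave_sum (2 * real M) q"
    using mean_square[where L = "2*M" and \<beta> = "tent M" and q = q] tent_energy[where 'n='n, of M]
    by (simp_all add: P_def[abs_def] x_def A_def n_def)
  have intR: "R i integrable_on {a..b}"
    "\<bar>integral {a..b} (R i) - (b - a) * (Z * A ^ (n - 1))\<bar> \<le> Z * A ^ (n - 1) * wave_sum (2 * real M) q" for i
    using mean_square[where L = "2*M" and \<beta> = "tent_diff M i" and q = q] tent_diff_energy[of M i]
    by (simp_all add: R_def[abs_def] x_def A_def Z_def n_def)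
  have An: "A ^ n = A * A ^ (n - 1)" using n1 by (simp add: power_eq_if)
  have Pge: "A ^ n * ((b - a) / 2) \<le> integral {a..b} P"
  proof -
    have "A ^ n * wave_sum (2 * real M) q \<le> A ^ n * ((b - a) / 2)" using S A0 by (intro mult_left_mono) auto
    then show ?thesis using intP(2) by (simp add: algebra_simps abs_le_iff)
  qed
  have Rle: "integral {a..b} (R i) \<le> 9 / (real M)\<^sup>2 * (A ^ n * (b - a))" for i
  proof -
    have "Z * A ^ (n - 1) \<le> 6 * A / (real M)\<^sup>2 * A ^ (n - 1)" using ZA A0 by (intro mult_right_mono) auto
    also have "\<dots> = 6 / (real M)\<^sup>2 * A ^ n" by (simp add: An)
    finally have e: "Z * A ^ (n - 1) \<le> 6 / (real M)\<^sup>2 * A ^ n" .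
    have "integral {a..b} (R i) \<le> Z * A ^ (n - 1) * ((b - a) + wave_sum (2 * real M) q)"
      using intR(2)[of i] by (simp add: algebra_simps abs_le_iff)
    also have "\<dots> \<le> (6 / (real M)\<^sup>2 * A ^ n) * ((b - a) + (b - a) / 2)"
      by (rule mult_mono[OF e]) (use S A0 ab wave_sum_nonneg[of "2 * real M" q] in auto)
    also have "(b - a) + (b - a) / 2 = 3 / 2 * (b - a)" by (simp add: field_simps)
    also have "(6 / (real M)\<^sup>2 * A ^ n) * (3 / 2 * (b - a)) = 9 / (real M)\<^sup>2 * (A ^ n * (b - a))" by simp
    finally show ?thesis .
  qed
  have intT: "(T has_integral \<tau> * integral {a..b} P - (\<Sum>i\<in>UNIV. integral {a..b} (R i))) {a..b}"
    unfolding T_def[abs_def]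
    by (intro has_integral_diff has_integral_mult_right has_integral_sum integrable_integral intP intR) auto
  have "((\<lambda>t. \<Sum>k\<in>?S. if t \<in> {u k..v k} then m else 0) has_integral (\<Sum>k\<in>?S. m * (v k - u k))) {a..b}"
    by (intro has_integral_sum finite_near has_integral_indicator_interval) (use uv in auto)
  from has_integral_le[OF intT this point]
  have "\<tau> * integral {a..b} P - (\<Sum>i\<in>UNIV. integral {a..b} (R i)) \<le> (\<Sum>k\<in>?S. m * (v k - u k))" .
  also have "\<dots> \<le> (\<Sum>k\<in>?S. m * (2 * l))" using uv(4) m0 by (intro sum_mono mult_left_mono) auto
  also have "\<dots> = card ?S * (m * (2 * l))" by simp
  finally have up: "\<tau> * integral {a..b} P - (\<Sum>i\<in>UNIV. integral {a..b} (R i)) \<le> card ?S * (m * (2 * l))" .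
  have "(\<Sum>i\<in>(UNIV::'n set). integral {a..b} (R i)) \<le> (\<Sum>i\<in>(UNIV::'n set). 9 / (real M)\<^sup>2 * (A ^ n * (b - a)))"
    by (rule sum_mono[OF Rle])
  also have "\<dots> = n * (9 / (real M)\<^sup>2 * (A ^ n * (b - a)))" by (simp add: n_def)
  finally have "(\<Sum>i\<in>(UNIV::'n set). integral {a..b} (R i)) \<le> n * (9 / (real M)\<^sup>2 * (A ^ n * (b - a)))" .
  moreover have "\<tau> * (A ^ n * ((b - a) / 2)) \<le> \<tau> * integral {a..b} P" using Pge \<tau> by (intro mult_left_mono) auto
  moreover have "\<tau> * (A ^ n * ((b - a) / 2)) = n * (9 / (real M)\<^sup>2 * (A ^ n * (b - a))) + \<tau> / 20 * (A ^ n * (b - a))"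
    using M0 by (simp add: \<tau>_def field_simps)
  moreover have "z \<le> w" if "s \<le> x" "y \<le> i" "y = x + z" "i - s \<le> w" for s x y i z w :: real
    using that by linarith
  ultimately have "\<tau> / 20 * (A ^ n * (b - a)) \<le> card ?S * (m * (2 * l))" using up by blast
  \<comment> \<open>The bound for the squared kernel is \<open>9^n * M^(4 n)\<close>, while
    \<open>A ^ n >= M^(3 n) / 3^n\<close>. Cancelling \<open>M^(3 n)\<close> leaves
    \<open>M ^ n * l\<close>, and \<open>l\<close> is of order \<open>1 / (M * q)\<close>; hence the
    exponent \<open>n - 1\<close>.\<close>
  then have "\<tau> * (A ^ n * (b - a) / 20) \<le> \<tau> * (card ?S * ((9 ^ n * (real M ^ n * real M ^ (3 * n))) * (2 * l)))"
  proof -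
    have "((3 * (real M)\<^sup>2) ^ n)\<^sup>2 = 9 ^ n * (real M ^ n * real M ^ (3 * n))"
      by (simp add: power_mult_distrib power_mult[symmetric] power_add[symmetric] mult.commute[of n])
        (simp add: power_mult)
    then show ?thesis using \<open>\<tau> / 20 * (A ^ n * (b - a)) \<le> _\<close> by (simp add: m_def mult_ac)
  qed
  then have "A ^ n * (b - a) / 20 \<le> card ?S * ((9 ^ n * (real M ^ n * real M ^ (3 * n))) * (2 * l))"
    using \<tau> by (simp only: mult_le_cancel_left_pos)
  moreover have "(real M ^ 3 / 3) ^ n * (b - a) / 20 \<le> A ^ n * (b - a) / 20"
    using A ab by (intro divide_right_mono mult_right_mono power_mono) auto
  ultimately have "(real M ^ 3 / 3) ^ n * (b - a) / 20 \<le> card ?S * ((9 ^ n * (real M ^ n * real M ^ (3 * n))) * (2 * l))"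
    by linarith
  then have "real M ^ (3 * n) * ((b - a) / (20 * 3 ^ n)) \<le> real M ^ (3 * n) * (card ?S * (9 ^ n * real M ^ n * (2 * l)))"
    by (simp add: power_divide power_mult[symmetric] mult_ac)
  then have "(b - a) / (20 * 3 ^ n) \<le> card ?S * (9 ^ n * real M ^ n * (2 * l))"
    using M0 by (simp only: mult_le_cancel_left_pos zero_less_power)
  also have "\<dots> = 9 ^ n * 4 * near_radius * (card ?S * real M ^ (n - 1)) / (q * c)"
  proof -
    have "real M ^ n = real M * real M ^ (n - 1)" using n1 by (simp add: power_eq_if)
    then show ?thesis using M0 by (simp add: l_def \<delta>_def)
  qed
  finally have "(b - a) * (q * c) \<le> 9 ^ n * 4 * near_radius * (card ?S * real M ^ (n - 1)) * (20 * 3 ^ n)"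
    using q c_pos by (simp add: field_simps)
  also have "\<dots> = 80 * (9 ^ n * 3 ^ n) * near_radius * (card ?S * real M ^ (n - 1))" by simp
  also have "(9::real) ^ n * 3 ^ n = 27 ^ n" by (simp add: power_mult_distrib[symmetric])
  finally have "(b - a) * c * q \<le> (80 * 27 ^ n * near_radius) * (card ?S * real M ^ (n - 1))"
    by (simp only: mult_ac)
  then show ?thesis
    using near_radius_pos unfolding lower_const_def by (simp add: pos_divide_le_eq field_simps \<delta>_def n_def)
qed

end

section \<open>Counting lattice points near an arc\<close>

text \<open>The cube of half side \<open>h = \<delta> / n\<close> lies in the ball by the l1 bound,
  and each of its sides contains at least \<open>2 * h - 1 >= h\<close> integers because
  \<open>h >= 1\<close>.\<close>

lemma card_lattice_ball_ge:
  fixes y :: "real ^ 'n"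
  assumes "real CARD('n) \<le> \<delta>"
  shows "(\<delta> / CARD('n)) ^ CARD('n) \<le> card {k \<in> lattice. norm (k - y) \<le> \<delta>}"
proof -
  define n where "n = real CARD('n)"
  have n: "n > 0" by (simp add: n_def)
  define h where "h = \<delta> / n"
  have h: "h \<ge> 1" using assms n by (simp add: h_def n_def)
  define T where "T i = {\<lceil>y $ i - h\<rceil>..\<lfloor>y $ i + h\<rfloor>}" for i
  define v where "v f = (\<chi> i. real_of_int (f i))" for f :: "'n \<Rightarrow> int"
  let ?A = "{k \<in> lattice. norm (k - y) \<le> \<delta>}"
  have inj: "inj_on v (PiE UNIV T)" by (auto simp: inj_on_def v_def vec_eq_iff)
  have sub: "v ` PiE UNIV T \<subseteq> ?A"
  proof clarify
    fix f assume f: "f \<in> PiE UNIV T"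
    have "\<bar>real_of_int (f i) - y $ i\<bar> \<le> h" for i
    proof -
      have "\<lceil>y $ i - h\<rceil> \<le> f i" "f i \<le> \<lfloor>y $ i + h\<rfloor>" using f by (auto simp: T_def PiE_iff)
      then have "y $ i - h \<le> f i" "f i \<le> y $ i + h" by (simp_all add: ceiling_le_iff le_floor_iff)
      then show ?thesis by linarith
    qed
    then have "(\<Sum>i\<in>(UNIV::'n set). \<bar>(v f - y) $ i\<bar>) \<le> (\<Sum>i\<in>(UNIV::'n set). h)"
      by (intro sum_mono) (simp add: v_def)
    also have "\<dots> = \<delta>" using n by (simp add: h_def n_def)
    finally have "norm (v f - y) \<le> \<delta>" using norm_le_l1_cart[of "v f - y"] by linarith
    then show "v f \<in> lattice \<and> norm (v f - y) \<le> \<delta>" by (simp add: lattice_def v_def)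
  qed
  have "h ^ CARD('n) = (\<Prod>i\<in>(UNIV::'n set). h)" by simp
  also have "\<dots> \<le> (\<Prod>i\<in>UNIV. real (card (T i)))"
  proof (intro prod_mono conjI)
    fix i
    have "2 * h - 1 \<le> of_int (\<lfloor>y $ i + h\<rfloor> - \<lceil>y $ i - h\<rceil> + 1)" by simp linarith
    moreover have "real (card (T i)) = of_int (max 0 (\<lfloor>y $ i + h\<rfloor> - \<lceil>y $ i - h\<rceil> + 1))"
      by (simp add: T_def max_def)
    ultimately show "h \<le> real (card (T i))" using h by linarith
  qed (use h in auto)
  also have "\<dots> = real (card (PiE UNIV T))" by (simp add: card_PiE)
  also have "card (PiE UNIV T) = card (v ` PiE UNIV T)" using card_image[OF inj] by simp
  also have "real \<dots> \<le> card ?A"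
    using card_mono[OF lattice_near_point(1) sub] assms by simp
  finally show ?thesis by (simp add: h_def n_def)
qed

text \<open>The number \<open>D\<close> of the overview in closed form: the maximum of
  \<open>s * (n + 2 - s) - 1\<close> is attained at \<open>s = (n + 2) / 2\<close> for even
  \<open>n\<close>, and at \<open>s = (n + 1) / 2\<close> and \<open>(n + 3) / 2\<close> for odd
  \<open>n\<close>.\<close>

definition critical_exponent :: "nat \<Rightarrow> real" where
  "critical_exponent n = (if even n then real n * (real n + 4) / 4 else (real n * (real n + 4) - 1) / 4)"

lemma critical_exponent_pos: "1 \<le> n \<Longrightarrow> 0 < critical_exponent n"
proof -
  assume n: "1 \<le> n"
  have "1 * (1 + 4) \<le> real n * (real n + 4)" using n by (intro mult_mono) auto
  then show ?thesis unfolding critical_exponent_def by simp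
qed

lemma Theta_critical_exponent:
  assumes "1 \<le> n"
  shows "Theta n = 1 - (real n - 1) / critical_exponent n"
proof (cases "even n")
  case True
  have p: "real n * (real n + 4) > 0" using assms by simp
  have "1 - (real n - 1) / critical_exponent n = (real n * (real n + 4) - 4 * (real n - 1)) / (real n * (real n + 4))"
    using True p assms by (simp add: critical_exponent_def diff_divide_distrib)
  also have "\<dots> = (real n ^ 2 + 4) / (real n * (real n + 4))"
    by (simp add: power2_eq_square algebra_simps)
  finally show ?thesis using True by (simp add: Theta_def)
next
  case False
  have "1 * (1 + 4) \<le> real n * (real n + 4)" using assms by (intro mult_mono) auto
  then have p: "real n * (real n + 4) - 1 > 0" by simp
  have "1 - (real n - 1) / critical_exponent n = 1 - 4 * (real n - 1) / (real n * (real n + 4) - 1)"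
    using False by (simp add: critical_exponent_def mult.commute)
  also have "\<dots> = (real n * (real n + 4) - 1 - 4 * (real n - 1)) / (real n * (real n + 4) - 1)"
    using p diff_divide_distrib[of "real n * (real n + 4) - 1" "4 * (real n - 1)" "real n * (real n + 4) - 1"] by simp
  also have "\<dots> = (real n ^ 2 + 3) / (real n * (real n + 4) - 1)"
    by (simp add: power2_eq_square algebra_simps)
  finally show ?thesis using False by (simp add: Theta_def)
qed

lemma Theta_nonneg: "1 \<le> n \<Longrightarrow> 0 \<le> Theta n"
proof -
  assume n: "1 \<le> n"
  have "1 * (1 + 4) \<le> real n * (real n + 4)" using n by (intro mult_mono) auto
  then show ?thesis unfolding Theta_def by auto
qed

text \<open>Completing the square, the gap is \<open>(n + 2 - 2 s)^2 / 4\<close> for even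
  \<open>n\<close> and \<open>((n + 2 - 2 s)^2 - 1) / 4\<close> for odd \<open>n\<close>; in the odd
  case the integer inside cannot be 0.\<close>

lemma scale_le_critical_exponent:
  "real s * (real n + 2 - real s) - 1 \<le> critical_exponent n"
proof (cases "even n")
  case True
  have "0 \<le> (real n + 2 - 2 * real s)\<^sup>2" by simp
  then show ?thesis using True by (simp add: critical_exponent_def power2_eq_square algebra_simps)
next
  case False
  define z where "z = int n + 2 - 2 * int s"
  have "z \<noteq> 0" using False unfolding z_def by presburger
  then have "1 \<le> z\<^sup>2" by (metis one_le_numeral power2_eq_1_iff zero_less_power2 int_one_le_iff_zero_less)
  then have "1 \<le> (real_of_int z)\<^sup>2" by (metis of_int_1_le_iff of_int_power)
  then have "1 \<le> (real n + 2 - 2 * real s)\<^sup>2" by (simp add: z_def)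
  then show ?thesis using False by (simp add: critical_exponent_def power2_eq_square algebra_simps)
qed

lemma half_le_floor:
  fixes x :: real
  assumes "1 \<le> x"
  shows "1 \<le> nat \<lfloor>x\<rfloor>" "real (nat \<lfloor>x\<rfloor>) \<le> x" "x / 2 \<le> real (nat \<lfloor>x\<rfloor>)"
proof -
  have "1 \<le> \<lfloor>x\<rfloor>" using assms by simp
  then have "nat 1 \<le> nat \<lfloor>x\<rfloor>" by (rule nat_mono)
  then show "1 \<le> nat \<lfloor>x\<rfloor>" by simp
  have e: "real (nat \<lfloor>x\<rfloor>) = of_int \<lfloor>x\<rfloor>" using \<open>1 \<le> \<lfloor>x\<rfloor>\<close> by simp
  show "real (nat \<lfloor>x\<rfloor>) \<le> x" unfolding e by simp
  have "1 \<le> real_of_int \<lfloor>x\<rfloor>" using \<open>1 \<le> \<lfloor>x\<rfloor>\<close> by simp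
  then show "x / 2 \<le> real (nat \<lfloor>x\<rfloor>)" unfolding e by linarith
qed

context nondegenerate_arc
begin

lemma near_mono: "\<delta> \<le> \<delta>' \<Longrightarrow> near q \<delta> \<subseteq> near q \<delta>'"
  by (force simp: near_def)

lemma card_near_mono: "\<delta> \<le> \<delta>' \<Longrightarrow> card (near q \<delta>) \<le> card (near q \<delta>')"
  by (intro card_mono finite_near near_mono)

text \<open>A parameter step of \<open>1 / q\<close> moves the dilated arc by at most
  \<open>B\<close>, so about \<open>q\<close> balls of a fixed radius cover the
  neighbourhood.\<close>

lemma card_near_trivial:
  assumes q: "1 \<le> q" and \<Delta>: "0 \<le> \<Delta>"
  shows "real (card (near q \<Delta>)) \<le> (b - a + 1) * (2 * (\<Delta> + B) + 2) ^ CARD('n) * q"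
proof -
  define m where "m = nat \<lfloor>(b - a) * q\<rfloor>"
  have "0 \<le> (b - a) * q" using ab q by simp
  then have mle: "real m \<le> (b - a) * q" unfolding m_def by simp
  define P where "P i = {k \<in> lattice. norm (k - q *\<^sub>R G 0 (a + real i / q)) \<le> \<Delta> + B}" for i :: nat
  have sub: "near q \<Delta> \<subseteq> (\<Union>i\<in>{..m}. P i)"
  proof
    fix k assume "k \<in> near q \<Delta>"
    then obtain t where t: "k \<in> lattice" "t \<in> {a..b}" "norm (k - q *\<^sub>R G 0 t) \<le> \<Delta>" by (auto simp: near_def)
    define i where "i = nat \<lfloor>(t - a) * q\<rfloor>"
    have ta: "0 \<le> (t - a) * q" "(t - a) * q \<le> (b - a) * q" using t q by (auto intro!: mult_right_mono)
    have im: "i \<le> m" using ta by (auto simp: i_def m_def intro!: nat_mono floor_mono)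
    have "real i \<le> (t - a) * q" "(t - a) * q < real i + 1" using ta unfolding i_def by (auto simp: of_nat_nat)
    then have i: "real i / q \<le> t - a" "t - a < (real i + 1) / q" using q by (auto simp: field_simps)
    then have dt: "\<bar>t - (a + real i / q)\<bar> \<le> 1 / q" by (simp add: add_divide_distrib)
    have ti: "a + real i / q \<in> {a..b}" using i t q by auto
    have "norm (q *\<^sub>R G 0 t - q *\<^sub>R G 0 (a + real i / q)) \<le> q * (B * \<bar>t - (a + real i / q)\<bar>)"
      by (rule q_lipschitz) (use t ti q in auto)
    also have "\<dots> \<le> q * (B * (1 / q))" using dt q B_nonneg by (intro mult_left_mono) auto
    also have "\<dots> = B" using q by simp
    finally have "norm (k - q *\<^sub>R G 0 (a + real i / q)) \<le> \<Delta> + B"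
      using t(3) norm_triangle_ineq[of "k - q *\<^sub>R G 0 t" "q *\<^sub>R G 0 t - q *\<^sub>R G 0 (a + real i / q)"] by simp
    then show "k \<in> (\<Union>i\<in>{..m}. P i)" using im t(1) by (auto simp: P_def)
  qed
  have P: "finite (P i)" "real (card (P i)) \<le> (2 * (\<Delta> + B) + 2) ^ CARD('n)" for i
    using lattice_near_point[of "\<Delta> + B"] \<Delta> B_nonneg by (auto simp: P_def)
  have "card (near q \<Delta>) \<le> card (\<Union>i\<in>{..m}. P i)" by (rule card_mono[OF _ sub]) (use P in auto)
  also have "\<dots> \<le> (\<Sum>i\<in>{..m}. card (P i))" by (rule card_UN_le) simp
  finally have "real (card (near q \<Delta>)) \<le> (\<Sum>i\<in>{..m}. real (card (P i)))" using of_nat_mono by fastforce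
  also have "\<dots> \<le> (\<Sum>i\<in>{..m}. (2 * (\<Delta> + B) + 2) ^ CARD('n))" by (rule sum_mono) (rule P)
  also have "\<dots> = (real m + 1) * (2 * (\<Delta> + B) + 2) ^ CARD('n)" by simp
  also have "\<dots> \<le> ((b - a + 1) * q) * (2 * (\<Delta> + B) + 2) ^ CARD('n)"
    by (rule mult_right_mono) (use mle q \<Delta> B_nonneg in \<open>auto simp: algebra_simps\<close>)
  finally show ?thesis by (simp add: mult_ac)
qed

text \<open>No Fourier analysis is needed here: by \<open>chord\<close>, parameters at distance
  \<open>h = 3 * \<delta> / (q * c)\<close> have points at distance at least
  \<open>3 * \<delta>\<close> on the dilated arc, so the balls of radius \<open>\<delta>\<close> are
  disjoint and each holds many lattice points.\<close>

lemma card_near_large_radius: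
  assumes q: "0 < q" and \<delta>: "real CARD('n) \<le> \<delta>"
  shows "(b - a) * c / (3 * CARD('n) ^ CARD('n)) * \<delta> ^ (CARD('n) - 1) * q \<le> card (near q \<delta>)"
proof -
  define n where "n = CARD('n)"
  have n1: "n \<ge> 1" by (simp add: n_def Suc_leI)
  have "real n \<ge> 1" using n1 by simp
  then have \<delta>0: "\<delta> > 0" using \<delta> unfolding n_def by linarith
  define h where "h = 3 * \<delta> / (q * c)"
  have h: "h > 0" using q c_pos \<delta>0 by (simp add: h_def)
  define m where "m = nat \<lfloor>(b - a) / h\<rfloor>"
  have "0 \<le> (b - a) / h" using ab h by simp
  then have m: "real m \<le> (b - a) / h" "(b - a) / h \<le> real m + 1" unfolding m_def by simp_all
  define t where "t i = a + real i * h" for i :: nat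
  have t: "t i \<in> {a..b}" if "i \<le> m" for i
  proof -
    have "real i \<le> (b - a) / h" using that m by linarith
    then show ?thesis using h by (auto simp: t_def field_simps)
  qed
  define P where "P i = {k \<in> lattice. norm (k - q *\<^sub>R G 0 (t i)) \<le> \<delta>}" for i
  have fin: "finite (P i)" for i unfolding P_def by (rule lattice_near_point) (use \<delta>0 in auto)
  have disj: "P i \<inter> P j = {}" if ij: "i \<le> m" "j \<le> m" "i \<noteq> j" for i j
  proof (rule ccontr)
    assume "P i \<inter> P j \<noteq> {}"
    then obtain k where k: "norm (k - q *\<^sub>R G 0 (t i)) \<le> \<delta>" "norm (k - q *\<^sub>R G 0 (t j)) \<le> \<delta>" by (auto simp: P_def)
    have "1 \<le> \<bar>real i - real j\<bar>" using ij by linarith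
    then have "1 * h \<le> \<bar>real i - real j\<bar> * h" using h by (intro mult_right_mono) auto
    also have "\<dots> = \<bar>t i - t j\<bar>" using h by (simp add: t_def abs_mult left_diff_distrib[symmetric])
    finally have "q * (c * h) \<le> q * (c * \<bar>t i - t j\<bar>)" using q c_pos by simp
    also have "\<dots> \<le> q * norm (G 0 (t i) - G 0 (t j))" using chord[OF t t] ij q by simp
    also have "\<dots> = norm ((k - q *\<^sub>R G 0 (t j)) - (k - q *\<^sub>R G 0 (t i)))"
      using q by (simp add: scaleR_diff_right[symmetric])
    also have "\<dots> \<le> 2 * \<delta>" using norm_triangle_ineq4[of "k - q *\<^sub>R G 0 (t j)" "k - q *\<^sub>R G 0 (t i)"] k by linarith
    finally have "3 * \<delta> \<le> 2 * \<delta>" using q c_pos by (simp add: h_def)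
    then show False using \<delta>0 by simp
  qed
  have "(b - a) / h * (\<delta> / n) ^ n \<le> (real m + 1) * (\<delta> / n) ^ n"
    using m \<delta>0 by (intro mult_right_mono) auto
  also have "\<dots> = (\<Sum>i\<in>{..m}. (\<delta> / n) ^ n)" by simp
  also have "\<dots> \<le> (\<Sum>i\<in>{..m}. real (card (P i)))"
    unfolding n_def P_def by (intro sum_mono card_lattice_ball_ge \<delta>)
  also have "\<dots> = real (card (\<Union>i\<in>{..m}. P i))"
    by (subst card_UN_disjoint) (use fin disj in auto)
  also have "\<dots> \<le> card (near q \<delta>)"
    using t by (intro of_nat_mono card_mono finite_near) (auto simp: P_def near_def)
  finally have "(b - a) / h * (\<delta> / n) ^ n \<le> card (near q \<delta>)" .
  moreover have "(b - a) / h * (\<delta> / n) ^ n = (b - a) * c / (3 * n ^ n) * \<delta> ^ (n - 1) * q"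
  proof -
    have "\<delta> ^ n = \<delta> * \<delta> ^ (n - 1)" using n1 by (simp add: power_eq_if)
    then show ?thesis using \<delta>0 by (simp add: h_def power_divide)
  qed
  ultimately show ?thesis by (simp add: n_def)
qed

text \<open>\<open>X\<close> is the largest \<open>N\<close> that \<open>wave_sum_small\<close>
  admits. Radii above \<open>1 / (12 X)\<close> take \<open>N\<close> near
  \<open>1 / (12 \<delta>)\<close> and produce the volume term; smaller ones take \<open>N\<close>
  near \<open>X\<close> and produce \<open>q / X^(n-1)\<close>, which is
  \<open>q powr Theta n\<close> up to the loss from \<open>\<kappa>\<close>. Bounded
  \<open>q\<close> and radii from 1/12 on fall under \<open>card_near_trivial\<close>.\<close>

lemma near_upper_bound:
  assumes n3: "3 \<le> CARD('n)" and \<nu>: "0 < \<nu>" and \<Delta>: "0 < \<Delta>"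
  shows "\<exists>C>0. \<forall>\<delta> q. 0 \<le> \<delta> \<and> \<delta> < \<Delta> \<and> 1 \<le> q \<longrightarrow>
    real (card (near q \<delta>)) \<le> C * (\<delta> ^ (CARD('n) - 1) * q + q powr (Theta CARD('n) + \<nu>))"
proof -
  define n where "n = CARD('n)"
  define D where "D = critical_exponent n"
  have n: "n \<ge> 3" using n3 by (simp add: n_def)
  have D: "D > 0" using n critical_exponent_pos by (simp add: D_def)
  \<comment> \<open>The bound 1/2 keeps \<open>X >= 1\<close>; the other makes the loss
    \<open>\<kappa> * (n - 1) / D\<close> in the exponent at most \<open>\<nu>\<close>.\<close>
  define \<kappa> where "\<kappa> = min (1/2) (\<nu> * D / (real n - 1))"
  have \<kappa>: "0 < \<kappa>" "\<kappa> \<le> 1/2" "\<kappa> * (real n - 1) / D \<le> \<nu>"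
    using \<nu> D n by (auto simp: \<kappa>_def min_def field_simps)
  obtain Q where Q: "Q \<ge> 1" "\<And>q N. q > Q \<Longrightarrow> 1 \<le> N \<Longrightarrow> N powr D \<le> q powr (1 - \<kappa>) \<Longrightarrow> wave_sum N q \<le> b - a"
    using wave_sum_small[of \<kappa> "b - a" D] \<kappa> ab n scale_le_critical_exponent unfolding D_def n_def by force
  define C1 where "C1 = (b - a + 1) * (2 * (\<Delta> + B) + 2) ^ n"
  have C1: "C1 \<ge> 0" using ab \<Delta> B_nonneg by (simp add: C1_def)
  have U: "upper_const \<ge> 0" using ab B_nonneg by (simp add: upper_const_def)
  define C where "C = C1 * Q + C1 * 12 ^ (n - 1) + upper_const * 24 ^ (n - 1) + 1"
  have Cge: "C1 * Q \<le> C" "C1 * 12 ^ (n - 1) \<le> C" "upper_const * 24 ^ (n - 1) \<le> C" "C > 0"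
    using C1 U Q(1) by (auto simp: C_def intro!: add_nonneg_pos add_nonneg_nonneg mult_nonneg_nonneg)
  have "card (near q \<delta>) \<le> C * (\<delta> ^ (n - 1) * q + q powr (Theta n + \<nu>))"
    if \<delta>: "0 \<le> \<delta>" "\<delta> < \<Delta>" and q: "1 \<le> q" for \<delta> q
  proof -
    have T0: "0 \<le> \<delta> ^ (n - 1) * q" "0 \<le> q powr (Theta n + \<nu>)" using \<delta> q by auto
    have CT: "0 \<le> C * (\<delta> ^ (n - 1) * q)" "0 \<le> C * q powr (Theta n + \<nu>)"
      by (intro mult_nonneg_nonneg T0 less_imp_le[OF Cge(4)])+
    have first: ?thesis if "real (card (near q \<delta>)) \<le> C * (\<delta> ^ (n - 1) * q)"
      using that CT unfolding distrib_left by linarith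
    have second: ?thesis if "real (card (near q \<delta>)) \<le> C * q powr (Theta n + \<nu>)"
      using that CT unfolding distrib_left by linarith
    have "card (near q \<delta>) \<le> card (near q \<Delta>)" using \<delta> by (intro card_near_mono) auto
    also have "real \<dots> \<le> C1 * q" using card_near_trivial[OF q, of \<Delta>] \<Delta> by (simp add: C1_def n_def)
    finally have triv: "real (card (near q \<delta>)) \<le> C1 * q" by simp
    show ?thesis
    proof (cases "q \<le> Q")
      case True
      have "C1 * q \<le> (C1 * Q) * 1" using True C1 by (simp add: mult_left_mono)
      also have "\<dots> \<le> C * q powr (Theta n + \<nu>)"
        using Cge q \<nu> n Theta_nonneg[of n] C1 Q(1) by (intro mult_mono ge_one_powr_ge_zero) auto
      finally show ?thesis using triv by (intro second) linarith
    next
      case False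
      then have qQ: "q > Q" by simp
      show ?thesis
      proof (cases "1 / 12 \<le> \<delta>")
        case True
        have "1 \<le> (12 * \<delta>) ^ (n - 1)" using True by (intro one_le_power) auto
        then have "1 * (C1 * q) \<le> (12 * \<delta>) ^ (n - 1) * (C1 * q)" using C1 q by (intro mult_right_mono) auto
        also have "\<dots> = (C1 * 12 ^ (n - 1)) * (\<delta> ^ (n - 1) * q)" by (simp add: power_mult_distrib)
        also have "\<dots> \<le> C * (\<delta> ^ (n - 1) * q)" using Cge T0 by (intro mult_right_mono) auto
        finally show ?thesis using triv by (intro first) linarith
      next
        case False
        define X where "X = q powr ((1 - \<kappa>) / D)"
        have X1: "X \<ge> 1" unfolding X_def using q \<kappa> D by (intro ge_one_powr_ge_zero) auto
        have XD: "X powr D = q powr (1 - \<kappa>)" using D by (simp add: X_def powr_powr)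
        have key: "real (card (near q \<delta>)) * real N ^ (n - 1) \<le> upper_const * q"
          if N: "1 \<le> N" "real N \<le> X" "\<delta> \<le> 1 / (12 * real N)" for N
        proof -
          have "real N powr D \<le> X powr D" using N D by (intro powr_mono2) auto
          then have "wave_sum (real N) q \<le> b - a" using N XD by (intro Q(2)[OF qQ]) auto
          then have "real (card (near q (1 / (12 * real N)))) * real N ^ (n - 1) \<le> upper_const * q"
            using card_near_upper[OF q N(1)] by (simp add: n_def)
          moreover have "real (card (near q \<delta>)) * real N ^ (n - 1) \<le> real (card (near q (1 / (12 * real N)))) * real N ^ (n - 1)"
            using card_near_mono[OF N(3)] by (intro mult_right_mono) auto
          ultimately show ?thesis by linarith
        qed
        show ?thesis
        proof (cases "12 * \<delta> * X \<le> 1")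
          case True
          define N where "N = nat \<lfloor>X\<rfloor>"
          have N: "1 \<le> N" "real N \<le> X" "X / 2 \<le> real N" using half_le_floor[OF X1] by (auto simp: N_def)
          have "12 * \<delta> * real N \<le> 12 * \<delta> * X" using \<delta> N by (intro mult_left_mono) auto
          then have "\<delta> \<le> 1 / (12 * real N)" using True N by (simp add: field_simps)
          then have "real (card (near q \<delta>)) * real N ^ (n - 1) \<le> upper_const * q" by (intro key N)
          moreover have "real (card (near q \<delta>)) * (X / 2) ^ (n - 1) \<le> real (card (near q \<delta>)) * real N ^ (n - 1)"
            using N X1 by (intro mult_left_mono power_mono) auto
          ultimately have "real (card (near q \<delta>)) * (X / 2) ^ (n - 1) \<le> upper_const * q" by linarith
          then have "real (card (near q \<delta>)) \<le> upper_const * 2 ^ (n - 1) * (q / X ^ (n - 1))"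
            using X1 by (simp add: field_simps power_divide)
          also have "q / X ^ (n - 1) = q powr (Theta n + \<kappa> * (real n - 1) / D)"
          proof -
            have "X ^ (n - 1) = q powr ((1 - \<kappa>) / D * (real n - 1))"
            proof -
              have "X ^ (n - 1) = X powr real (n - 1)" using X1 by (simp add: powr_realpow)
              also have "\<dots> = q powr ((1 - \<kappa>) / D * real (n - 1))" unfolding X_def by (rule powr_powr)
              also have "real (n - 1) = real n - 1" using n by (simp add: of_nat_diff)
              finally show ?thesis .
            qed
            then have "q / X ^ (n - 1) = q powr (1 - (1 - \<kappa>) / D * (real n - 1))"
              using q by (simp add: powr_diff)
            also have "1 - (1 - \<kappa>) / D * (real n - 1) = Theta n + \<kappa> * (real n - 1) / D"
              using Theta_critical_exponent[of n] n D by (simp add: D_def[symmetric] field_simps)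
            finally show ?thesis .
          qed
          also have "upper_const * 2 ^ (n - 1) * q powr (Theta n + \<kappa> * (real n - 1) / D)
              \<le> C * q powr (Theta n + \<nu>)"
          proof (rule mult_mono)
            have "upper_const * 2 ^ (n - 1) \<le> upper_const * 24 ^ (n - 1)"
              using U by (intro mult_left_mono power_mono) auto
            then show "upper_const * 2 ^ (n - 1) \<le> C" using Cge by linarith
            show "q powr (Theta n + \<kappa> * (real n - 1) / D) \<le> q powr (Theta n + \<nu>)"
              using q \<kappa> by (intro powr_mono) auto
          qed (use Cge in auto)
          finally show ?thesis by (rule second)
        next
          case large: False
          then have \<delta>0: "\<delta> > 0" using \<delta> X1 by (cases "\<delta> = 0") auto
          define Y where "Y = 1 / (12 * \<delta>)"
          have Y1: "Y \<ge> 1" using \<delta>0 False by (simp add: Y_def)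
          have YX: "Y \<le> X" using large \<delta>0 by (simp add: Y_def field_simps)
          define N where "N = nat \<lfloor>Y\<rfloor>"
          have N: "1 \<le> N" "real N \<le> Y" "Y / 2 \<le> real N" using half_le_floor[OF Y1] by (auto simp: N_def)
          have "\<delta> \<le> 1 / (12 * real N)" using N(1,2) \<delta>0 by (simp add: Y_def field_simps)
          then have "real (card (near q \<delta>)) * real N ^ (n - 1) \<le> upper_const * q" using N YX by (intro key) auto
          moreover have "real (card (near q \<delta>)) * (Y / 2) ^ (n - 1) \<le> real (card (near q \<delta>)) * real N ^ (n - 1)"
            using N Y1 by (intro mult_left_mono power_mono) auto
          ultimately have "real (card (near q \<delta>)) * (Y / 2) ^ (n - 1) \<le> upper_const * q" by linarith
          then have "real (card (near q \<delta>)) \<le> upper_const * 24 ^ (n - 1) * (\<delta> ^ (n - 1) * q)"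
          proof -
            define Z where "Z = 24 ^ (n - 1) * \<delta> ^ (n - 1)"
            have Z: "Z > 0" using \<delta>0 by (simp add: Z_def)
            have "Y / 2 = 1 / (24 * \<delta>)" by (simp add: Y_def)
            then have "(Y / 2) ^ (n - 1) = 1 / (24 * \<delta>) ^ (n - 1)" by (simp only: power_one_over)
            also have "\<dots> = 1 / Z" by (simp only: Z_def power_mult_distrib)
            finally have "(Y / 2) ^ (n - 1) = 1 / Z" .
            then have "real (card (near q \<delta>)) / Z \<le> upper_const * q"
              using \<open>real (card (near q \<delta>)) * (Y / 2) ^ (n - 1) \<le> upper_const * q\<close> by simp
            then have "real (card (near q \<delta>)) \<le> upper_const * q * Z" using Z by (simp only: pos_divide_le_eq)
            then show ?thesis by (simp add: Z_def mult_ac)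
          qed
          also have "\<dots> \<le> C * (\<delta> ^ (n - 1) * q)" using Cge T0 by (intro mult_right_mono) auto
          finally show ?thesis by (rule first)
        qed
      qed
    qed
  qed
  then show ?thesis using Cge(4) unfolding n_def by blast
qed

text \<open>\<open>c0\<close> is chosen before \<open>\<nu>\<close>, as the final statement demands;
  only \<open>Q\<close> may depend on it. The exponent of \<open>q\<close> equals
  \<open>- 1 / D + \<nu>\<close>, so \<open>M\<close> near \<open>near_radius / \<delta>\<close>
  stays below \<open>q powr (1 / D)\<close> by a power of \<open>q\<close>. Radii beyond
  \<open>near_radius\<close> are left to \<open>card_near_large_radius\<close>.\<close>

lemma near_lower_bound:
  assumes n3: "3 \<le> CARD('n)"
  shows "\<exists>c0>0. \<forall>\<nu>>0. \<exists>Q>0. \<forall>q\<ge>1. q > Q \<longrightarrow>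
    (\<forall>\<delta>. q powr ((Theta CARD('n) - 1) / (real CARD('n) - 1) + \<nu>) < \<delta> \<longrightarrow>
      c0 * \<delta> ^ (CARD('n) - 1) * q \<le> real (card (near q \<delta>)))"
proof -
  define n where "n = CARD('n)"
  define D where "D = critical_exponent n"
  define R where "R = near_radius"
  have n: "n \<ge> 3" using n3 by (simp add: n_def)
  have D: "D > 0" using n critical_exponent_pos by (simp add: D_def)
  have R: "R \<ge> n" "R \<ge> 1"
  proof -
    have "1 \<le> sqrt (20 * real n)" using n by simp
    then have "real n * 1 \<le> real n * sqrt (20 * real n)" by (intro mult_left_mono) auto
    then show "R \<ge> n" by (simp add: R_def near_radius_def n_def)
    then show "R \<ge> 1" using n by linarith
  qed
  define L where "L = (b - a) * c / (3 * n ^ n)"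
  define c0 where "c0 = min (lower_const / (2 * R) ^ (n - 1)) L"
  have L: "L > 0" using ab c_pos n by (simp add: L_def)
  have c0: "c0 > 0" "c0 \<le> lower_const / (2 * R) ^ (n - 1)" "c0 \<le> L"
    using lower_const_pos R L by (auto simp: c0_def)
  have exponent: "(Theta n - 1) / (real n - 1) = - 1 / D"
    using Theta_critical_exponent[of n] n by (simp add: D_def)
  have "\<exists>Q>0. \<forall>q\<ge>1. q > Q \<longrightarrow> (\<forall>\<delta>. q powr ((Theta n - 1) / (real n - 1) + \<nu>) < \<delta> \<longrightarrow>
      c0 * \<delta> ^ (n - 1) * q \<le> real (card (near q \<delta>)))" if \<nu>: "\<nu> > 0" for \<nu>
  proof -
    define \<mu> where "\<mu> = min \<nu> (1 / (2 * D))"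
    \<comment> \<open>The room \<open>D * \<mu> = 2 * \<kappa>\<close> is shared: one
      \<open>\<kappa>\<close> absorbs the constant \<open>(4 * R) powr D\<close> once
      \<open>q > Q0\<close>, the other is the one required by \<open>wave_sum_small\<close>.\<close>
    define \<kappa> where "\<kappa> = D * \<mu> / 2"
    have \<mu>: "\<mu> > 0" "\<mu> \<le> \<nu>" "\<mu> \<le> 1 / (2 * D)" using \<nu> D by (auto simp: \<mu>_def)
    have \<kappa>: "\<kappa> > 0" using \<mu> D by (simp add: \<kappa>_def)
    obtain Q where Q: "Q \<ge> 1" "\<And>q N. q > Q \<Longrightarrow> 1 \<le> N \<Longrightarrow> N powr D \<le> q powr (1 - \<kappa>) \<Longrightarrow> wave_sum N q \<le> (b - a) / 2"
      using wave_sum_small[of \<kappa> "(b - a) / 2" D] \<kappa> ab n scale_le_critical_exponent unfolding D_def n_def by force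
    define Q0 where "Q0 = max Q ((4 * R) powr (D / \<kappa>))"
    have "c0 * \<delta> ^ (n - 1) * q \<le> real (card (near q \<delta>))"
      if q: "q \<ge> 1" "q > Q0" and \<delta>: "q powr ((Theta n - 1) / (real n - 1) + \<nu>) < \<delta>" for q \<delta>
    proof (cases "\<delta> \<le> R")
      case False
      have "c0 * \<delta> ^ (n - 1) * q \<le> L * \<delta> ^ (n - 1) * q"
        using c0 False R q by (intro mult_right_mono) auto
      also have "\<dots> \<le> card (near q \<delta>)"
        using card_near_large_radius[of q \<delta>] q False R by (simp add: L_def n_def)
      finally show ?thesis .
    next
      case True
      have "q powr (-1 / D + \<mu>) \<le> q powr (-1 / D + \<nu>)" using q \<mu> by (intro powr_mono) auto
      then have \<delta>': "q powr (-1 / D + \<mu>) < \<delta>" using \<delta> exponent by simp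
      have q0: "q powr (-1 / D + \<mu>) > 0" using q by simp
      then have \<delta>0: "\<delta> > 0" using \<delta>' by linarith
      define M where "M = nat \<lceil>R / \<delta>\<rceil>"
      have Rd: "R / \<delta> \<ge> 1" using True \<delta>0 by simp
      then have "real M = of_int \<lceil>R / \<delta>\<rceil>" unfolding M_def by simp
      then have M: "R / \<delta> \<le> real M" "real M \<le> 2 * R / \<delta>" using Rd by linarith+
      have M1: "1 \<le> M" using M(1) Rd by linarith
      have "2 * real M \<le> 4 * R * (1 / \<delta>)" using M(2) by simp
      also have "\<dots> \<le> 4 * R * (1 / q powr (-1 / D + \<mu>))"
        using \<delta>' q0 \<delta>0 R by (intro mult_left_mono divide_left_mono) auto
      also have "\<dots> = 4 * R * q powr (1 / D - \<mu>)" by (simp add: powr_minus_divide[symmetric])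
      finally have "(2 * real M) powr D \<le> (4 * R * q powr (1 / D - \<mu>)) powr D"
        using D by (intro powr_mono2) auto
      also have "\<dots> = (4 * R) powr D * q powr (1 - 2 * \<kappa>)"
      proof -
        have "(1 / D - \<mu>) * D = 1 - 2 * \<kappa>" using D by (simp add: \<kappa>_def field_simps)
        then show ?thesis using R powr_mult[of "4 * R" "q powr (1 / D - \<mu>)" D] by (simp add: powr_powr)
      qed
      also have "\<dots> \<le> q powr \<kappa> * q powr (1 - 2 * \<kappa>)"
      proof (rule mult_right_mono)
        have "(4 * R) powr D = ((4 * R) powr (D / \<kappa>)) powr \<kappa>" using \<kappa> by (simp add: powr_powr)
        also have "\<dots> \<le> q powr \<kappa>" using q \<kappa> by (intro powr_mono2) (auto simp: Q0_def)
        finally show "(4 * R) powr D \<le> q powr \<kappa>" .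
      qed simp
      also have "\<dots> = q powr (1 - \<kappa>)" by (simp add: powr_add[symmetric])
      finally have "wave_sum (2 * real M) q \<le> (b - a) / 2"
        using Q(2)[of q "2 * real M"] q M1 by (auto simp: Q0_def)
      then have low: "lower_const * q \<le> real (card (near q (R / M))) * real M ^ (n - 1)"
        using card_near_lower[of q M] q M1 by (simp add: R_def n_def)
      have "R / M \<le> \<delta>" using M(1) M1 \<delta>0 by (simp add: field_simps)
      then have "real (card (near q (R / M))) * real M ^ (n - 1) \<le> real (card (near q \<delta>)) * (2 * R / \<delta>) ^ (n - 1)"
        using M(2) card_near_mono by (intro mult_mono power_mono) auto
      with low have "lower_const * q \<le> real (card (near q \<delta>)) * ((2 * R) ^ (n - 1) / \<delta> ^ (n - 1))"
        by (simp add: power_divide)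
      then have "lower_const / (2 * R) ^ (n - 1) * \<delta> ^ (n - 1) * q \<le> real (card (near q \<delta>))"
        using \<delta>0 R by (simp add: field_simps)
      moreover have "c0 * \<delta> ^ (n - 1) * q \<le> lower_const / (2 * R) ^ (n - 1) * \<delta> ^ (n - 1) * q"
        using c0 \<delta>0 q by (intro mult_right_mono) auto
      ultimately show ?thesis by linarith
    qed
    moreover have "Q0 > 0" using Q(1) by (simp add: Q0_def)
    ultimately show ?thesis by blast
  qed
  then show ?thesis using c0(1) unfolding n_def by blast
qed

end

section \<open>Covering the curve by arcs\<close>

text \<open>An invertible matrix does not shrink \<open>k\<close> below \<open>e * norm k\<close>,
  and by the l1 bound some entry of the image carries at least the share \<open>1 / n\<close> of
  that.\<close>

lemma matrix_columns_bounded_below: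
  fixes H :: "nat \<Rightarrow> real ^ 'n"
  assumes \<sigma>: "bij_betw \<sigma> UNIV {1..CARD('n)}" and det: "det (\<chi> i j. H (\<sigma> j) $ i) \<noteq> 0"
  obtains c0 where "0 < c0" "\<And>k. \<exists>m\<in>{1..CARD('n)}. c0 * norm k \<le> \<bar>k \<bullet> H m\<bar>"
proof -
  define A where "A = transpose (\<chi> i j. H (\<sigma> j) $ i)"
  have comp: "(A *v k) $ j = k \<bullet> H (\<sigma> j)" for k j
    by (simp add: A_def transpose_def matrix_vector_mult_def inner_vec_def mult.commute)
  have "det A \<noteq> 0" using det by (simp add: A_def det_transpose)
  then have "inj ((*v) A)" by (simp add: inj_matrix_vector_mult invertible_det_nz)
  then obtain e where e: "e > 0" "\<And>k. e * norm k \<le> norm (A *v k)"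
    using linear_inj_bounded_below_pos[of "(*v) A"] by auto
  have "\<exists>m\<in>{1..CARD('n)}. e / CARD('n) * norm k \<le> \<bar>k \<bullet> H m\<bar>" for k
  proof (rule ccontr)
    assume neg: "\<not> ?thesis"
    have "\<sigma> j \<in> {1..CARD('n)}" for j using \<sigma> by (metis UNIV_I bij_betw_apply)
    then have "\<bar>(A *v k) $ j\<bar> < e / CARD('n) * norm k" for j using neg comp by (metis not_le)
    then have "(\<Sum>j\<in>UNIV. \<bar>(A *v k) $ j\<bar>) < (\<Sum>j\<in>(UNIV::'n set). e / CARD('n) * norm k)"
      by (intro sum_strict_mono) auto
    then have "norm (A *v k) < e * norm k" using norm_le_l1_cart[of "A *v k"] by simp
    then show False using e(2)[of k] by simp
  qed
  then show thesis using that[of "e / CARD('n)"] e(1) by simp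
qed

text \<open>All lower bounds come from the single point \<open>t0\<close>: nearby, the derivatives
  up to the dimension differ from their values at \<open>t0\<close> by less than \<open>d\<close>,
  which costs at most half of each bound. In particular the order \<open>m\<close> found for
  \<open>k\<close> at \<open>t0\<close> serves at all nearby \<open>t\<close>.\<close>

lemma arc_near_parameter:
  fixes \<gamma> :: "real \<Rightarrow> real ^ 'n"
  assumes V: "open V" "t0 \<in> V" and diff: "\<And>k t. t \<in> V \<Longrightarrow> vderiv k \<gamma> differentiable (at t)"
    and v: "vderiv 1 \<gamma> t0 \<noteq> 0"
    and \<sigma>: "bij_betw \<sigma> UNIV {1..CARD('n)}" and det: "det (\<chi> i j. vderiv (\<sigma> j) \<gamma> t0 $ i) \<noteq> 0"
  obtains e where "0 < e"
    "\<And>a b. a < b \<Longrightarrow> {a..b} \<subseteq> {t0 - e..t0 + e} \<Longrightarrow> \<exists>c B. nondegenerate_arc (\<lambda>j. vderiv j \<gamma>) a b c B"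
proof -
  define G where "G j = vderiv j \<gamma>" for j
  have dG: "(G j has_vector_derivative G (Suc j) t) (at t)" if "t \<in> V" for j t
    using diff[OF that, of j] by (simp add: G_def vderiv_def vector_derivative_works[symmetric])
  have cG: "isCont (G j) t" if "t \<in> V" for j t
    using dG[OF that] has_vector_derivative_continuous by blast
  obtain c0 where c0: "0 < c0" "\<And>k. \<exists>m\<in>{1..CARD('n)}. c0 * norm k \<le> \<bar>k \<bullet> G m t0\<bar>"
    using matrix_columns_bounded_below[OF \<sigma> det] unfolding G_def by blast
  define d where "d = min (c0 / 2) (norm (G 1 t0) / 2)"
  have d: "d > 0" using c0 v by (simp add: d_def G_def)
  have "\<forall>\<^sub>F t in at t0. dist (G j t) (G j t0) < d" for j
    using cG[OF V(2), of j] d by (auto simp: isCont_def intro: tendstoD)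
  then have "\<forall>\<^sub>F t in at t0. \<forall>j\<in>{..CARD('n)}. dist (G j t) (G j t0) < d"
    by (simp add: eventually_ball_finite_distrib)
  moreover have "\<forall>\<^sub>F t in at t0. t \<in> V"
    using V by (auto intro: eventually_at_in_open')
  ultimately have "\<forall>\<^sub>F t in at t0. (\<forall>j\<in>{..CARD('n)}. dist (G j t) (G j t0) < d) \<and> t \<in> V"
    by (rule eventually_conj)
  then obtain e0 where e0: "e0 > 0" "\<And>t. t \<noteq> t0 \<Longrightarrow> dist t t0 < e0 \<Longrightarrow> (\<forall>j\<in>{..CARD('n)}. dist (G j t) (G j t0) < d) \<and> t \<in> V"
    unfolding eventually_at by auto
  define e where "e = e0 / 2"
  have e: "e > 0" using e0 by (simp add: e_def)
  have near: "t \<in> V" "j \<le> CARD('n) \<Longrightarrow> norm (G j t - G j t0) < d" if t: "t \<in> {t0 - e..t0 + e}" for t j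
  proof -
    have "dist t t0 < e0" using t e0 by (auto simp: dist_real_def e_def abs_less_iff)
    then show "t \<in> V" "j \<le> CARD('n) \<Longrightarrow> norm (G j t - G j t0) < d"
      using e0(2)[of t] V d by (cases "t = t0"; auto simp: dist_norm)+
  qed
  have "\<exists>c B. nondegenerate_arc G a b c B" if ab: "a < b" and sub: "{a..b} \<subseteq> {t0 - e..t0 + e}" for a b
  proof -
    have "\<exists>K. \<forall>t\<in>{a..b}. norm (G j t) \<le> K" for j
    proof -
      have "continuous_on {a..b} (G j)" using cG near(1) sub by (intro continuous_at_imp_continuous_on) auto
      then have "compact (G j ` {a..b})" by (intro compact_continuous_image) auto
      then show ?thesis using compact_imp_bounded bounded_iff by (metis imageI)
    qed
    then obtain K where K: "\<And>j t. t \<in> {a..b} \<Longrightarrow> norm (G j t) \<le> K j" by metis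
    define B where "B = Max (K ` {..Suc CARD('n)})"
    have "nondegenerate_arc G a b d B"
    proof
      show "a < b" "0 < d" by fact+
    next
      fix t j assume "t \<in> {a..b}"
      then show "(G j has_vector_derivative G (Suc j) t) (at t within {a..b})"
        using dG near(1) sub by (meson has_vector_derivative_at_within subsetD)
    next
      fix t j assume t: "t \<in> {a..b}" and j: "j \<le> Suc CARD('n)"
      have "K j \<le> B" unfolding B_def using j by (intro Max_ge) auto
      then show "norm (G j t) \<le> B" using K[OF t, of j] by linarith
    next
      fix k :: "real ^ 'n"
      obtain m where m: "m \<in> {1..CARD('n)}" "c0 * norm k \<le> \<bar>k \<bullet> G m t0\<bar>" using c0(2) by blast
      have "d * norm k \<le> \<bar>k \<bullet> G m t\<bar>" if t: "t \<in> {a..b}" for t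
      proof -
        have "\<bar>k \<bullet> (G m t - G m t0)\<bar> \<le> norm k * norm (G m t - G m t0)" by (rule Cauchy_Schwarz_ineq2)
        also have "\<dots> \<le> norm k * (c0 / 2)"
        proof (rule mult_left_mono)
          have "norm (G m t - G m t0) < d" using near(2) t sub m by auto
          then show "norm (G m t - G m t0) \<le> c0 / 2" by (simp add: d_def)
        qed simp
        finally have "\<bar>k \<bullet> G m t - k \<bullet> G m t0\<bar> \<le> norm k * (c0 / 2)" by (simp add: inner_diff_right)
        moreover have "d * norm k \<le> c0 / 2 * norm k" by (rule mult_right_mono) (auto simp: d_def)
        moreover have "\<bar>k \<bullet> G m t0\<bar> \<le> \<bar>k \<bullet> G m t\<bar> + \<bar>k \<bullet> G m t - k \<bullet> G m t0\<bar>" by linarith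
        moreover have "norm k * (c0 / 2) + c0 / 2 * norm k = c0 * norm k" by simp
        ultimately show ?thesis using m(2) by linarith
      qed
      then show "\<exists>m\<in>{1..CARD('n)}. \<forall>t\<in>{a..b}. d * norm k \<le> \<bar>k \<bullet> G m t\<bar>" using m(1) by blast
    next
      fix s t assume st: "s \<in> {a..b}" "t \<in> {a..b}"
      \<comment> \<open>The chord bound follows by projecting to the fixed direction
        \<open>w\<close>, along which the inner product advances at rate at least
        \<open>|w|^2 / 2\<close>.\<close>
      define w where "w = G 1 t0"
      have w: "norm w > 0" using v by (simp add: w_def G_def)
      have slope: "norm w * (norm w / 2) \<le> w \<bullet> G 1 x" if x: "x \<in> {a..b}" for x
      proof -
        have "\<bar>w \<bullet> (G 1 x - w)\<bar> \<le> norm w * norm (G 1 x - w)" by (rule Cauchy_Schwarz_ineq2)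
        also have "\<dots> \<le> norm w * (norm w / 2)"
        proof (rule mult_left_mono)
          have "norm (G 1 x - w) < d" unfolding w_def using near(2)[of x 1] x sub by (auto simp: Suc_leI)
          then show "norm (G 1 x - w) \<le> norm w / 2" by (simp add: d_def w_def)
        qed simp
        finally have "\<bar>w \<bullet> G 1 x - norm w * norm w\<bar> \<le> norm w * (norm w / 2)"
          by (simp add: inner_diff_right power2_norm_eq_inner[symmetric] power2_eq_square)
        then have "norm w * norm w - norm w * (norm w / 2) \<le> w \<bullet> G 1 x" unfolding abs_le_iff by linarith
        then show ?thesis by simp
      qed
      have mono: "norm w * (norm w / 2) * (t' - s') \<le> w \<bullet> (G 0 t' - G 0 s')"
        if "s' \<in> {a..b}" "t' \<in> {a..b}" "s' < t'" for s' t'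
      proof -
        have "\<exists>z. z > s' \<and> z < t' \<and> w \<bullet> G 0 t' - w \<bullet> G 0 s' = (t' - s') * (w \<bullet> G 1 z)"
        proof (rule MVT2[OF that(3)])
          fix x assume x: "s' \<le> x" "x \<le> t'"
          then have "x \<in> V" using near(1)[of x] that sub by auto
          then show "((\<lambda>x. w \<bullet> G 0 x) has_real_derivative w \<bullet> G 1 x) (at x)"
            unfolding has_real_derivative_iff_has_vector_derivative
            using bounded_linear.has_vector_derivative[OF bounded_linear_inner_right dG[of x 0]] by simp
        qed
        then obtain z where z: "z > s'" "z < t'" "w \<bullet> G 0 t' - w \<bullet> G 0 s' = (t' - s') * (w \<bullet> G 1 z)" by blast
        have "norm w * (norm w / 2) \<le> w \<bullet> G 1 z" using z that by (intro slope) auto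
        then have "(t' - s') * (norm w * (norm w / 2)) \<le> (t' - s') * (w \<bullet> G 1 z)"
          using that by (intro mult_left_mono) auto
        then show ?thesis using z(3) by (simp add: inner_diff_right mult.commute)
      qed
      have "norm w * ((norm w / 2) * \<bar>s - t\<bar>) \<le> \<bar>w \<bullet> (G 0 s - G 0 t)\<bar>"
      proof (cases s t rule: linorder_cases)
        case less
        have "w \<bullet> (G 0 t - G 0 s) = - (w \<bullet> (G 0 s - G 0 t))" by (simp add: inner_diff_right)
        moreover have "\<bar>s - t\<bar> = t - s" using less by simp
        moreover have "norm w * ((norm w / 2) * (t - s)) \<le> w \<bullet> (G 0 t - G 0 s)"
          using mono[OF st less] by (simp only: mult.assoc)
        ultimately show ?thesis using abs_ge_minus_self[of "w \<bullet> (G 0 s - G 0 t)"] by simp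
      next
        case greater
        then have "\<bar>s - t\<bar> = s - t" by simp
        moreover have "norm w * ((norm w / 2) * (s - t)) \<le> w \<bullet> (G 0 s - G 0 t)"
          using mono[OF st(2,1) greater] by (simp only: mult.assoc)
        ultimately show ?thesis using abs_ge_self[of "w \<bullet> (G 0 s - G 0 t)"] by simp
      qed simp
      also have "\<dots> \<le> norm w * norm (G 0 s - G 0 t)" by (rule Cauchy_Schwarz_ineq2)
      finally have "(norm w / 2) * \<bar>s - t\<bar> \<le> norm (G 0 s - G 0 t)" using w by (simp only: mult_le_cancel_left_pos)
      moreover have "d * \<bar>s - t\<bar> \<le> (norm w / 2) * \<bar>s - t\<bar>" by (rule mult_right_mono) (auto simp: d_def w_def)
      ultimately show "d * \<bar>s - t\<bar> \<le> norm (G 0 s - G 0 t)" by linarith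
    qed
    then show ?thesis by blast
  qed
  then show thesis using that[OF e] by (simp add: G_def[abs_def])
qed

text \<open>\<open>W\<close> comes from the chart being an open map onto a relatively open part of
  \<open>M\<close>; this keeps other stretches of the curve out of \<open>W\<close>.\<close>

lemma arc_neighbourhood:
  fixes M :: "(real ^ 'n) set"
  assumes M: "compact_smooth_curve M" "nondegenerate M" and x: "x \<in> M"
  obtains W G a b c B where "open W" "x \<in> W" "nondegenerate_arc G a b c B"
    "M \<inter> W \<subseteq> G 0 ` {a..b}" "G 0 ` {a..b} \<subseteq> M"
proof -
  obtain U \<gamma> where lp: "local_parametrization M U \<gamma>" and xU: "x \<in> \<gamma> ` U"
    using M(1) x unfolding compact_smooth_curve_def by blast
  obtain t0 where t0: "t0 \<in> U" "x = \<gamma> t0" using xU by auto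
  obtain V where V: "open V" "U \<subseteq> V" "\<And>k t. t \<in> V \<Longrightarrow> vderiv k \<gamma> differentiable (at t)"
    using lp unfolding local_parametrization_def smooth_on_def by blast
  obtain \<phi> where hom: "homeomorphism U (\<gamma> ` U) \<gamma> \<phi>" using lp unfolding local_parametrization_def by blast
  have opM: "openin (top_of_set M) (\<gamma> ` U)" using lp unfolding local_parametrization_def by blast
  obtain \<sigma> :: "'n \<Rightarrow> nat" where \<sigma>: "bij_betw \<sigma> UNIV {1..CARD('n)}"
    using finite_same_card_bij[of "UNIV :: 'n set" "{1..CARD('n)}"] by auto
  have det: "det (\<chi> i j. vderiv (\<sigma> j) \<gamma> t0 $ i) \<noteq> 0"
    using M(2) lp t0(1) \<sigma> unfolding nondegenerate_def by blast
  have v: "vderiv 1 \<gamma> t0 \<noteq> 0" using lp t0 unfolding local_parametrization_def by blast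
  obtain e where e: "0 < e"
    "\<And>a b. a < b \<Longrightarrow> {a..b} \<subseteq> {t0 - e..t0 + e} \<Longrightarrow> \<exists>c B. nondegenerate_arc (\<lambda>j. vderiv j \<gamma>) a b c B"
    by (rule arc_near_parameter[OF V(1) _ V(3) v \<sigma> det]) (use t0 V in auto)
  \<comment> \<open>A closed interval in \<open>U\<close> containing a relative neighbourhood of
    \<open>t0\<close>. In a half-line chart it is cut at 0, so at a boundary point it extends to one
    side only, still with \<open>a < b\<close>.\<close>
  have "\<exists>e' a b. 0 < e' \<and> e' \<le> e \<and> a < b \<and> {a..b} \<subseteq> U \<and> {a..b} \<subseteq> {t0 - e'..t0 + e'} \<and> U \<inter> {t0 - e'<..<t0 + e'} \<subseteq> {a..b}"
  proof (cases "open U")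
    case True
    then obtain r where r: "r > 0" "cball t0 r \<subseteq> U" using t0 open_contains_cball by blast
    define e' where "e' = min e r"
    have "{t0 - e'..t0 + e'} \<subseteq> U" using r by (auto simp: e'_def cball_def dist_real_def subset_eq)
    then show ?thesis using r e(1)
      by (intro exI[of _ e'] exI[of _ "t0 - e'"] exI[of _ "t0 + e'"]) (auto simp: e'_def)
  next
    case False
    then have "openin (top_of_set {0..}) U" using lp unfolding local_parametrization_def by blast
    then obtain Y where Y: "open Y" "U = {0..} \<inter> Y" by (auto simp: openin_open)
    then obtain r where r: "r > 0" "cball t0 r \<subseteq> Y" using t0 open_contains_cball by blast
    define e' where "e' = min e r"
    have "{t0 - e'..t0 + e'} \<subseteq> Y" using r by (auto simp: e'_def cball_def dist_real_def subset_eq)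
    moreover have "t0 \<ge> 0" using t0 Y by auto
    ultimately show ?thesis using r e(1) Y(2)
      by (intro exI[of _ e'] exI[of _ "max 0 (t0 - e')"] exI[of _ "t0 + e'"]) (auto simp: e'_def)
  qed
  then obtain e' a b where ab: "0 < e'" "e' \<le> e" "a < b" "{a..b} \<subseteq> U" "{a..b} \<subseteq> {t0 - e'..t0 + e'}"
    "U \<inter> {t0 - e'<..<t0 + e'} \<subseteq> {a..b}" by blast
  have "{a..b} \<subseteq> {t0 - e..t0 + e}" using ab(2,5) by force
  then obtain c B where arc: "nondegenerate_arc (\<lambda>j. vderiv j \<gamma>) a b c B" using e(2)[OF ab(3)] by blast
  have "openin (top_of_set U) (U \<inter> {t0 - e'<..<t0 + e'})" by (simp add: openin_open_Int)
  then have "openin (top_of_set (\<gamma> ` U)) (\<gamma> ` (U \<inter> {t0 - e'<..<t0 + e'}))"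
    by (rule homeomorphism_imp_open_map[OF hom])
  then have "openin (top_of_set M) (\<gamma> ` (U \<inter> {t0 - e'<..<t0 + e'}))" using opM openin_trans by blast
  then obtain W where W: "open W" "\<gamma> ` (U \<inter> {t0 - e'<..<t0 + e'}) = M \<inter> W" by (auto simp: openin_open)
  have v0: "vderiv 0 \<gamma> = \<gamma>" by (simp add: vderiv_def)
  show thesis
  proof (rule that[OF W(1) _ arc])
    show "x \<in> W" using W(2) t0 ab(1) by force
    show "M \<inter> W \<subseteq> vderiv 0 \<gamma> ` {a..b}" unfolding v0 W(2)[symmetric] using ab(6) by (rule image_mono)
    show "vderiv 0 \<gamma> ` {a..b} \<subseteq> M" unfolding v0 using ab(4) openin_imp_subset[OF opM] by auto
  qed
qed

text \<open>The parameter-free form of \<open>near\<close>, in which different arcs and the whole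
  curve can be compared.\<close>

definition near_set :: "(real ^ 'n) set \<Rightarrow> real \<Rightarrow> real \<Rightarrow> (real ^ 'n) set" where
  "near_set S q \<delta> = {k \<in> lattice. \<exists>y\<in>S. norm (k - q *\<^sub>R y) \<le> \<delta>}"

lemma (in nondegenerate_arc) near_eq: "near q \<delta> = near_set (G 0 ` {a..b}) q \<delta>"
  by (auto simp: near_def near_set_def)

text \<open>The infimum in the distance is attained because the dilated curve is compact, so a
  distance at most \<open>\<delta>\<close> is realised by a point of the curve.\<close>

lemma lattice_count_eq:
  assumes "compact M" "M \<noteq> {}"
  shows "lattice_count M q \<delta> = card (near_set M q \<delta>)"
proof -
  have "compact ((\<lambda>x. q *\<^sub>R x) ` M)" using assms(1) by (rule compact_scaling)
  then have cl: "closed ((\<lambda>x. q *\<^sub>R x) ` M)" by (rule compact_imp_closed)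
  have ne: "(\<lambda>x. q *\<^sub>R x) ` M \<noteq> {}" using assms by simp
  have "infdist k ((\<lambda>x. q *\<^sub>R x) ` M) \<le> \<delta> \<longleftrightarrow> (\<exists>y\<in>M. norm (k - q *\<^sub>R y) \<le> \<delta>)" for k
  proof
    assume "infdist k ((\<lambda>x. q *\<^sub>R x) ` M) \<le> \<delta>"
    moreover obtain z where "z \<in> (\<lambda>x. q *\<^sub>R x) ` M" "infdist k ((\<lambda>x. q *\<^sub>R x) ` M) = dist k z"
      by (rule infdist_attains_inf[OF cl ne])
    ultimately show "\<exists>y\<in>M. norm (k - q *\<^sub>R y) \<le> \<delta>" by (auto simp: dist_norm)
  next
    assume "\<exists>y\<in>M. norm (k - q *\<^sub>R y) \<le> \<delta>"
    then obtain y where "y \<in> M" "dist k (q *\<^sub>R y) \<le> \<delta>" by (auto simp: dist_norm)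
    then show "infdist k ((\<lambda>x. q *\<^sub>R x) ` M) \<le> \<delta>"
      by (intro infdist_le2[of "q *\<^sub>R y"]) auto
  qed
  then show ?thesis by (simp add: lattice_count_def near_set_def lattice_def)
qed

theorem theorem1p6:
  fixes M :: "(real ^ 'n) set"
  assumes "CARD('n) \<ge> 3"
    and "compact_smooth_curve M"
    and "nondegenerate M"
  shows "(\<forall>\<nu>>0. \<forall>\<Delta>>0. \<exists>C>0. \<forall>\<delta>. 0 \<le> \<delta> \<and> \<delta> < \<Delta> \<longrightarrow> (\<forall>q\<ge>1.
            real (lattice_count M q \<delta>)
              \<le> C * (\<delta> ^ (CARD('n) - 1) * q + q powr (Theta CARD('n) + \<nu>))))
       \<and> (\<exists>C\<^sub>0>0. \<exists>c>0. \<forall>\<nu>>0. \<exists>Q\<^sub>0>0. \<forall>q\<ge>1. q > Q\<^sub>0 \<longrightarrow>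
            (\<forall>\<delta>. \<delta> > C\<^sub>0 * q powr ((Theta CARD('n) - 1) / (real CARD('n) - 1) + \<nu>) \<longrightarrow>
               real (lattice_count M q \<delta>) \<ge> c * \<delta> ^ (CARD('n) - 1) * q))"
proof -
  have cM: "compact M" "M \<noteq> {}" using assms(2) by (auto simp: compact_smooth_curve_def)
  define arcs where "arcs = {S. \<exists>G a b c B. nondegenerate_arc G a b c B \<and> S = G 0 ` {a..b} \<and> S \<subseteq> M}"
  have "\<exists>W S. open W \<and> x \<in> W \<and> S \<in> arcs \<and> M \<inter> W \<subseteq> S" if "x \<in> M" for x
    using arc_neighbourhood[OF assms(2,3) that] unfolding arcs_def by (smt (verit) mem_Collect_eq)
  then obtain W S where WS: "\<And>x. x \<in> M \<Longrightarrow> open (W x)" "\<And>x. x \<in> M \<Longrightarrow> x \<in> W x"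
    "\<And>x. x \<in> M \<Longrightarrow> S x \<in> arcs" "\<And>x. x \<in> M \<Longrightarrow> M \<inter> W x \<subseteq> S x"
    by metis
  obtain X where X: "X \<subseteq> M" "finite X" "M \<subseteq> (\<Union>x\<in>X. W x)"
    by (rule compactE_image[OF cM(1), of M W]) (use WS in auto)
  have cover: "near_set M q \<delta> \<subseteq> (\<Union>x\<in>X. near_set (S x) q \<delta>)" for q \<delta>
    using X WS(4) by (fastforce simp: near_set_def)
  have finS: "finite (near_set S' q \<delta>)" if "S' \<in> arcs" for S' q \<delta>
    using that nondegenerate_arc.finite_near nondegenerate_arc.near_eq unfolding arcs_def by fastforce
  have finM: "finite (near_set M q \<delta>)" for q \<delta>
    by (rule finite_subset[OF cover]) (use X WS finS in auto)
  \<comment> \<open>The finitely many arcs may overlap; adding their counts, and hence their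
    constants, is harmless for an upper bound.\<close>
  have upper: "\<exists>C>0. \<forall>\<delta>. 0 \<le> \<delta> \<and> \<delta> < \<Delta> \<longrightarrow> (\<forall>q\<ge>1. real (lattice_count M q \<delta>)
      \<le> C * (\<delta> ^ (CARD('n) - 1) * q + q powr (Theta CARD('n) + \<nu>)))" if \<nu>: "\<nu> > 0" and \<Delta>: "\<Delta> > 0" for \<nu> \<Delta>
  proof -
    have "\<exists>C>0. \<forall>\<delta> q. 0 \<le> \<delta> \<and> \<delta> < \<Delta> \<and> 1 \<le> q \<longrightarrow> real (card (near_set (S x) q \<delta>))
        \<le> C * (\<delta> ^ (CARD('n) - 1) * q + q powr (Theta CARD('n) + \<nu>))" if xX: "x \<in> X" for x
    proof -
      obtain G a b c B where arc: "nondegenerate_arc G a b c B" and Sx: "S x = G 0 ` {a..b}"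
        using WS(3)[of x] xX X(1) unfolding arcs_def by blast
      interpret nondegenerate_arc G a b c B by (rule arc)
      show ?thesis using near_upper_bound[OF assms(1) \<nu> \<Delta>] unfolding near_eq Sx .
    qed
    then obtain C where C: "\<And>x. x \<in> X \<Longrightarrow> C x > 0"
      "\<And>x \<delta> q. x \<in> X \<Longrightarrow> 0 \<le> \<delta> \<Longrightarrow> \<delta> < \<Delta> \<Longrightarrow> 1 \<le> q \<Longrightarrow> real (card (near_set (S x) q \<delta>))
        \<le> C x * (\<delta> ^ (CARD('n) - 1) * q + q powr (Theta CARD('n) + \<nu>))" by metis
    have "real (lattice_count M q \<delta>) \<le> (\<Sum>x\<in>X. C x) * (\<delta> ^ (CARD('n) - 1) * q + q powr (Theta CARD('n) + \<nu>))"
      if "0 \<le> \<delta>" "\<delta> < \<Delta>" "q \<ge> 1" for \<delta> q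
    proof -
      have "card (near_set M q \<delta>) \<le> card (\<Union>x\<in>X. near_set (S x) q \<delta>)"
        by (rule card_mono[OF _ cover]) (use X WS finS in auto)
      also have "\<dots> \<le> (\<Sum>x\<in>X. card (near_set (S x) q \<delta>))" by (rule card_UN_le[OF X(2)])
      finally have "real (card (near_set M q \<delta>)) \<le> (\<Sum>x\<in>X. real (card (near_set (S x) q \<delta>)))"
        using of_nat_mono by fastforce
      also have "\<dots> \<le> (\<Sum>x\<in>X. C x * (\<delta> ^ (CARD('n) - 1) * q + q powr (Theta CARD('n) + \<nu>)))"
        by (rule sum_mono) (use C that in auto)
      finally show ?thesis by (simp add: lattice_count_eq[OF cM] sum_distrib_right)
    qed
    moreover have "X \<noteq> {}" using X cM by auto
    then have "(\<Sum>x\<in>X. C x) > 0" using X(2) C(1) by (intro sum_pos) auto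
    ultimately show ?thesis by blast
  qed
  \<comment> \<open>A single arc inside \<open>M\<close> suffices. The constant in front of the
    power of \<open>q\<close> can be 1, since \<open>near_lower_bound\<close> has put all such
    losses into \<open>Q\<close>.\<close>
  have lower: "\<exists>c>0. \<forall>\<nu>>0. \<exists>Q>0. \<forall>q\<ge>1. q > Q \<longrightarrow>
      (\<forall>\<delta>. q powr ((Theta CARD('n) - 1) / (real CARD('n) - 1) + \<nu>) < \<delta> \<longrightarrow>
        c * \<delta> ^ (CARD('n) - 1) * q \<le> real (lattice_count M q \<delta>))"
  proof -
    obtain x where "x \<in> M" using cM by blast
    then have "S x \<in> arcs" by (rule WS(3))
    then obtain G a b c B where arc: "nondegenerate_arc G a b c B" "S x = G 0 ` {a..b}" "S x \<subseteq> M"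
      unfolding arcs_def by blast
    then have sub: "G 0 ` {a..b} \<subseteq> M" by simp
    interpret nondegenerate_arc G a b c B by (rule arc(1))
    have "near q \<delta> \<subseteq> near_set M q \<delta>" for q \<delta>
      unfolding near_eq using sub by (auto simp: near_set_def)
    then have le: "real (card (near q \<delta>)) \<le> real (lattice_count M q \<delta>)" for q \<delta>
      unfolding lattice_count_eq[OF cM] of_nat_le_iff by (intro card_mono finM)
    obtain c0 where c0: "c0 > 0" "\<forall>\<nu>>0. \<exists>Q>0. \<forall>q\<ge>1. q > Q \<longrightarrow>
        (\<forall>\<delta>. q powr ((Theta CARD('n) - 1) / (real CARD('n) - 1) + \<nu>) < \<delta> \<longrightarrow>
          c0 * \<delta> ^ (CARD('n) - 1) * q \<le> real (card (near q \<delta>)))"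
      using near_lower_bound[OF assms(1)] by blast
    show ?thesis
    proof (rule exI[of _ c0], intro conjI allI impI c0(1))
      fix \<nu> :: real assume "\<nu> > 0"
      then obtain Q where "Q > 0" "\<forall>q\<ge>1. q > Q \<longrightarrow>
        (\<forall>\<delta>. q powr ((Theta CARD('n) - 1) / (real CARD('n) - 1) + \<nu>) < \<delta> \<longrightarrow>
          c0 * \<delta> ^ (CARD('n) - 1) * q \<le> real (card (near q \<delta>)))" using c0(2) by blast
      then show "\<exists>Q>0. \<forall>q\<ge>1. q > Q \<longrightarrow>
        (\<forall>\<delta>. q powr ((Theta CARD('n) - 1) / (real CARD('n) - 1) + \<nu>) < \<delta> \<longrightarrow>
          c0 * \<delta> ^ (CARD('n) - 1) * q \<le> real (lattice_count M q \<delta>))"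
        using order_trans[OF _ le] by (intro exI[of _ Q]) blast
    qed
  qed
  show ?thesis
  proof (rule conjI)
    show "\<exists>C\<^sub>0>0. \<exists>c>0. \<forall>\<nu>>0. \<exists>Q\<^sub>0>0. \<forall>q\<ge>1. q > Q\<^sub>0 \<longrightarrow>
        (\<forall>\<delta>. \<delta> > C\<^sub>0 * q powr ((Theta CARD('n) - 1) / (real CARD('n) - 1) + \<nu>) \<longrightarrow>
          real (lattice_count M q \<delta>) \<ge> c * \<delta> ^ (CARD('n) - 1) * q)"
      by (rule exI[of _ 1], rule conjI, rule zero_less_one, unfold mult_1, rule lower)
  qed (intro allI impI upper)
qed

end
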